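(* Let $\Sigma$ be a fan in $N_{\mathbb R}$ and let $I\subseteq \mathrm{Cox}(\mathrm{trop}(X_\Sigma))$ be a locally tropical ideal. Then $I$ has a finite tropical basis; that is, there exist finitely many homogeneous polynomials $f_1,\dots,f_l\in I$ such that $$V_\Sigma(I)=V_\Sigma(f_1)\cap V_\Sigma(f_2)\cap\dots\cap V_\Sigma(f_l).$$
   Context: $\overline{\mathbb R}=(\mathbb R\cup\{\infty\},\oplus=\min,\odot=+)$ is the tropical semiring. Polynomials over $\overline{\mathbb R}$ are formal (not functions). An ideal of a semiring is a nonempty subset closed under addition and under multiplication by elements of the semiring. Tropical toric varieties. $N\cong\mathbb Z^n$ is a lattice, $M=\mathrm{Hom}(N,\mathbb Z)$, $N_{\mathbb R}=N\otimes\mathbb R$; a fan means a (finite) rational polyhedral fan, as in toric geometry. For $\sigma\in\Sigma$ put $N(\sigma)=N_{\mathbb R}/\mathrm{span}(\sigma)$, and $\mathrm{trop}(X_\Sigma)=\coprod_{\sigma\in\Sigma}N(\sigma)$. The space $U^{\mathrm{trop}}_\sigma=\mathrm{Hom}(\sigma^\vee\cap M,\overline{\mathbb R})$ of monoid homomorphisms to $(\overline{\mathbb R},\odot)$ is identified with $\coprod_{\tau\preceq\sigma}N(\tau)$: $\mathbf w\in N(\tau)$ is the homomorphism sending $\mathbf u$ to $\langle \mathbf u,\mathbf w\rangle$ if $\mathbf u\in\tau^\perp$ and to $\infty$ otherwise. Cox semiring. Let $s$ be the number of rays of $\Sigma$, $t=n-\dim\mathrm{span}(\Sigma)$, $m=s+t$,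 and $S=\mathrm{Cox}(\mathrm{trop}(X_\Sigma))=\overline{\mathbb R}[x_1,\dots,x_m]$. Write $N=N'\oplus N''$ where the rays of $\Sigma$ span $N'_{\mathbb R}$; $Q$ is an $m\times n$ matrix whose $i$th row for $i\le s$ is the first lattice point on the $i$th ray, and whose last $t$ rows form a basis of $N''$. $S$ is graded by $\mathrm{coker}(\mathbb Z^n\cong M\to\mathbb Z^m,\ \mathbf u\mapsto Q\mathbf u)$, with $\deg(x_i)$ the class of $\mathbf e_i$. Rays are identified with $\{1,\dots,s\}$ and cones with subsets of $\{1,\dots,s\}$. For $\sigma\in\Sigma$, $\mathbf x^{\hat\sigma}=\prod_{i\notin\sigma}x_i$ (product over $i\in\{1,\dots,m\}\setminus\sigma$). The degree-$\mathbf 0$ part of the localization satisfies $(S_{\mathbf x^{\hat\sigma}})_{\mathbf 0}\cong\overline{\mathbb R}[\sigma^\vee\cap M]$, with $\mathbf x^{Q\mathbf u}$ corresponding to $\mathbf u$. Tropical and locally tropical ideals. An ideal $J\subseteq\overline{\mathbb R}[\sigma^\vee\cap M]$ is a tropical ideal if for every finite set $E$ of monomials the set of polynomials in $J$ with support in $E$ is the set of vectors of a valuated matroid on $E$; equivalently, this set $\mathcal V$ satisfies: for $f,g\in\mathcal V$ and a monomial $e\in E$ at which $f,g$ have equal coefficients $\ne\infty$, there is $h\in\mathcal V$ whose coefficient at $e$ is $\infty$, whose coefficient at each $e'\in E$ is at least the minimum of those of $f$ and $g$, with equality whenever those of $f$ and $g$ at $e'$ differ. A homogeneous ideal $I\subseteq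 S$ is locally tropical if $(IS_{\mathbf x^{\hat\sigma}})_{\mathbf 0}\subseteq\overline{\mathbb R}[\sigma^\vee\cap M]$ is a tropical ideal for every $\sigma\in\Sigma$. Varieties. For a homogeneous ideal $I\subseteq S$ and $\sigma\in\Sigma$, let $I_{(\sigma)}=(IS_{\mathbf x^{\hat\sigma}}/\langle x_i\sim\infty:i\in\sigma\rangle)_{\mathbf 0}\subseteq\overline{\mathbb R}[\sigma^\perp\cap M]$ (the set of polynomials obtained from elements of $(IS_{\mathbf x^{\hat\sigma}})_{\mathbf 0}$ by deleting all terms divisible by some $x_i$, $i\in\sigma$). $V_\sigma(I)$ is the set of $\mathbf w\in N(\sigma)$ such that for every $f\in I_{(\sigma)}$, $f\neq\infty$, the minimum in $f(\mathbf w)$ is achieved at least twice, and $V_\Sigma(I)=\coprod_{\sigma}V_\sigma(I)\subseteq\mathrm{trop}(X_\Sigma)$. For $f\in S$, $V(f)=\{\mathbf w\in\overline{\mathbb R}^m: f(\mathbf w)=\infty$ or the minimum in $f(\mathbf w)$ is achieved at least twice$\}$. Let $\mathrm{trop}(B_\Sigma)=\langle\mathbf x^{\hat\sigma}:\sigma\in\Sigma\rangle$, with $V(\mathrm{trop}(B_\Sigma))=\bigcap_{g\in\mathrm{trop}(B_\Sigma)}V(g)$, so that its complement consists of the $\mathbf w$ for which there is $\sigma\in\Sigma$ with $w_i<\infty$ for all $i\notin\sigma$. There is the quotient description $\mathrm{trop}(X_\Sigma)=(\overline{\mathbb R}^m\setminus V(\mathrm{trop}(B_\Sigma)))/\ker(Q^T)$;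 the quotient map sends $\mathbf w$ with $w_i<\infty$ for all $i\notin\sigma$ to the point $\mathbf u\mapsto\sum_i(Q\mathbf u)_iw_i$ of $U_\sigma^{\mathrm{trop}}$ (with $\infty\cdot0=0$). It identifies $N(\sigma)$ with $\overline{\mathbb R}^m_\sigma/\ker(Q^T)$, where $\overline{\mathbb R}^m_\sigma=\{\mathbf w: w_i=\infty\iff i\in\sigma\}$. For homogeneous $f\in S$, $V_\Sigma(f)=(V(f)\setminus V(\mathrm{trop}(B_\Sigma)))/\ker(Q^T)$, i.e. the image of $V(f)\setminus V(\mathrm{trop}(B_\Sigma))$ under the quotient map. *)

theory Defs
  imports "HOL-Analysis.Analysis" "HOL-Library.Poly_Mapping"
begin

section \<open>The tropical semiring\<close>

text \<open>
  The class operations are the tropical ones: \<open>+\<close> is the minimum, \<open>*\<close> is the addition of real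
  numbers, \<open>0\<close> is \<open>\<infinity>\<close> and \<open>1\<close> is the real number zero; likewise \<open>\<Sum>\<close> is a minimum and \<open>\<Prod>\<close> an
  ordinary sum.  Hence \<open>'k \<Rightarrow>\<^sub>0 trop\<close> is the semiring of formal polynomials with exponents in the
  monoid \<open>'k\<close>, and \<open>keys f\<close> is the set of exponents whose coefficient is not \<open>\<infinity>\<close>.
\<close>

datatype trop = TReal real | TInf

instantiation trop :: comm_semiring_1
begin

definition zero_trop :: trop where "0 = TInf"
definition one_trop :: trop where "1 = TReal 0"

fun plus_trop :: "trop \<Rightarrow> trop \<Rightarrow> trop" where
  "TReal x + TReal y = TReal (min x y)"
| "TInf + y = y"
| "x + TInf = x"

fun times_trop :: "trop \<Rightarrow> trop \<Rightarrow> trop" where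
  "TReal x * TReal y = TReal (x + y)"
| "TInf * y = TInf"
| "x * TInf = TInf"

instance
proof
  fix a b c :: trop
  show "a + b + c = a + (b + c)" by (cases a; cases b; cases c) (auto simp: min.assoc)
  show "a + b = b + a" by (cases a; cases b) (auto simp: min.commute)
  show "0 + a = a" by (cases a) (auto simp: zero_trop_def)
  show "a * b * c = a * (b * c)" by (cases a; cases b; cases c) auto
  show "a * b = b * a" by (cases a; cases b) auto
  show "1 * a = a" by (cases a) (auto simp: one_trop_def)
  show "(a + b) * c = a * c + b * c"
    by (cases a; cases b; cases c) (auto simp: min_add_distrib_left)
  show "0 * a = 0" by (cases a) (auto simp: zero_trop_def)
  show "a * 0 = 0" by (cases a) (auto simp: zero_trop_def)
  show "(0::trop) \<noteq> 1" by (auto simp: zero_trop_def one_trop_def)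
qed

end

instantiation trop :: linorder
begin

fun less_eq_trop :: "trop \<Rightarrow> trop \<Rightarrow> bool" where
  "TReal x \<le> TReal y \<longleftrightarrow> x \<le> y"
| "x \<le> TInf \<longleftrightarrow> True"
| "TInf \<le> TReal y \<longleftrightarrow> False"

definition less_trop :: "trop \<Rightarrow> trop \<Rightarrow> bool" where
  "x < y \<longleftrightarrow> x \<le> y \<and> \<not> y \<le> (x::trop)"

instance
proof
  fix a b c :: trop
  show "a < b \<longleftrightarrow> a \<le> b \<and> \<not> b \<le> a" by (rule less_trop_def)
  show "a \<le> a" by (cases a) auto
  show "a \<le> b \<Longrightarrow> b \<le> c \<Longrightarrow> a \<le> c" by (cases a; cases b; cases c) auto
  show "a \<le> b \<Longrightarrow> b \<le> a \<Longrightarrow> a = b" by (cases a; cases b) auto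
  show "a \<le> b \<or> b \<le> a" by (cases a; cases b) auto
qed

end

text \<open>The ordinary product \<open>c \<cdot> x\<close>, that is, the tropical power, with the convention \<open>0 \<cdot> \<infinity> = 0\<close>.\<close>

fun trop_scale :: "real \<Rightarrow> trop \<Rightarrow> trop" where
  "trop_scale c (TReal x) = TReal (c * x)"
| "trop_scale c TInf = (if c = 0 then TReal 0 else TInf)"

text \<open>The minimum of the terms \<open>t a\<close>, for \<open>a\<close> in the finite set \<open>A\<close>, is achieved at least twice.\<close>

definition min_twice :: "'k set \<Rightarrow> ('k \<Rightarrow> trop) \<Rightarrow> bool" where
  "min_twice A t \<longleftrightarrow> (\<exists>a\<in>A. \<exists>b\<in>A. a \<noteq> b \<and> t a = (\<Sum>c\<in>A. t c) \<and> t b = (\<Sum>c\<in>A. t c))"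


section \<open>Polynomials and ideals\<close>

abbreviation lookup :: "('k \<Rightarrow>\<^sub>0 'b::zero) \<Rightarrow> 'k \<Rightarrow> 'b" where "lookup \<equiv> Poly_Mapping.lookup"
abbreviation keys :: "('k \<Rightarrow>\<^sub>0 'b::zero) \<Rightarrow> 'k set" where "keys \<equiv> Poly_Mapping.keys"

definition polys_on :: "'k set \<Rightarrow> ('k \<Rightarrow>\<^sub>0 trop) set" where
  "polys_on P = {f. keys f \<subseteq> P}"

definition terms_in :: "'k set \<Rightarrow> ('k \<Rightarrow>\<^sub>0 trop) \<Rightarrow> ('k \<Rightarrow>\<^sub>0 trop)" where
  "terms_in D f = (\<Sum>a \<in> keys f \<inter> D. Poly_Mapping.single a (lookup f a))"

definition semiring_ideal :: "'r::comm_semiring_1 set \<Rightarrow> 'r set \<Rightarrow> bool" where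
  "semiring_ideal A J \<longleftrightarrow> J \<subseteq> A \<and> J \<noteq> {} \<and> (\<forall>f\<in>J. \<forall>g\<in>J. f + g \<in> J) \<and> (\<forall>r\<in>A. \<forall>f\<in>J. r * f \<in> J)"

definition ideal_generated :: "'r::comm_semiring_1 set \<Rightarrow> 'r set \<Rightarrow> 'r set" where
  "ideal_generated A G = \<Inter> {J. semiring_ideal A J \<and> G \<subseteq> J}"

definition tropical_ideal :: "'k::comm_monoid_add set \<Rightarrow> ('k \<Rightarrow>\<^sub>0 trop) set \<Rightarrow> bool" where
  "tropical_ideal P J \<longleftrightarrow> semiring_ideal (polys_on P) J \<and>
     (\<forall>E. finite E \<and> E \<subseteq> P \<longrightarrow>
        (\<forall>f \<in> J \<inter> polys_on E. \<forall>g \<in> J \<inter> polys_on E. \<forall>e\<in>E.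
           lookup f e = lookup g e \<and> lookup f e \<noteq> TInf \<longrightarrow>
           (\<exists>h \<in> J \<inter> polys_on E. lookup h e = TInf \<and>
              (\<forall>e'\<in>E. min (lookup f e') (lookup g e') \<le> lookup h e' \<and>
                 (lookup f e' \<noteq> lookup g e' \<longrightarrow>
                    lookup h e' = min (lookup f e') (lookup g e'))))))"


section \<open>Lattices and fans\<close>

text \<open>
  A lattice \<open>N\<close> is given inside a Euclidean space, whose dimension may exceed the rank \<open>n\<close> of \<open>N\<close>
  (so that \<open>n = 0\<close> is covered); \<open>N\<^sub>\<real>\<close> is \<open>span N\<close>.  The inner product identifies
  \<open>M = Hom(N, \<int>)\<close> with the dual lattice in \<open>span N\<close>.
\<close>

definition int_span :: "'a::real_vector set \<Rightarrow> 'a set" where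
  "int_span B = {\<Sum>b\<in>B. of_int (c b) *\<^sub>R b | c :: 'a \<Rightarrow> int. True}"

definition is_lattice :: "'a::euclidean_space set \<Rightarrow> bool" where
  "is_lattice N \<longleftrightarrow> (\<exists>B. finite B \<and> independent B \<and> N = int_span B)"

definition dual_lattice :: "'a::euclidean_space set \<Rightarrow> 'a set" where
  "dual_lattice N = {u \<in> span N. \<forall>v\<in>N. u \<bullet> v \<in> \<int>}"

text \<open>The monoid \<open>\<sigma>\<^sup>\<or> \<inter> M\<close>.\<close>

definition dual_monoid :: "'a::euclidean_space set \<Rightarrow> 'a set \<Rightarrow> 'a set" where
  "dual_monoid N \<sigma> = {u \<in> dual_lattice N. \<forall>v\<in>\<sigma>. 0 \<le> u \<bullet> v}"

text \<open>Strongly convex cones, as usual in toric geometry.\<close>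

definition rational_cone :: "'a::euclidean_space set \<Rightarrow> 'a set \<Rightarrow> bool" where
  "rational_cone N \<sigma> \<longleftrightarrow>
     (\<exists>G. finite G \<and> G \<subseteq> N \<and> \<sigma> = convex_cone hull G) \<and> \<sigma> \<inter> uminus ` \<sigma> = {0}"

text \<open>Note that \<open>{} face_of \<sigma>\<close> holds in the library, but \<open>{}\<close> is not a face of a cone.\<close>

definition is_fan :: "'a::euclidean_space set \<Rightarrow> 'a set set \<Rightarrow> bool" where
  "is_fan N \<Sigma> \<longleftrightarrow> finite \<Sigma> \<and>
     (\<forall>\<sigma>\<in>\<Sigma>. rational_cone N \<sigma>) \<and>
     (\<forall>\<sigma>\<in>\<Sigma>. \<forall>\<tau>. \<tau> face_of \<sigma> \<and> \<tau> \<noteq> {} \<longrightarrow> \<tau> \<in> \<Sigma>) \<and>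
     (\<forall>\<sigma>\<in>\<Sigma>. \<forall>\<tau>\<in>\<Sigma>. \<sigma> \<inter> \<tau> face_of \<sigma> \<and> \<sigma> \<inter> \<tau> face_of \<tau>)"

definition rays :: "'a::euclidean_space set set \<Rightarrow> 'a set set" where
  "rays \<Sigma> = {\<rho>\<in>\<Sigma>. dim \<rho> = 1}"

definition first_lattice_point :: "'a::euclidean_space set \<Rightarrow> 'a set \<Rightarrow> 'a \<Rightarrow> bool" where
  "first_lattice_point N \<rho> v \<longleftrightarrow>
     v \<in> \<rho> \<inter> N \<and> v \<noteq> 0 \<and> (\<forall>c::real. 0 < c \<and> c < 1 \<longrightarrow> c *\<^sub>R v \<notin> N)"

text \<open>
  \<open>q i\<close> is the \<open>i\<close>th row of the matrix \<open>Q\<close>, for \<open>i \<in> {1..s + t}\<close>.  Since \<open>N'\<close> is a direct summand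
  of \<open>N\<close>, it is the set of all lattice points in the span of the rays.
\<close>

definition cox_matrix ::
  "'a::euclidean_space set \<Rightarrow> 'a set set \<Rightarrow> nat \<Rightarrow> nat \<Rightarrow> (nat \<Rightarrow> 'a) \<Rightarrow> bool" where
  "cox_matrix N \<Sigma> s t q \<longleftrightarrow>
     s = card (rays \<Sigma>) \<and> t = dim N - dim (\<Union>\<Sigma>) \<and>
     bij_betw q {1..s} {v. \<exists>\<rho>\<in>rays \<Sigma>. first_lattice_point N \<rho> v} \<and>
     inj_on q {s+1..s+t} \<and> independent (q ` {s+1..s+t}) \<and>
     (let N' = N \<inter> span (\<Union>(rays \<Sigma>)); N'' = int_span (q ` {s+1..s+t})
      in N' \<inter> N'' = {0} \<and> N = {x + y | x y. x \<in> N' \<and> y \<in> N''})"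

text \<open>The set of (indices of) rays with which the cone \<open>\<sigma>\<close> is identified.\<close>

definition cone_rays :: "nat \<Rightarrow> (nat \<Rightarrow> 'a) \<Rightarrow> 'a set \<Rightarrow> nat set" where
  "cone_rays s q \<sigma> = {i\<in>{1..s}. q i \<in> \<sigma>}"


section \<open>The Cox semiring\<close>

text \<open>
  All polynomials in the variables \<open>x\<^sub>1, \<dots>, x\<^sub>m\<close>, as well as the elements of the localizations, are
  represented as Laurent polynomials; as multiplication by a monomial is injective, the
  localizations embed into the Laurent polynomials.
\<close>

definition cox_semiring :: "nat \<Rightarrow> ((nat \<Rightarrow>\<^sub>0 int) \<Rightarrow>\<^sub>0 trop) set" where
  "cox_semiring m = polys_on {a. keys a \<subseteq> {1..m} \<and> (\<forall>i. 0 \<le> lookup a i)}"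

text \<open>The product of the \<open>x\<^sub>i\<close> with \<open>i \<notin> J\<close>.\<close>

definition xhat :: "nat \<Rightarrow> nat set \<Rightarrow> ((nat \<Rightarrow>\<^sub>0 int) \<Rightarrow>\<^sub>0 trop)" where
  "xhat m J = (\<Prod>i \<in> {1..m} - J. Poly_Mapping.single (Poly_Mapping.single i 1) 1)"

definition cox_localization :: "nat \<Rightarrow> nat set \<Rightarrow> ((nat \<Rightarrow>\<^sub>0 int) \<Rightarrow>\<^sub>0 trop) set" where
  "cox_localization m J = {f. \<exists>k. xhat m J ^ k * f \<in> cox_semiring m}"

text \<open>The vector \<open>Q u\<close>; it is integral for \<open>u \<in> M\<close>.\<close>

definition Qvec :: "nat \<Rightarrow> (nat \<Rightarrow> 'a::euclidean_space) \<Rightarrow> 'a \<Rightarrow> (nat \<Rightarrow>\<^sub>0 int)" where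
  "Qvec m q u = (\<Sum>i\<in>{1..m}. Poly_Mapping.single i \<lfloor>q i \<bullet> u\<rfloor>)"

text \<open>The class of \<open>a\<close> in the cokernel of \<open>u \<mapsto> Q u\<close>, as a coset.\<close>

definition cox_degree ::
  "'a::euclidean_space set \<Rightarrow> nat \<Rightarrow> (nat \<Rightarrow> 'a) \<Rightarrow> (nat \<Rightarrow>\<^sub>0 int) \<Rightarrow> (nat \<Rightarrow>\<^sub>0 int) set" where
  "cox_degree N m q a = {a + Qvec m q u | u. u \<in> dual_lattice N}"

definition homogeneous ::
  "'a::euclidean_space set \<Rightarrow> nat \<Rightarrow> (nat \<Rightarrow> 'a) \<Rightarrow> ((nat \<Rightarrow>\<^sub>0 int) \<Rightarrow>\<^sub>0 trop) \<Rightarrow> bool" where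
  "homogeneous N m q f \<longleftrightarrow> (\<exists>d. \<forall>a\<in>keys f. cox_degree N m q a = d)"

text \<open>Homogeneous ideals contain the homogeneous components of their elements.\<close>

definition homogeneous_ideal ::
  "'a::euclidean_space set \<Rightarrow> nat \<Rightarrow> (nat \<Rightarrow> 'a) \<Rightarrow> ((nat \<Rightarrow>\<^sub>0 int) \<Rightarrow>\<^sub>0 trop) set \<Rightarrow> bool" where
  "homogeneous_ideal N m q I \<longleftrightarrow> semiring_ideal (cox_semiring m) I \<and>
     (\<forall>f\<in>I. \<forall>d. terms_in {a. cox_degree N m q a = d} f \<in> I)"

text \<open>Replaces each monomial \<open>u \<in> M\<close> by \<open>x\<^bsup>Q u\<^esup>\<close>.\<close>

definition cox_embed ::
  "nat \<Rightarrow> (nat \<Rightarrow> 'a::euclidean_space) \<Rightarrow> ('a \<Rightarrow>\<^sub>0 trop) \<Rightarrow> ((nat \<Rightarrow>\<^sub>0 int) \<Rightarrow>\<^sub>0 trop)" where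
  "cox_embed m q g = (\<Sum>u\<in>keys g. Poly_Mapping.single (Qvec m q u) (lookup g u))"

text \<open>
  The degree-zero part of the extension of \<open>I\<close> to the localization at \<open>\<sigma>\<close>, as a subset of the
  semiring of polynomials with exponents in \<open>\<sigma>\<^sup>\<or> \<inter> M\<close>.
\<close>

definition local_ideal ::
  "'a::euclidean_space set \<Rightarrow> nat \<Rightarrow> nat \<Rightarrow> (nat \<Rightarrow> 'a) \<Rightarrow>
   ((nat \<Rightarrow>\<^sub>0 int) \<Rightarrow>\<^sub>0 trop) set \<Rightarrow> 'a set \<Rightarrow> ('a \<Rightarrow>\<^sub>0 trop) set" where
  "local_ideal N s t q I \<sigma> = {g \<in> polys_on (dual_monoid N \<sigma>).
     cox_embed (s+t) q g \<in> ideal_generated (cox_localization (s+t) (cone_rays s q \<sigma>)) I}"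

definition locally_tropical ::
  "'a::euclidean_space set \<Rightarrow> 'a set set \<Rightarrow> nat \<Rightarrow> nat \<Rightarrow> (nat \<Rightarrow> 'a) \<Rightarrow>
   ((nat \<Rightarrow>\<^sub>0 int) \<Rightarrow>\<^sub>0 trop) set \<Rightarrow> bool" where
  "locally_tropical N \<Sigma> s t q I \<longleftrightarrow> homogeneous_ideal N (s+t) q I \<and>
     (\<forall>\<sigma>\<in>\<Sigma>. tropical_ideal (dual_monoid N \<sigma>) (local_ideal N s t q I \<sigma>))"


section \<open>Varieties\<close>

text \<open>
  A point of the disjoint union \<open>trop(X\<^sub>\<Sigma>)\<close> of the spaces \<open>N(\<sigma>) = N\<^sub>\<real> / span \<sigma>\<close> is a pair of a cone
  and a coset.
\<close>

definition coset :: "'a::euclidean_space set \<Rightarrow> 'a \<Rightarrow> 'a set" where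
  "coset \<sigma> w = {w + v | v. v \<in> span \<sigma>}"

text \<open>
  The ideal \<open>I\<^bsub>(\<sigma>)\<^esub>\<close>: the terms divisible in the localization by some \<open>x\<^sub>i\<close> with \<open>i \<in> \<sigma>\<close> are deleted.
\<close>

definition stratum_ideal ::
  "'a::euclidean_space set \<Rightarrow> nat \<Rightarrow> nat \<Rightarrow> (nat \<Rightarrow> 'a) \<Rightarrow>
   ((nat \<Rightarrow>\<^sub>0 int) \<Rightarrow>\<^sub>0 trop) set \<Rightarrow> 'a set \<Rightarrow> ('a \<Rightarrow>\<^sub>0 trop) set" where
  "stratum_ideal N s t q I \<sigma> =
     terms_in {u. \<not> (\<exists>i\<in>cone_rays s q \<sigma>. 0 < lookup (Qvec (s+t) q u) i)} ` local_ideal N s t q I \<sigma>"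

definition variety_ideal ::
  "'a::euclidean_space set \<Rightarrow> 'a set set \<Rightarrow> nat \<Rightarrow> nat \<Rightarrow> (nat \<Rightarrow> 'a) \<Rightarrow>
   ((nat \<Rightarrow>\<^sub>0 int) \<Rightarrow>\<^sub>0 trop) set \<Rightarrow> ('a set \<times> 'a set) set" where
  "variety_ideal N \<Sigma> s t q I = (SIGMA \<sigma>:\<Sigma>. coset \<sigma> `
     {w \<in> span N. \<forall>f\<in>stratum_ideal N s t q I \<sigma>. f \<noteq> 0 \<longrightarrow>
        min_twice (keys f) (\<lambda>u. lookup f u * TReal (u \<bullet> w))})"

definition trop_space :: "nat \<Rightarrow> (nat \<Rightarrow> trop) set" where
  "trop_space m = {1..m} \<rightarrow>\<^sub>E UNIV"

definition trop_term :: "nat \<Rightarrow> ((nat \<Rightarrow>\<^sub>0 int) \<Rightarrow>\<^sub>0 trop) \<Rightarrow> (nat \<Rightarrow> trop) \<Rightarrow> (nat \<Rightarrow>\<^sub>0 int) \<Rightarrow> trop" where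
  "trop_term m f w a = lookup f a * (\<Prod>i\<in>{1..m}. trop_scale (of_int (lookup a i)) (w i))"

definition affine_variety :: "nat \<Rightarrow> ((nat \<Rightarrow>\<^sub>0 int) \<Rightarrow>\<^sub>0 trop) \<Rightarrow> (nat \<Rightarrow> trop) set" where
  "affine_variety m f = {w \<in> trop_space m.
     (\<Sum>a\<in>keys f. trop_term m f w a) = TInf \<or> min_twice (keys f) (trop_term m f w)}"

definition irrelevant_ideal ::
  "'a set set \<Rightarrow> nat \<Rightarrow> nat \<Rightarrow> (nat \<Rightarrow> 'a) \<Rightarrow> ((nat \<Rightarrow>\<^sub>0 int) \<Rightarrow>\<^sub>0 trop) set" where
  "irrelevant_ideal \<Sigma> s t q =
     ideal_generated (cox_semiring (s+t)) {xhat (s+t) (cone_rays s q \<sigma>) | \<sigma>. \<sigma> \<in> \<Sigma>}"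

definition irrelevant_locus ::
  "'a set set \<Rightarrow> nat \<Rightarrow> nat \<Rightarrow> (nat \<Rightarrow> 'a) \<Rightarrow> (nat \<Rightarrow> trop) set" where
  "irrelevant_locus \<Sigma> s t q =
     {w \<in> trop_space (s+t). \<forall>g\<in>irrelevant_ideal \<Sigma> s t q. w \<in> affine_variety (s+t) g}"

text \<open>
  The monoid homomorphism in \<open>Hom(\<sigma>\<^sup>\<or> \<inter> M, \<real> \<union> {\<infinity>})\<close> given by the class of \<open>v\<close> in \<open>N(\<tau>)\<close>, for a face
  \<open>\<tau>\<close> of \<open>\<sigma>\<close>.
\<close>

definition point_hom :: "'a::euclidean_space set \<Rightarrow> 'a \<Rightarrow> 'a \<Rightarrow> trop" where
  "point_hom \<tau> v u = (if \<forall>x\<in>\<tau>. u \<bullet> x = 0 then TReal (u \<bullet> v) else TInf)"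

text \<open>
  The graph of the quotient map: \<open>w\<close>, with \<open>w\<^sub>i < \<infinity>\<close> for \<open>i \<notin> \<sigma>\<close>, is sent to the point of
  \<open>Hom(\<sigma>\<^sup>\<or> \<inter> M, \<real> \<union> {\<infinity>})\<close> mapping \<open>u\<close> to the ordinary sum of the \<open>(Q u)\<^sub>i \<cdot> w\<^sub>i\<close>.
\<close>

definition quotient_map ::
  "'a::euclidean_space set \<Rightarrow> 'a set set \<Rightarrow> nat \<Rightarrow> nat \<Rightarrow> (nat \<Rightarrow> 'a) \<Rightarrow>
   ((nat \<Rightarrow> trop) \<times> ('a set \<times> 'a set)) set" where
  "quotient_map N \<Sigma> s t q = {(w, (\<tau>, coset \<tau> v)) | w \<tau> v.
     w \<in> trop_space (s+t) \<and> \<tau> \<in> \<Sigma> \<and> v \<in> span N \<and>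
     (\<exists>\<sigma>\<in>\<Sigma>. \<tau> face_of \<sigma> \<and> (\<forall>i\<in>{1..s+t} - cone_rays s q \<sigma>. w i < TInf) \<and>
        (\<forall>u\<in>dual_monoid N \<sigma>.
           point_hom \<tau> v u =
             (\<Prod>i\<in>{1..s+t}. trop_scale (of_int (lookup (Qvec (s+t) q u) i)) (w i))))}"

definition variety_poly ::
  "'a::euclidean_space set \<Rightarrow> 'a set set \<Rightarrow> nat \<Rightarrow> nat \<Rightarrow> (nat \<Rightarrow> 'a) \<Rightarrow>
   ((nat \<Rightarrow>\<^sub>0 int) \<Rightarrow>\<^sub>0 trop) \<Rightarrow> ('a set \<times> 'a set) set" where
  "variety_poly N \<Sigma> s t q f =
     quotient_map N \<Sigma> s t q `` (affine_variety (s+t) f - irrelevant_locus \<Sigma> s t q)"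

end

theory Submission imports Defs
begin

text \<open>
  The ideal of each stratum is a tropical ideal \<open>J\<close> of Laurent polynomials.  For a weight \<open>w\<close> refined
  to a total order on terms, the initial exponents of the elements of \<open>J\<close> of bounded degree form a
  monomial ideal whose complement is, in each degree, a basis of the matroid of \<open>J\<close>; there are only
  finitely many such monomial ideals \<open>M\<close>.  Over the complement of \<open>M\<close> each \<open>u \<in> M\<close> has a unique
  fundamental circuit.  Let \<open>w\<close> and \<open>w'\<close> be compatible with the same ideals \<open>M\<close>, and let \<open>u\<close> be the
  unique initial exponent at \<open>w\<close> of some element of \<open>J\<close>.  Choose \<open>M\<close> as the initial ideal at \<open>w'\<close>
  refined by the direction \<open>w' - w\<close>.  It is compatible with \<open>w\<close>, so the circuit of \<open>u\<close> has the unique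
  initial exponent \<open>u\<close> at \<open>w\<close>, and by convexity also at \<open>w'\<close>.  Hence one exponent \<open>u\<close> for each class
  of weights and the circuits of \<open>u\<close> for all \<open>M\<close> give a finite tropical basis of \<open>J\<close>.  Multiplied
  by powers of \<open>xhat\<close>, lifts of these circuits become homogeneous elements of \<open>I\<close>; elements of \<open>I\<close>
  never cut away points of the variety of \<open>I\<close> in other strata.
\<close>

section \<open>Tropical bases of Laurent ideals\<close>

text \<open>A tropical ideal need not be finitely generated, so no basis theorem for ideals can
  supply the finite set; finiteness comes from counting the sets \<open>M\<close>. Laurent exponents
  carry no grading, and the boxes \<open>E k\<close> provide one: matroid arguments take place on
  the finite sets \<open>E k\<close>, while \<open>E_add\<close> keeps multiplication by monomials
  available across degrees. The obstacle is ties: a weight may be compatible with several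
  \<open>M\<close> at once, so compatibility can only be a weak inequality, whereas the exponents
  that matter are strictly initial. Elimination therefore has to combine one strict and one weak
  comparison, which is why orders are presented by a pair \<open>pos\<close>, \<open>wpos\<close>. A
  plain weight gives such a pair without being total, a refined weight gives a total one, and the
  same elimination argument serves both.\<close>

fun tval :: "trop \<Rightarrow> real" where
  "tval (TReal x) = x"
| "tval TInf = 0"

lemma TReal_tval: "x \<noteq> 0 \<Longrightarrow> TReal (tval x) = x"
  by (cases x) (auto simp: zero_trop_def)

lemma TReal_neq_zero [simp]: "TReal x \<noteq> 0" "0 \<noteq> TReal x"
  by (auto simp: zero_trop_def)

lemma trop_mult_eq_zero: "x * y = (0::trop) \<longleftrightarrow> x = 0 \<or> y = 0"
  by (cases x; cases y) (auto simp: zero_trop_def)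

lemma TReal_zero_mult [simp]: "TReal 0 * x = x"
  by (cases x) auto

lemma lookup_single_mult:
  fixes f :: "'k::ab_group_add \<Rightarrow>\<^sub>0 'b::semiring_0"
  shows "lookup (Poly_Mapping.single a c * f) x = c * lookup f (x - a)"
proof -
  have *: "x = a + q \<longleftrightarrow> q = x - a" for q by (auto simp: algebra_simps)
  show ?thesis
  by (simp add: lookup_mult lookup_single mult_when when_mult *)
qed

lemma keys_single_mult:
  fixes f :: "'k::ab_group_add \<Rightarrow>\<^sub>0 trop"
  assumes "c \<noteq> 0"
  shows "keys (Poly_Mapping.single a c * f) = (+) a ` keys f"
proof -
  have "x \<in> keys (Poly_Mapping.single a c * f) \<longleftrightarrow> x - a \<in> keys f" for x
    using assms by (simp add: in_keys_iff lookup_single_mult trop_mult_eq_zero)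
  then show ?thesis by (force simp: image_iff)
qed

section \<open>Initial exponents and elimination\<close>

definition initial_at :: "(real \<Rightarrow> 'k::ab_group_add \<Rightarrow> bool) \<Rightarrow> ('k \<Rightarrow>\<^sub>0 trop) \<Rightarrow> 'k \<Rightarrow> bool" where
  "initial_at pos f u \<longleftrightarrow> u \<in> keys f \<and>
     (\<forall>b\<in>keys f. b \<noteq> u \<longrightarrow> pos (tval (lookup f b) - tval (lookup f u)) (b - u))"

text \<open>\<open>pos c a\<close> stands for "strictly higher" when the coefficient grows by
  \<open>c\<close> and the exponent by \<open>a\<close>, and \<open>wpos\<close> is its weak form.
  Recording only differences makes \<open>initial_at\<close> invariant under multiplication by
  monomials. Coefficients are compared only at exponents of the support, so the default value of
  \<open>tval\<close> at \<open>TInf\<close> does not enter.\<close>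

locale term_cone =
  fixes pos wpos :: "real \<Rightarrow> 'k::ab_group_add \<Rightarrow> bool"
  assumes pos_const: "pos c 0 \<Longrightarrow> 0 < c"
    and pos_mono: "pos c a \<Longrightarrow> c \<le> d \<Longrightarrow> pos d a"
    and pos_wpos: "pos c a \<Longrightarrow> wpos d b \<Longrightarrow> pos (c + d) (a + b)"

text \<open>The vectors in \<open>B\<close> act as finitely many integer-valued functionals that
  separate the points of \<open>L\<close>; they measure the size of an exponent.
  \<open>J_elim\<close> names no finite set of monomials because its lower bound already confines
  the support of \<open>h\<close> to those of \<open>f\<close> and \<open>g\<close>.\<close>

locale laurent_tropical_ideal =
  fixes L B :: "'a::euclidean_space set" and J :: "('a \<Rightarrow>\<^sub>0 trop) set"
  assumes L_zero: "0 \<in> L" and L_add: "a \<in> L \<Longrightarrow> b \<in> L \<Longrightarrow> a + b \<in> L"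
    and L_diff: "a \<in> L \<Longrightarrow> b \<in> L \<Longrightarrow> a - b \<in> L"
    and finite_B: "finite B" and B_int: "a \<in> L \<Longrightarrow> b \<in> B \<Longrightarrow> a \<bullet> b \<in> \<int>"
    and B_sep: "a \<in> L \<Longrightarrow> (\<And>b. b \<in> B \<Longrightarrow> a \<bullet> b = 0) \<Longrightarrow> a = 0"
    and J_keys: "f \<in> J \<Longrightarrow> keys f \<subseteq> L"
    and J_mult: "f \<in> J \<Longrightarrow> a \<in> L \<Longrightarrow> Poly_Mapping.single a (TReal c) * f \<in> J"
    and J_elim: "f \<in> J \<Longrightarrow> g \<in> J \<Longrightarrow> e \<in> keys f \<Longrightarrow> lookup f e = lookup g e \<Longrightarrow>
      \<exists>h\<in>J. lookup h e = TInf \<and> (\<forall>x. min (lookup f x) (lookup g x) \<le> lookup h x \<and>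
        (lookup f x \<noteq> lookup g x \<longrightarrow> lookup h x = min (lookup f x) (lookup g x)))"
begin

text \<open>Bounding the functionals of \<open>B\<close> instead of a norm makes every
  \<open>k \<plusminus> a \<bullet> b\<close> a natural number, the form in which Dickson's lemma
  applies.\<close>

definition E :: "nat \<Rightarrow> 'a set" where
  "E k = {a\<in>L. \<forall>b\<in>B. \<bar>a \<bullet> b\<bar> \<le> real k}"

definition V :: "nat \<Rightarrow> ('a \<Rightarrow>\<^sub>0 trop) set" where
  "V k = {f\<in>J. keys f \<subseteq> E k}"

text \<open>The integer values on \<open>B\<close> determine an exponent, which embeds
  \<open>E k\<close> into a finite box of integer vectors.\<close>

lemma finite_E: "finite (E k)"
proof -
  let ?h = "\<lambda>a. restrict (\<lambda>b. \<lfloor>a \<bullet> b\<rfloor>) B"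
  have "?h ` E k \<subseteq> B \<rightarrow>\<^sub>E {- int k..int k}"
    unfolding E_def by (auto simp: abs_le_iff le_floor_iff floor_le_iff)
  moreover have "finite (B \<rightarrow>\<^sub>E {- int k..int k})"
    by (intro finite_PiE finite_B) auto
  ultimately have fin: "finite (?h ` E k)" by (rule finite_subset)
  have "inj_on ?h (E k)"
  proof (rule inj_onI)
    fix x y assume xy: "x \<in> E k" "y \<in> E k" "?h x = ?h y"
    then have L: "x \<in> L" "y \<in> L" by (auto simp: E_def)
    have "(x - y) \<bullet> b = 0" if b: "b \<in> B" for b
    proof -
      have "\<lfloor>x \<bullet> b\<rfloor> = \<lfloor>y \<bullet> b\<rfloor>" using fun_cong[OF xy(3), of b] b by simp
      then show ?thesis using B_int[OF L(1) b] B_int[OF L(2) b]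
        by (simp add: inner_diff_left) (metis Ints_cases of_int_floor_cancel)
    qed
    then show "x = y" using B_sep[OF L_diff[OF L]] by simp
  qed
  then show ?thesis using fin by (rule finite_imageD[rotated])
qed

lemma E_add: "a \<in> E k \<Longrightarrow> b \<in> E l \<Longrightarrow> a + b \<in> E (k + l)"
  unfolding E_def mem_Collect_eq of_nat_add inner_add_left
  by (meson L_add abs_triangle_ineq add_mono order_trans)

lemma E_exhausts:
  assumes "finite A" "A \<subseteq> L" shows "\<exists>k. A \<subseteq> E k"
proof -
  have "finite ((\<lambda>(a,b). \<bar>a \<bullet> b\<bar>) ` (A \<times> B))" using assms finite_B by auto
  then obtain K where K: "\<And>x. x \<in> (\<lambda>(a,b). \<bar>a \<bullet> b\<bar>) ` (A \<times> B) \<Longrightarrow> x \<le> K"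
    using bdd_above_finite[of "(\<lambda>(a,b). \<bar>a \<bullet> b\<bar>) ` (A \<times> B)"] unfolding bdd_above_def by blast
  obtain k where "K \<le> real k" using real_arch_simple by blast
  then have "A \<subseteq> E k" using assms(2) K unfolding E_def by (fastforce intro: order_trans)
  then show ?thesis ..
qed

lemma V_mult:
  assumes "f \<in> V k" "b \<in> E l" shows "Poly_Mapping.single b (TReal c) * f \<in> V (k + l)"
proof -
  have "b + a \<in> E (k + l)" if "a \<in> keys f" for a
    using E_add[of a k b l] that assms by (auto simp: V_def add.commute)
  then show ?thesis using assms by (auto simp: V_def keys_single_mult J_mult E_def)
qed

lemma V_scale:
  assumes "f \<in> V k" shows "Poly_Mapping.single 0 (TReal c) * f \<in> V k"
  using V_mult[OF assms, of 0 0] by (simp add: E_def L_zero)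

text \<open>Tropical scaling of \<open>g\<close> by \<open>c\<close> makes the two coefficients at
  \<open>e\<close> agree, as the elimination axiom demands.\<close>

lemma eliminate:
  assumes f: "f \<in> V k" and g: "g \<in> V k" and e: "e \<in> keys f" "e \<in> keys g"
  defines "c \<equiv> tval (lookup f e) - tval (lookup g e)"
  obtains h where "h \<in> V k" "keys h \<subseteq> keys f \<union> keys g - {e}"
    "\<And>x. x \<in> keys h \<Longrightarrow> (x \<in> keys f \<and> tval (lookup f x) \<le> tval (lookup h x)) \<or>
       (x \<in> keys g \<and> c + tval (lookup g x) \<le> tval (lookup h x))"
    "\<And>x. lookup f x \<noteq> TReal c * lookup g x \<Longrightarrow> lookup h x = min (lookup f x) (TReal c * lookup g x)"
proof -
  let ?g = "Poly_Mapping.single 0 (TReal c) * g"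
  have lg: "lookup ?g x = TReal c * lookup g x" for x by (simp add: lookup_single_mult)
  have kg: "keys ?g = keys g" by (simp add: keys_single_mult)
  have "lookup f e = lookup ?g e"
    unfolding lg using e by (cases "lookup f e"; cases "lookup g e") (auto simp: in_keys_iff c_def zero_trop_def)
  then obtain h where h: "h \<in> J" "lookup h e = TInf"
     "\<And>x. min (lookup f x) (lookup ?g x) \<le> lookup h x"
     "\<And>x. lookup f x \<noteq> lookup ?g x \<Longrightarrow> lookup h x = min (lookup f x) (lookup ?g x)"
    using J_elim[of f ?g e] f V_scale[OF g] e(1) unfolding V_def by blast
  have le: "(x \<in> keys f \<and> tval (lookup f x) \<le> tval (lookup h x)) \<or>
       (x \<in> keys g \<and> c + tval (lookup g x) \<le> tval (lookup h x))" if x: "x \<in> keys h" for x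
    using h(3)[of x] x unfolding lg
    by (cases "lookup f x"; cases "lookup g x"; cases "lookup h x")
       (auto simp: in_keys_iff zero_trop_def min_def split: if_splits)
  show ?thesis
  proof (rule that)
    show "keys h \<subseteq> keys f \<union> keys g - {e}"
    proof
      fix x assume "x \<in> keys h"
      then show "x \<in> keys f \<union> keys g - {e}" using le[of x] h(2) by (auto simp: in_keys_iff zero_trop_def)
    qed
    then show "h \<in> V k" using f g h(1) by (auto simp: V_def)
  qed (use le h(4) lg in auto)
qed

text \<open>All terms of \<open>g\<close> lie weakly above its term at \<open>e\<close>, and that
  term, once scaled to match \<open>f\<close>, lies strictly above the term of \<open>f\<close> at
  \<open>u\<close>. So nothing coming from \<open>g\<close> can disturb \<open>u\<close>.\<close>

lemma eliminate_initial:
  assumes "term_cone pos wpos"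
    and f: "f \<in> V k" and g: "g \<in> V k" and e: "e \<in> keys f" "e \<in> keys g" "e \<noteq> u"
    and fu: "initial_at pos f u"
    and ge: "\<And>x. x \<in> keys g \<Longrightarrow> wpos (tval (lookup g x) - tval (lookup g e)) (x - e)"
  obtains h where "h \<in> V k" "initial_at pos h u" "keys h \<subseteq> keys f \<union> keys g - {e}"
proof -
  interpret term_cone pos wpos by fact
  define c where "c = tval (lookup f e) - tval (lookup g e)"
  obtain h where h: "h \<in> V k" "keys h \<subseteq> keys f \<union> keys g - {e}"
    "\<And>x. x \<in> keys h \<Longrightarrow> (x \<in> keys f \<and> tval (lookup f x) \<le> tval (lookup h x)) \<or>
       (x \<in> keys g \<and> c + tval (lookup g x) \<le> tval (lookup h x))"
    "\<And>x. lookup f x \<noteq> TReal c * lookup g x \<Longrightarrow> lookup h x = min (lookup f x) (TReal c * lookup g x)"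
    using eliminate[OF f g e(1,2)] unfolding c_def by metis
  have u: "u \<in> keys f" using fu by (simp add: initial_at_def)
  have g_above: "pos (c + tval (lookup g x) - tval (lookup f u)) (x - u)" if x: "x \<in> keys g" for x
  proof -
    have "pos (tval (lookup f e) - tval (lookup f u)) (e - u)" using fu e by (auto simp: initial_at_def)
    from pos_wpos[OF this ge[OF x]] show ?thesis by (simp add: c_def algebra_simps)
  qed
  \<comment> \<open>Strictness makes the two coefficients at \<open>u\<close> differ, and then
    elimination keeps exactly the smaller one.\<close>
  have "lookup f u < TReal c * lookup g u"
  proof (cases "u \<in> keys g")
    case True
    then show ?thesis using pos_const[of "c + tval (lookup g u) - tval (lookup f u)"] g_above[OF True] u
      by (cases "lookup f u"; cases "lookup g u") (auto simp: in_keys_iff zero_trop_def less_trop_def)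
  next
    case False
    then show ?thesis using u
      by (cases "lookup f u") (auto simp: in_keys_iff zero_trop_def less_trop_def)
  qed
  then have hu: "lookup h u = lookup f u" using h(4)[of u] by (auto simp: min_def)
  have "pos (tval (lookup h x) - tval (lookup h u)) (x - u)" if x: "x \<in> keys h" "x \<noteq> u" for x
    using h(3)[OF x(1)]
  proof
    assume x': "x \<in> keys f \<and> tval (lookup f x) \<le> tval (lookup h x)"
    then have "pos (tval (lookup f x) - tval (lookup f u)) (x - u)" using fu x(2) by (auto simp: initial_at_def)
    then show ?thesis using x' pos_mono hu by simp
  next
    assume x': "x \<in> keys g \<and> c + tval (lookup g x) \<le> tval (lookup h x)"
    then show ?thesis using g_above[of x] pos_mono hu by simp
  qed
  moreover have "u \<in> keys h" using u hu by (simp add: in_keys_iff)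
  ultimately show ?thesis using that[OF h(1) _ h(2)] by (auto simp: initial_at_def)
qed

section \<open>Standard monomials and fundamental circuits\<close>

definition std :: "(nat \<times> 'a) set \<Rightarrow> nat \<Rightarrow> 'a set" where
  "std M k = {a\<in>E k. (k, a) \<notin> M}"

text \<open>A basis of the matroid on \<open>E k\<close> whose dependent sets are those containing
  the support of a nonzero element of \<open>V k\<close>: the second clause is independence, the
  third provides a fundamental circuit for every further exponent.\<close>

definition basis :: "nat \<Rightarrow> 'a set \<Rightarrow> bool" where
  "basis k S \<longleftrightarrow> S \<subseteq> E k \<and> (\<forall>f\<in>V k. keys f \<subseteq> S \<longrightarrow> f = 0) \<and>
     (\<forall>u\<in>E k - S. \<exists>f\<in>V k. lookup f u = TReal 0 \<and> keys f \<subseteq> insert u S)"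

text \<open>
  The exponent sets that behave like monomial initial ideals of the homogenization of \<open>J\<close>, whose
  part of degree \<open>k\<close> is identified with \<open>V k\<close>.
\<close>

definition initial_ideals :: "(nat \<times> 'a) set set" where
  "initial_ideals = {M. (\<forall>k a. (k, a) \<in> M \<longrightarrow> a \<in> E k) \<and>
     (\<forall>k a l b. (k, a) \<in> M \<longrightarrow> b \<in> E l \<longrightarrow> (k + l, a + b) \<in> M) \<and>
     (\<forall>k. basis k (std M k))}"

text \<open>The fundamental circuit of \<open>u\<close> over the basis \<open>std M k\<close>.
  Prescribing the coefficient at \<open>u\<close> makes it unique for \<open>M\<close> in
  \<open>initial_ideals\<close> and \<open>(k, u)\<close> in \<open>M\<close>.\<close>

definition circuit :: "(nat \<times> 'a) set \<Rightarrow> nat \<Rightarrow> 'a \<Rightarrow> ('a \<Rightarrow>\<^sub>0 trop)" where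
  "circuit M k u = (THE f. f \<in> V k \<and> lookup f u = TReal 0 \<and> keys f \<subseteq> insert u (std M k))"

text \<open>Eliminating \<open>u\<close> from two different candidates would leave an element
  supported in \<open>S\<close> that is nonzero wherever they differ, against independence.\<close>

lemma basis_circuit_unique:
  assumes "basis k S" "f \<in> V k" "g \<in> V k" "lookup f u = TReal 0" "lookup g u = TReal 0"
    "keys f \<subseteq> insert u S" "keys g \<subseteq> insert u S"
  shows "f = g"
proof (rule poly_mapping_eqI, rule ccontr)
  fix x assume x: "lookup f x \<noteq> lookup g x"
  have "u \<in> keys f" "u \<in> keys g" using assms by (auto simp: in_keys_iff)
  with eliminate[OF assms(2,3), of u] assms(4,5) obtain h where
    h: "h \<in> V k" "keys h \<subseteq> keys f \<union> keys g - {u}"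
    "\<And>x. lookup f x \<noteq> TReal 0 * lookup g x \<Longrightarrow> lookup h x = min (lookup f x) (TReal 0 * lookup g x)"
    by (metis cancel_comm_monoid_add_class.diff_cancel)
  have "h = 0" using assms(1,6,7) h(1,2) unfolding basis_def by blast
  moreover have "lookup h x \<noteq> 0" using x h(3)[of x] unfolding TReal_zero_mult
    by (cases "lookup f x"; cases "lookup g x") (auto simp: min_def zero_trop_def)
  ultimately show False by simp
qed

lemma initial_ideals_basis: "M \<in> initial_ideals \<Longrightarrow> basis k (std M k)"
  by (simp add: initial_ideals_def)

lemma circuit:
  assumes "M \<in> initial_ideals" "(k, u) \<in> M"
  shows "circuit M k u \<in> V k" "lookup (circuit M k u) u = TReal 0"
    "keys (circuit M k u) \<subseteq> insert u (std M k)"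
proof -
  have b: "basis k (std M k)" using assms(1) by (rule initial_ideals_basis)
  have "u \<in> E k - std M k" using assms by (auto simp: initial_ideals_def std_def)
  then obtain f where "f \<in> V k" "lookup f u = TReal 0" "keys f \<subseteq> insert u (std M k)"
    using b unfolding basis_def by blast
  then have "\<exists>!f. f \<in> V k \<and> lookup f u = TReal 0 \<and> keys f \<subseteq> insert u (std M k)"
    using basis_circuit_unique[OF b] by (intro ex1I[of _ f]) auto
  from theI'[OF this] show "circuit M k u \<in> V k" "lookup (circuit M k u) u = TReal 0"
    "keys (circuit M k u) \<subseteq> insert u (std M k)" unfolding circuit_def by auto
qed

lemma circuit_eqI:
  assumes "M \<in> initial_ideals" "(k, u) \<in> M" "f \<in> V k" "u \<in> keys f" "keys f \<subseteq> insert u (std M k)"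
  shows "circuit M k u = Poly_Mapping.single 0 (TReal (- tval (lookup f u))) * f"
proof (rule basis_circuit_unique[OF initial_ideals_basis[OF assms(1)] circuit(1)[OF assms(1,2)] _ circuit(2)[OF assms(1,2)] _ circuit(3)[OF assms(1,2)]])
  show "lookup (Poly_Mapping.single 0 (TReal (- tval (lookup f u))) * f) u = TReal 0"
    using assms(4) by (cases "lookup f u") (auto simp: lookup_single_mult in_keys_iff zero_trop_def)
qed (use assms V_scale in \<open>auto simp: keys_single_mult\<close>)

lemma initial_at_circuit:
  assumes "M \<in> initial_ideals" "(k, u) \<in> M" "f \<in> V k" "initial_at pos f u" "keys f \<subseteq> insert u (std M k)"
  shows "initial_at pos (circuit M k u) u"
proof -
  have u: "u \<in> keys f" using assms(4) by (simp add: initial_at_def)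
  have "tval (TReal c * y) = c + tval y" if "y \<noteq> 0" for c y
    using that by (cases y) (auto simp: zero_trop_def)
  then show ?thesis using assms(4) unfolding circuit_eqI[OF assms(1-3) u assms(5)]
    by (simp add: initial_at_def keys_single_mult lookup_single_mult in_keys_iff)
qed

text \<open>Bases of a matroid are never properly nested: for \<open>(k, u)\<close> in
  \<open>M'\<close> but not in \<open>M\<close>, the circuit of \<open>u\<close> over the smaller
  basis would be supported inside the larger one.\<close>

lemma initial_ideals_antichain:
  assumes "M \<in> initial_ideals" "M' \<in> initial_ideals" "M \<subseteq> M'"
  shows "M = M'"
proof (rule ccontr)
  assume "M \<noteq> M'"
  then obtain k u where ku: "(k, u) \<in> M'" "(k, u) \<notin> M" using assms(3) by auto
  have "std M' k \<subseteq> std M k" using assms(3) by (auto simp: std_def)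
  moreover have "u \<in> std M k" using ku assms(2) by (auto simp: std_def initial_ideals_def)
  ultimately have "keys (circuit M' k u) \<subseteq> std M k" using circuit(3)[OF assms(2) ku(1)] by auto
  then have "circuit M' k u = 0"
    using circuit(1)[OF assms(2) ku(1)] initial_ideals_basis[OF assms(1)] unfolding basis_def by blast
  then show False using circuit(2)[OF assms(2) ku(1)] by simp
qed

text \<open>Circuits of \<open>M\<close> remove from \<open>f\<close> every nonstandard exponent
  \<open>e\<close> other than \<open>u\<close>. Each circuit has its lowest term, possibly tied, at
  its own \<open>e\<close>, so \<open>u\<close> stays strictly initial; what remains is a scalar
  multiple of the circuit of \<open>u\<close>. Since weak compatibility suffices, \<open>M\<close>
  may stem from a different order.\<close>

lemma initial_at_extend:
  assumes tc: "term_cone pos wpos" and M: "M \<in> initial_ideals"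
    and compatible: "\<And>a x. (k, a) \<in> M \<Longrightarrow> x \<in> keys (circuit M k a) \<Longrightarrow> wpos (tval (lookup (circuit M k a) x)) (x - a)"
    and f: "f \<in> V k" "initial_at pos f u"
  shows "(k, u) \<in> M" "initial_at pos (circuit M k u) u"
proof -
  have "\<exists>h\<in>V k. initial_at pos h u \<and> keys h \<subseteq> insert u (std M k)"
    using f
  proof (induction "card (keys f - insert u (std M k))" arbitrary: f rule: less_induct)
    case less
    show ?case
    proof (cases "keys f \<subseteq> insert u (std M k)")
      case False
      then obtain e where e: "e \<in> keys f" "e \<noteq> u" "e \<notin> std M k" by auto
      then have eM: "(k, e) \<in> M" using less.prems(1) by (auto simp: V_def std_def)
      note c = circuit[OF M eM]
      obtain h where h: "h \<in> V k" "initial_at pos h u" "keys h \<subseteq> keys f \<union> keys (circuit M k e) - {e}"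
        using eliminate_initial[OF tc less.prems(1) c(1) e(1) _ e(2) less.prems(2)] compatible[OF eM] c(2)
        by (auto simp: in_keys_iff)
      \<comment> \<open>The circuit of \<open>e\<close> brings in only standard exponents besides
        \<open>e\<close>, so fewer exponents are left to remove.\<close>
      then have "keys h - insert u (std M k) \<subset> keys f - insert u (std M k)" using c(3) e by blast
      then have "card (keys h - insert u (std M k)) < card (keys f - insert u (std M k))"
        by (intro psubset_card_mono) auto
      then show ?thesis using less.hyps h by blast
    qed (use less.prems in blast)
  qed
  then obtain h where h: "h \<in> V k" "initial_at pos h u" "keys h \<subseteq> insert u (std M k)" by blast
  then have u: "u \<in> keys h" by (simp add: initial_at_def)
  show kuM: "(k, u) \<in> M"
  proof (rule ccontr)
    assume "(k, u) \<notin> M"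
    then have "u \<in> std M k" using u h(1) by (auto simp: V_def std_def)
    then have "h = 0" using initial_ideals_basis[OF M, of k] h(1,3) unfolding basis_def by blast
    then show False using u by simp
  qed
  show "initial_at pos (circuit M k u) u" by (rule initial_at_circuit[OF M kuM h])
qed

end

section \<open>Initial ideals of total term orders\<close>

locale term_order = term_cone pos wpos for pos wpos :: "real \<Rightarrow> 'k::ab_group_add \<Rightarrow> bool" +
  fixes L :: "'k set"
  assumes wpos_iff: "wpos c a \<longleftrightarrow> pos c a \<or> (c = 0 \<and> a = 0)"
    and pos_total: "a \<in> L \<Longrightarrow> a \<noteq> 0 \<Longrightarrow> pos c a \<or> pos (- c) (- a)"

context laurent_tropical_ideal
begin

definition initial_set :: "(real \<Rightarrow> 'a \<Rightarrow> bool) \<Rightarrow> (nat \<times> 'a) set" where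
  "initial_set pos = {(k, u). \<exists>f\<in>V k. initial_at pos f u}"

lemma initial_at_exists:
  assumes "term_order pos wpos L" "f \<in> J" "f \<noteq> 0"
  shows "\<exists>u. initial_at pos f u"
proof -
  interpret term_order pos wpos L by fact
  let ?D = "\<lambda>b u. pos (tval (lookup f b) - tval (lookup f u)) (b - u)"
  have trans: "?D c a" if "?D b a" "?D c b" for a b c
    using pos_wpos[OF that(1), of "tval (lookup f c) - tval (lookup f b)" "c - b"] that(2)
    by (simp add: wpos_iff)
  have "A \<noteq> {} \<longrightarrow> (\<exists>u\<in>A. \<forall>b\<in>A. b \<noteq> u \<longrightarrow> ?D b u)" if "finite A" "A \<subseteq> L" for A
    using that
  proof (induction A rule: finite_induct)
    case (insert x A)
    show ?case
    proof (cases "A = {}")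
      case False
      then obtain u where u: "u \<in> A" "\<And>b. b \<in> A \<Longrightarrow> b \<noteq> u \<Longrightarrow> ?D b u" using insert by auto
      have "x \<noteq> u" using u(1) insert by auto
      have "x - u \<in> L" using u insert L_diff by auto
      then consider "?D x u" | "?D u x" using pos_total[of "x - u" "tval (lookup f x) - tval (lookup f u)"] \<open>x \<noteq> u\<close> by auto
      then show ?thesis
      proof cases
        case 1 then show ?thesis using u by blast
      next
        case 2
        then have "\<forall>b\<in>insert x A. b \<noteq> x \<longrightarrow> ?D b x" using u trans by (metis insertE)
        then show ?thesis by blast
      qed
    qed auto
  qed auto
  moreover have "keys f \<noteq> {}" using assms(3) by simp
  ultimately show ?thesis using J_keys[OF assms(2)] unfolding initial_at_def by (meson finite_keys)
qed

text \<open>The analogue of a reduced Groebner basis: the other initial exponents are eliminated one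
  after another.\<close>

lemma initial_set_reduced:
  assumes to: "term_order pos wpos L" and u: "(k, u) \<in> initial_set pos"
  shows "\<exists>f\<in>V k. initial_at pos f u \<and> keys f \<subseteq> insert u (std (initial_set pos) k)"
proof -
  interpret term_order pos wpos L by fact
  let ?M = "{a\<in>E k. (k, a) \<in> initial_set pos}"
  \<comment> \<open>The induction over the set \<open>S\<close> of avoided exponents treats all
    initial exponents \<open>a\<close> together: removing \<open>e\<close> from \<open>f\<close>
    needs an element with initial exponent \<open>e\<close> that already avoids \<open>S\<close>, or
    exponents of \<open>S\<close> would return.\<close>
  have "\<forall>a\<in>?M. \<exists>f\<in>V k. initial_at pos f a \<and> keys f \<inter> S \<subseteq> {a}" if "finite S" "S \<subseteq> ?M" for S
    using that
  proof (induction S rule: finite_induct)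
    case empty then show ?case by (auto simp: initial_set_def)
  next
    case (insert e S)
    show ?case
    proof
      fix a assume a: "a \<in> ?M"
      obtain f where f: "f \<in> V k" "initial_at pos f a" "keys f \<inter> S \<subseteq> {a}" using insert a by auto
      show "\<exists>f\<in>V k. initial_at pos f a \<and> keys f \<inter> insert e S \<subseteq> {a}"
      proof (cases "e \<noteq> a \<and> e \<in> keys f")
        case True
        then obtain g where g: "g \<in> V k" "initial_at pos g e" "keys g \<inter> S \<subseteq> {e}" using insert by auto
        have ge: "e \<in> keys g" using g(2) by (simp add: initial_at_def)
        have "wpos (tval (lookup g x) - tval (lookup g e)) (x - e)" if "x \<in> keys g" for x
          using g(2) that unfolding initial_at_def wpos_iff by (cases "x = e") auto
        then obtain h where "h \<in> V k" "initial_at pos h a" "keys h \<subseteq> keys f \<union> keys g - {e}"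
          using eliminate_initial[OF term_cone_axioms f(1) g(1) _ ge _ f(2)] True by blast
        then show ?thesis using f(3) g(3) insert.hyps(2) by blast
      qed (use f in \<open>auto simp: V_def\<close>)
    qed
  qed
  from this[of ?M] have "\<exists>f\<in>V k. initial_at pos f u \<and> keys f \<inter> ?M \<subseteq> {u}"
    using u finite_E[of k] by (auto simp: initial_set_def initial_at_def V_def)
  then show ?thesis by (fastforce simp: std_def V_def)
qed

text \<open>Independence holds because a nonzero element has an initial exponent, which is
  nonstandard; the fundamental circuits come from \<open>initial_set_reduced\<close>.\<close>

lemma initial_set_initial_ideal:
  assumes to: "term_order pos wpos L"
  shows "initial_set pos \<in> initial_ideals"
proof -
  interpret term_order pos wpos L by fact
  let ?M = "initial_set pos"
  have ME: "a \<in> E k" if "(k, a) \<in> ?M" for k a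
    using that by (auto simp: initial_set_def initial_at_def V_def)
  have "(k + l, a + b) \<in> ?M" if a: "(k, a) \<in> ?M" and b: "b \<in> E l" for k a l b
  proof -
    obtain f where f: "f \<in> V k" "initial_at pos f a" using a by (auto simp: initial_set_def)
    have "initial_at pos (Poly_Mapping.single b (TReal 0) * f) (b + a)"
      using f(2) by (auto simp: initial_at_def keys_single_mult lookup_single_mult)
    then show ?thesis using V_mult[OF f(1) b] unfolding initial_set_def by (auto simp: add.commute)
  qed
  moreover have "basis k (std ?M k)" for k
    unfolding basis_def
  proof (intro conjI ballI impI)
    show "std ?M k \<subseteq> E k" by (auto simp: std_def)
  next
    fix f assume f: "f \<in> V k" "keys f \<subseteq> std ?M k"
    show "f = 0"
    proof (rule ccontr)
      assume "f \<noteq> 0"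
      moreover have "f \<in> J" using f(1) by (simp add: V_def)
      ultimately obtain u where "initial_at pos f u" using initial_at_exists[OF to] by blast
      then have "(k, u) \<in> ?M" "u \<in> keys f" using f by (auto simp: initial_set_def initial_at_def)
      then show False using f(2) by (auto simp: std_def)
    qed
  next
    fix u assume "u \<in> E k - std ?M k"
    then have "(k, u) \<in> ?M" by (auto simp: std_def)
    from initial_set_reduced[OF to this] obtain f where
      f: "f \<in> V k" "initial_at pos f u" "keys f \<subseteq> insert u (std ?M k)" by blast
    define c where "c = tval (lookup f u)"
    have c: "lookup f u = TReal c" using f(2) TReal_tval[of "lookup f u"]
      by (auto simp: initial_at_def in_keys_iff c_def)
    show "\<exists>f\<in>V k. lookup f u = TReal 0 \<and> keys f \<subseteq> insert u (std ?M k)"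
      using V_scale[OF f(1), of "-c"] f(3) c
      by (intro bexI[of _ "Poly_Mapping.single 0 (TReal (- c)) * f"]) (auto simp: keys_single_mult lookup_single_mult)
  qed
  ultimately show ?thesis using ME by (simp add: initial_ideals_def)
qed

lemma initial_at_circuit_initial_set:
  assumes to: "term_order pos wpos L" and u: "(k, u) \<in> initial_set pos"
  shows "initial_at pos (circuit (initial_set pos) k u) u"
  using initial_set_reduced[OF to u] initial_at_circuit[OF initial_set_initial_ideal[OF to] u] by blast

end

section \<open>Dickson's lemma and finiteness of the set of initial ideals\<close>

lemma nat_seq_mono_subseq:
  fixes y :: "nat \<Rightarrow> nat"
  shows "\<exists>r::nat \<Rightarrow> nat. strict_mono r \<and> mono (y \<circ> r)"
proof -
  obtain r where r: "strict_mono r" "monoseq (\<lambda>n. y (r n))" using seq_monosub[of y] by blast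
  show ?thesis
  proof (cases "mono (y \<circ> r)")
    case False
    \<comment> \<open>A decreasing sequence of natural numbers is constant from the index
      \<open>n0\<close> of its least value on, so its tail is also nondecreasing.\<close>
    then have dec: "y (r n) \<le> y (r m)" if "m \<le> n" for m n
      using r(2) that unfolding monoseq_def mono_def by auto
    obtain n0 where n0: "\<And>n. y (r n0) \<le> y (r n)"
      using ex_has_least_nat[of "\<lambda>_. True" 0 "\<lambda>n. y (r n)"] by auto
    have "y (r (n0 + n)) = y (r n0)" for n using n0[of "n0 + n"] dec[of n0 "n0 + n"] by simp
    moreover have "strict_mono (\<lambda>n. r (n0 + n))" using r(1) by (simp add: strict_mono_def)
    ultimately show ?thesis by (intro exI[of _ "\<lambda>n. r (n0 + n)"]) (simp add: mono_def)
  qed (use r in blast)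
qed

lemma dickson_subseq:
  fixes x :: "nat \<Rightarrow> 'c \<Rightarrow> nat"
  assumes "finite C"
  shows "\<exists>r::nat \<Rightarrow> nat. strict_mono r \<and> (\<forall>c\<in>C. mono (\<lambda>i. x (r i) c))"
  using assms
proof (induction C rule: finite_induct)
  case empty then show ?case by (intro exI[of _ id]) (simp add: strict_mono_def)
next
  case (insert c C)
  then obtain r :: "nat \<Rightarrow> nat" where r: "strict_mono r" "\<forall>c\<in>C. mono (\<lambda>i. x (r i) c)" by blast
  obtain r' :: "nat \<Rightarrow> nat" where r': "strict_mono r'" "mono (\<lambda>i. x (r (r' i)) c)"
    using nat_seq_mono_subseq[of "\<lambda>i. x (r i) c"] by (auto simp: o_def)
  have "mono (\<lambda>i. x (r (r' i)) d)" if "d \<in> C" for d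
    using r(2) that strict_mono_mono[OF r'(1)] unfolding mono_def by blast
  then show ?case using r' strict_mono_o[OF r(1) r'(1)] by (intro exI[of _ "\<lambda>n. r (r' n)"]) (auto simp: o_def)
qed

context laurent_tropical_ideal
begin

text \<open>
  Dickson's lemma for the natural numbers \<open>k \<plusminus> a \<bullet> b\<close>, which turn divisibility of \<open>(k, a)\<close> into
  the componentwise order.
\<close>

lemma E_dickson:
  fixes k :: "nat \<Rightarrow> nat" and a :: "nat \<Rightarrow> 'a"
  assumes a: "\<And>n. a n \<in> E (k n)"
  obtains i j where "i < j" "k i \<le> k j" "a j - a i \<in> E (k j - k i)"
proof -
  define y where "y n = (\<lambda>(b, s). nat \<lfloor>real (k n) + s * (a n \<bullet> b)\<rfloor>)" for n
  obtain r :: "nat \<Rightarrow> nat" where r: "strict_mono r" "\<forall>c\<in>B \<times> {1,-1}. mono (\<lambda>i. y (r i) c)"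
    using dickson_subseq[of "B \<times> {1,-1}" y] finite_B by auto
  \<comment> \<open>For empty \<open>B\<close> the coordinates \<open>y\<close> say nothing about
    \<open>k\<close>, so its monotonicity is arranged separately.\<close>
  obtain r' :: "nat \<Rightarrow> nat" where r': "strict_mono r'" "mono (k \<circ> (r \<circ> r'))"
    using nat_seq_mono_subseq[of "k \<circ> r"] by (auto simp: o_assoc)
  define i j where "i = r (r' 0)" and "j = r (r' 1)"
  have ij: "i < j" using r r' by (simp add: i_def j_def strict_mono_def)
  have kij: "k i \<le> k j" using r'(2) by (simp add: mono_def i_def j_def)
  have y: "real (y n (b, s)) = real (k n) + s * (a n \<bullet> b)" if "b \<in> B" "s \<in> {1,-1}" for n b s
  proof -
    have "s * (a n \<bullet> b) \<in> \<int>" using that B_int[of "a n" b] a[of n] by (auto simp: E_def)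
    then have "real (k n) + s * (a n \<bullet> b) \<in> \<int>" by simp
    moreover have "0 \<le> real (k n) + s * (a n \<bullet> b)" using a[of n] that by (auto simp: E_def abs_le_iff)
    ultimately show ?thesis by (auto simp: y_def elim!: Ints_cases)
  qed
  have "\<bar>(a j - a i) \<bullet> b\<bar> \<le> real (k j - k i)" if b: "b \<in> B" for b
  proof -
    have le: "y i (b, s) \<le> y j (b, s)" if "s \<in> {1,-1}" for s
    proof -
      have "mono (\<lambda>i. y (r i) (b, s))" using r(2) b that by blast
      moreover have "r' 0 \<le> r' 1" using strict_mono_mono[OF r'(1)] by (simp add: mono_def)
      ultimately show ?thesis unfolding mono_def i_def j_def by blast
    qed
    \<comment> \<open>The signs 1 and -1 give the two halves of the bound on the absolute
      value.\<close>
    have "real (k i) + s * (a i \<bullet> b) \<le> real (k j) + s * (a j \<bullet> b)" if "s \<in> {1,-1}" for s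
      using le[OF that] y[OF b that] by (metis of_nat_le_iff)
    from this[of 1] this[of "-1"] show ?thesis using kij by (auto simp: abs_le_iff inner_diff_left of_nat_diff)
  qed
  moreover have "a j - a i \<in> L" using a[of i] a[of j] L_diff by (auto simp: E_def)
  ultimately have "a j - a i \<in> E (k j - k i)" by (auto simp: E_def)
  then show ?thesis using that ij kij by blast
qed

text \<open>Otherwise \<open>M\<close> would contain a sequence of increasing degrees in which no
  element divides a later one, which \<open>E_dickson\<close> excludes.\<close>

lemma initial_ideal_generators_bounded:
  assumes M: "M \<in> initial_ideals"
  shows "\<exists>D. \<forall>k a. (k, a) \<in> M \<longrightarrow> (\<exists>l b. (l, b) \<in> M \<and> l \<le> D \<and> l \<le> k \<and> a - b \<in> E (k - l))"
proof (rule ccontr)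
  assume neg: "\<not> ?thesis"
  define bad where "bad D y \<longleftrightarrow> y \<in> M \<and>
    (\<forall>l b. (l, b) \<in> M \<longrightarrow> l \<le> D \<longrightarrow> l \<le> fst y \<longrightarrow> snd y - b \<notin> E (fst y - l))" for D y
  have ex: "\<exists>y. bad D y" for D using neg unfolding bad_def by fastforce
  then obtain z where z: "\<And>D. bad D (z D)" by metis
  \<comment> \<open>Every element divides itself, so a bad one must have degree beyond
    \<open>D\<close>.\<close>
  have zD: "D < fst (z D)" for D
  proof (rule ccontr)
    assume "\<not> D < fst (z D)"
    moreover have "snd (z D) - snd (z D) \<in> E (fst (z D) - fst (z D))" by (simp add: E_def L_zero)
    ultimately show False using z[of D] unfolding bad_def by (metis leI order_refl prod.collapse)
  qed
  \<comment> \<open>Each element is bad for the degree of its predecessor, hence divisible by none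
    of the earlier ones, whose degrees are all within that bound.\<close>
  define x where "x = rec_nat (z 0) (\<lambda>_ y. z (fst y))"
  have xS: "x (Suc n) = z (fst (x n))" for n by (simp add: x_def)
  have xM: "x n \<in> M" for n using z by (cases n) (auto simp: x_def bad_def)
  have "strict_mono (\<lambda>n. fst (x n))" by (rule strict_mono_Suc_iff[THEN iffD2]) (simp add: xS zD)
  note mono = strict_mono_mono[OF this]
  have "snd (x n) \<in> E (fst (x n))" for n using xM[of n] M by (auto simp: initial_ideals_def)
  then obtain i j where ij: "i < j" "fst (x i) \<le> fst (x j)" "snd (x j) - snd (x i) \<in> E (fst (x j) - fst (x i))"
    using E_dickson[of "\<lambda>n. snd (x n)" "\<lambda>n. fst (x n)"] by blast
  obtain j' where j': "j = Suc j'" using ij(1) by (cases j) auto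
  have "bad (fst (x j')) (x j)" using z by (simp add: j' xS)
  moreover have "fst (x i) \<le> fst (x j')" using mono ij(1) j' by (simp add: mono_def)
  ultimately show False using ij xM[of i] unfolding bad_def by (metis prod.collapse)
qed

text \<open>
  A limit \<open>M\<close> of infinitely many such sets is again one of them, as every condition involves only
  finitely many degrees.  It is generated in bounded degree, hence contained in, and by the
  antichain property equal to, each of the sets that agree with it up to that degree.
\<close>

lemma finite_initial_ideals: "finite initial_ideals"
proof (rule ccontr)
  assume inf: "infinite initial_ideals"
  define sl :: "nat \<Rightarrow> (nat \<times> 'a) set \<Rightarrow> 'a set" where "sl n M = {a. (n, a) \<in> M}" for n M
  \<comment> \<open>Nested infinite families whose members agree in all degrees below
    \<open>n\<close>. The pigeonhole principle applies because \<open>E n\<close> has only finitely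
    many subsets.\<close>
  have "\<exists>S. \<forall>n. (S n \<subseteq> initial_ideals \<and> infinite (S n)) \<and>
    (S (Suc n) \<subseteq> S n \<and> (\<exists>T. \<forall>M\<in>S (Suc n). sl n M = T))"
  proof (rule dependent_nat_choice[where P = "\<lambda>_ S. S \<subseteq> initial_ideals \<and> infinite S"
        and Q = "\<lambda>n S S'. S' \<subseteq> S \<and> (\<exists>T. \<forall>M\<in>S'. sl n M = T)"])
    fix S n assume S: "S \<subseteq> initial_ideals \<and> infinite S"
    have "sl n ` S \<subseteq> Pow (E n)" using S by (auto simp: sl_def initial_ideals_def)
    then have "finite (sl n ` S)" by (rule finite_subset) (simp add: finite_E)
    then obtain M0 where "M0 \<in> S" "infinite {M\<in>S. sl n M = sl n M0}" using pigeonhole_infinite S by blast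
    then show "\<exists>S'. (S' \<subseteq> initial_ideals \<and> infinite S') \<and> S' \<subseteq> S \<and> (\<exists>T. \<forall>M\<in>S'. sl n M = T)"
      using S by (intro exI[of _ "{M\<in>S. sl n M = sl n M0}"]) auto
  qed (use inf in blast)
  then obtain S where "\<forall>n. (S n \<subseteq> initial_ideals \<and> infinite (S n)) \<and>
    (S (Suc n) \<subseteq> S n \<and> (\<exists>T. \<forall>M\<in>S (Suc n). sl n M = T))" ..
  then have S: "S n \<subseteq> initial_ideals" "infinite (S n)" "S (Suc n) \<subseteq> S n"
    and "\<exists>T. \<forall>M\<in>S (Suc n). sl n M = T" for n by simp_all
  from this(4) obtain T where T: "\<And>n M. M \<in> S (Suc n) \<Longrightarrow> sl n M = T n" by metis
  have dec: "S n \<subseteq> S m" if "m \<le> n" for m n using that S(3) by (rule lift_Suc_antimono_le[rotated])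
  have agree: "sl k M = T k" if "M \<in> S n" "k < n" for k n M using T[of M k] dec[of "Suc k" n] that by auto
  define M where "M = {(k, a). a \<in> T k}"
  have slM: "sl k M = T k" for k by (simp add: sl_def M_def)
  have mem: "(k, a) \<in> M \<longleftrightarrow> (k, a) \<in> M'" if "M' \<in> S n" "k < n" for M' n k a
    using agree[OF that] slM[of k] unfolding sl_def by blast
  have M: "M \<in> initial_ideals"
    unfolding initial_ideals_def
  proof (intro CollectI conjI allI impI)
    fix k a assume ka: "(k, a) \<in> M"
    obtain M' where M': "M' \<in> S (Suc k)" using S(2) by (metis finite.emptyI ex_in_conv)
    have "M' \<in> initial_ideals" using M' S(1) by blast
    then show "a \<in> E k" using mem[OF M'] ka by (auto simp: initial_ideals_def)
  next
    fix k a l b assume kab: "(k, a) \<in> M" "b \<in> E l"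
    obtain M' where M': "M' \<in> S (Suc (k + l))" using S(2) by (metis finite.emptyI ex_in_conv)
    have "M' \<in> initial_ideals" using M' S(1) by blast
    then show "(k + l, a + b) \<in> M" using mem[OF M', of k a] mem[OF M', of "k+l" "a+b"] kab
      by (auto simp: initial_ideals_def)
  next
    fix k
    obtain M' where M': "M' \<in> S (Suc k)" using S(2) by (metis finite.emptyI ex_in_conv)
    have "M' \<in> initial_ideals" using M' S(1) by blast
    moreover have "std M k = std M' k" using mem[OF M', of k] by (auto simp: std_def)
    ultimately show "basis k (std M k)" using initial_ideals_basis by metis
  qed
  obtain D where D: "\<And>k a. (k, a) \<in> M \<Longrightarrow> \<exists>l b. (l, b) \<in> M \<and> l \<le> D \<and> l \<le> k \<and> a - b \<in> E (k - l)"
    using initial_ideal_generators_bounded[OF M] by blast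
  have "M' = M" if M': "M' \<in> S (Suc D)" for M'
  proof -
    have M'I: "M' \<in> initial_ideals" using M' S(1) by blast
    have "(k, a) \<in> M'" if ka: "(k, a) \<in> M" for k a
    proof -
      obtain l b where lb: "(l, b) \<in> M" "l \<le> D" "l \<le> k" "a - b \<in> E (k - l)" using D[OF ka] by blast
      then have "(l, b) \<in> M'" using mem[OF M', of l b] by simp
      then have "(l + (k - l), b + (a - b)) \<in> M'" using M'I lb(4) unfolding initial_ideals_def by blast
      then show ?thesis using lb(3) by simp
    qed
    then have "M \<subseteq> M'" by auto
    then show ?thesis using initial_ideals_antichain[OF M M'I] by simp
  qed
  then have "S (Suc D) \<subseteq> {M}" by blast
  then show False using S(2) finite_subset by blast
qed

section \<open>Compatible weights and the finite basis\<close>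

lemma generic_functional: "\<exists>\<eta>. \<forall>a\<in>L - {0}. a \<bullet> \<eta> \<noteq> 0"
proof -
  have "L \<subseteq> (\<Union>k. E k)"
  proof
    fix a assume "a \<in> L" then show "a \<in> (\<Union>k. E k)" using E_exhausts[of "{a}"] by auto
  qed
  then have "countable L" by (rule countable_subset) (auto intro: countable_finite finite_E)
  \<comment> \<open>The hyperplanes orthogonal to the countably many exponents are null sets, so
    they do not cover the space.\<close>
  then have "negligible (\<Union>((\<lambda>a. {x. a \<bullet> x = 0}) ` (L - {0})))"
    by (intro negligible_countable_Union) (auto intro: negligible_hyperplane)
  then have "(\<Union>((\<lambda>a. {x. a \<bullet> x = 0}) ` (L - {0}))) \<noteq> UNIV" using non_negligible_UNIV by metis
  then show ?thesis by auto
qed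

text \<open>The weights \<open>w\<close> with \<open>M \<in> compatible w\<close> form the closed
  Groebner cell of \<open>M\<close>. As a subset of the finite set \<open>initial_ideals\<close>,
  \<open>compatible w\<close> takes only finitely many values. The coefficient at \<open>a\<close>
  does not appear in the inequality because circuits are normalized there.\<close>

definition compatible :: "'a \<Rightarrow> (nat \<times> 'a) set set" where
  "compatible w = {M\<in>initial_ideals. \<forall>k a. (k, a) \<in> M \<longrightarrow> (\<forall>x\<in>keys (circuit M k a).
     0 \<le> tval (lookup (circuit M k a) x) + (x - a) \<bullet> w)}"

text \<open>
  The initial ideal at \<open>w\<close>, with ties broken first by moving infinitesimally into the direction \<open>v\<close>
  and then by a functional that is injective on \<open>L\<close>.
\<close>

lemma directional_initial_ideal:
  obtains M where "M \<in> compatible w" "\<And>k a x. (k, a) \<in> M \<Longrightarrow> x \<in> keys (circuit M k a) \<Longrightarrow>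
    tval (lookup (circuit M k a) x) + (x - a) \<bullet> w = 0 \<Longrightarrow> 0 \<le> (x - a) \<bullet> v"
proof -
  obtain \<eta> where \<eta>: "\<And>a. a \<in> L \<Longrightarrow> a \<noteq> 0 \<Longrightarrow> a \<bullet> \<eta> \<noteq> 0" using generic_functional by blast
  define pos where "pos c a \<longleftrightarrow> 0 < c + a \<bullet> w \<or> (c + a \<bullet> w = 0 \<and> (0 < a \<bullet> v \<or> (a \<bullet> v = 0 \<and> 0 < a \<bullet> \<eta>)))" for c a
  define wpos where "wpos c a \<longleftrightarrow> pos c a \<or> (c = 0 \<and> a = 0)" for c a
  have to: "term_order pos wpos L"
  proof
    fix c d :: real and a b :: 'a
    show "pos c 0 \<Longrightarrow> 0 < c" by (auto simp: pos_def)
    show "pos c a \<Longrightarrow> c \<le> d \<Longrightarrow> pos d a" by (auto simp: pos_def)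
    show "pos c a \<Longrightarrow> wpos d b \<Longrightarrow> pos (c + d) (a + b)" by (auto simp: pos_def wpos_def inner_add_left)
    show "wpos c a \<longleftrightarrow> pos c a \<or> (c = 0 \<and> a = 0)" by (rule wpos_def)
    show "pos c a \<or> pos (- c) (- a)" if "a \<in> L" "a \<noteq> 0" using \<eta>[OF that] by (auto simp: pos_def)
  qed
  let ?M = "initial_set pos"
  have M: "?M \<in> initial_ideals" by (rule initial_set_initial_ideal[OF to])
  have pos: "pos (tval (lookup (circuit ?M k a) x)) (x - a) \<or> x = a"
    if "(k, a) \<in> ?M" "x \<in> keys (circuit ?M k a)" for k a x
    using initial_at_circuit_initial_set[OF to that(1)] that(2) circuit(2)[OF M that(1)]
    by (auto simp: initial_at_def)
  show ?thesis
  proof (rule that)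
    have "0 \<le> tval (lookup (circuit ?M k a) x) + (x - a) \<bullet> w" if "(k, a) \<in> ?M" "x \<in> keys (circuit ?M k a)" for k a x
      using pos[OF that] circuit(2)[OF M that(1)] by (auto simp: pos_def)
    then show "?M \<in> compatible w" using M by (auto simp: compatible_def)
    show "0 \<le> (x - a) \<bullet> v" if "(k, a) \<in> ?M" "x \<in> keys (circuit ?M k a)"
      "tval (lookup (circuit ?M k a) x) + (x - a) \<bullet> w = 0" for k a x
      using pos[OF that(1,2)] that(3) by (auto simp: pos_def)
  qed
qed

text \<open>An initial exponent for the plain weight \<open>w\<close> means that the minimum is
  attained only once, so this is the contrapositive of an inclusion of varieties.\<close>

theorem finite_tropical_basis:
  "\<exists>F\<subseteq>J. finite F \<and> (\<forall>w. (\<exists>f\<in>J. \<exists>u. initial_at (\<lambda>c a. 0 < c + a \<bullet> w) f u) \<longrightarrow>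
     (\<exists>f\<in>F. \<exists>u. initial_at (\<lambda>c a. 0 < c + a \<bullet> w) f u))"
proof -
  let ?pos = "\<lambda>w c a. 0 < c + a \<bullet> (w::'a)"
  define good where "good C k u \<longleftrightarrow> (\<exists>w. compatible w = C \<and> (\<exists>f\<in>V k. initial_at (?pos w) f u))" for C k u
  \<comment> \<open>The degree is fixed along with the exponent because a fundamental circuit
    depends on both. For a class \<open>C\<close> without a good pair the choice is arbitrary, and
    the resulting circuits are merely further elements of \<open>J\<close>.\<close>
  define K U where "K C = (SOME k. \<exists>u. good C k u)" and "U C = (SOME u. good C (K C) u)" for C
  have KU: "good C (K C) (U C)" if "good C k u" for C k u
    using someI_ex[of "\<lambda>k. \<exists>u. good C k u"] someI_ex[of "\<lambda>u. good C (K C) u"] that unfolding K_def U_def by blast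
  define F where "F = (\<lambda>(M, C). circuit M (K C) (U C)) `
     {(M, C). M \<in> initial_ideals \<and> C \<in> Pow initial_ideals \<and> (K C, U C) \<in> M}"
  have "{(M, C). M \<in> initial_ideals \<and> C \<in> Pow initial_ideals \<and> (K C, U C) \<in> M}
      \<subseteq> initial_ideals \<times> Pow initial_ideals" by blast
  moreover have "finite (initial_ideals \<times> Pow initial_ideals)" by (simp add: finite_initial_ideals)
  ultimately have "finite F" unfolding F_def by (intro finite_imageI) (rule finite_subset)
  moreover have "F \<subseteq> J" unfolding F_def using circuit(1) by (auto simp: V_def)
  moreover have "\<exists>f\<in>F. \<exists>u. initial_at (?pos w') f u" if ex: "\<exists>f\<in>J. \<exists>u. initial_at (?pos w') f u" for w'
  proof -
    define C where "C = compatible w'"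
    obtain f u where f: "f \<in> J" "initial_at (?pos w') f u" using ex by blast
    obtain k where "keys f \<subseteq> E k" using E_exhausts[OF _ J_keys[OF f(1)]] by auto
    then have "good C k u" using f unfolding good_def C_def V_def by blast
    from KU[OF this] obtain w g where w: "compatible w = C" and g: "g \<in> V (K C)" "initial_at (?pos w) g (U C)"
      unfolding good_def by blast
    obtain M where M: "M \<in> compatible w'" and dir: "\<And>k a x. (k, a) \<in> M \<Longrightarrow> x \<in> keys (circuit M k a) \<Longrightarrow>
      tval (lookup (circuit M k a) x) + (x - a) \<bullet> w' = 0 \<Longrightarrow> 0 \<le> (x - a) \<bullet> (w' - w)"
      using directional_initial_ideal[of w' "w' - w"] by blast
    have Mw: "M \<in> compatible w" using M w C_def by simp
    have MI: "M \<in> initial_ideals" using M by (simp add: compatible_def)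
    have tc: "term_cone (?pos w) (\<lambda>c a. 0 \<le> c + a \<bullet> w)" by unfold_locales (auto simp: inner_add_left)
    have ext: "(K C, U C) \<in> M" "initial_at (?pos w) (circuit M (K C) (U C)) (U C)"
      using initial_at_extend[OF tc MI _ g] Mw by (auto simp: compatible_def)
    let ?c = "circuit M (K C) (U C)"
    have cu: "tval (lookup ?c (U C)) = 0" using circuit(2)[OF MI ext(1)] by simp
    \<comment> \<open>An affine function that is positive at \<open>w\<close> and vanishes at \<open>w'\<close> is negative just beyond \<open>w'\<close>.\<close>
    have "0 < tval (lookup ?c x) + (x - U C) \<bullet> w'" if x: "x \<in> keys ?c" "x \<noteq> U C" for x
    proof -
      have "0 \<le> tval (lookup ?c x) + (x - U C) \<bullet> w'" using M ext(1) x by (auto simp: compatible_def)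
      moreover have "0 < tval (lookup ?c x) + (x - U C) \<bullet> w" using ext(2) x cu by (auto simp: initial_at_def)
      ultimately show ?thesis using dir[OF ext(1) x(1)] by (force simp: inner_diff_right)
    qed
    then have "initial_at (?pos w') ?c (U C)" using ext(2) cu by (auto simp: initial_at_def)
    moreover have "?c \<in> F" unfolding F_def using MI ext(1) by (auto simp: C_def compatible_def intro!: image_eqI[of _ _ "(M, C)"])
    ultimately show ?thesis by blast
  qed
  ultimately show ?thesis by blast
qed

end

section \<open>Minima over finite supports\<close>

lemma trop_add_eq_min: "x + y = min x (y::trop)"
  by (cases x; cases y) (auto simp: min_def)

lemma trop_le_TInf [simp]: "x \<le> TInf"
  by (cases x) auto

lemma trop_sum_le:
  fixes t :: "'k \<Rightarrow> trop"
  assumes "finite A" "a \<in> A" shows "sum t A \<le> t a"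
  using assms by (induction A rule: finite_induct) (auto simp: trop_add_eq_min min.coboundedI2)

lemma trop_sum_attained:
  fixes t :: "'k \<Rightarrow> trop"
  assumes "finite A" "A \<noteq> {}" shows "\<exists>a\<in>A. t a = sum t A"
  using assms
proof (induction A rule: finite_ne_induct)
  case (insert x A)
  then show ?case by (auto simp: trop_add_eq_min min_def)
qed auto

lemma trop_sum_eq_iff:
  fixes t :: "'k \<Rightarrow> trop"
  assumes "finite A" "a \<in> A" shows "t a = sum t A \<longleftrightarrow> (\<forall>c\<in>A. t a \<le> t c)"
  using assms trop_sum_le[OF assms(1)] trop_sum_attained[OF assms(1), of t]
  by (metis antisym empty_iff)

lemma trop_sum_eq_TInf_iff:
  fixes t :: "'k \<Rightarrow> trop"
  assumes "finite A" shows "sum t A = TInf \<longleftrightarrow> (\<forall>c\<in>A. t c = TInf)"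
proof -
  have "x + y = TInf \<longleftrightarrow> x = TInf \<and> y = TInf" for x y :: trop by (cases x; cases y) auto
  with assms show ?thesis by (induction A rule: finite_induct) (auto simp: zero_trop_def)
qed

lemma min_twice_iff:
  assumes "finite A"
  shows "min_twice A t \<longleftrightarrow> (\<exists>a\<in>A. \<exists>b\<in>A. a \<noteq> b \<and> (\<forall>c\<in>A. t a \<le> t c \<and> t b \<le> t c))"
  unfolding min_twice_def using trop_sum_eq_iff[OF assms] by (metis (no_types, lifting))

text \<open>The bridge between varieties and initial exponents: a nonempty finite support has a
  lowest term, strictly lowest unless a second one ties with it.\<close>

lemma not_min_twice_iff:
  fixes f :: "'a::euclidean_space \<Rightarrow>\<^sub>0 trop"
  assumes "f \<noteq> 0"
  shows "\<not> min_twice (keys f) (\<lambda>u. lookup f u * TReal (u \<bullet> w)) \<longleftrightarrow>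
    (\<exists>u. initial_at (\<lambda>c a. 0 < c + a \<bullet> w) f u)"
proof -
  define W where "W u = tval (lookup f u) + u \<bullet> w" for u
  have le: "lookup f a * TReal (a \<bullet> w) \<le> lookup f b * TReal (b \<bullet> w) \<longleftrightarrow> W a \<le> W b"
    if "a \<in> keys f" "b \<in> keys f" for a b
    using that by (cases "lookup f a"; cases "lookup f b") (auto simp: W_def in_keys_iff zero_trop_def)
  have mt: "min_twice (keys f) (\<lambda>u. lookup f u * TReal (u \<bullet> w)) \<longleftrightarrow>
     (\<exists>a\<in>keys f. \<exists>b\<in>keys f. a \<noteq> b \<and> (\<forall>c\<in>keys f. W a \<le> W c \<and> W b \<le> W c))"
    by (simp add: min_twice_iff le cong: bex_cong)
  have ini: "initial_at (\<lambda>c a. 0 < c + a \<bullet> w) f u \<longleftrightarrow> u \<in> keys f \<and> (\<forall>b\<in>keys f. b \<noteq> u \<longrightarrow> W u < W b)" for u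
    by (auto simp: initial_at_def W_def inner_diff_left)
  obtain u where u: "u \<in> keys f" "\<And>b. b \<in> keys f \<Longrightarrow> W u \<le> W b"
    using finite_keys[of f] assms by (metis arg_min_if_finite(1) arg_min_least keys_eq_empty)
  show ?thesis unfolding mt ini
  proof
    assume nt: "\<not> (\<exists>a\<in>keys f. \<exists>b\<in>keys f. a \<noteq> b \<and> (\<forall>c\<in>keys f. W a \<le> W c \<and> W b \<le> W c))"
    have "W u < W b" if "b \<in> keys f" "b \<noteq> u" for b
    proof (rule ccontr)
      assume "\<not> W u < W b"
      then have "W u \<le> W c \<and> W b \<le> W c" if "c \<in> keys f" for c using u(2)[OF that] by auto
      then show False using nt u(1) that by blast
    qed
    then show "\<exists>u. u \<in> keys f \<and> (\<forall>b\<in>keys f. b \<noteq> u \<longrightarrow> W u < W b)" using u(1) by blast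
  next
    assume "\<exists>u. u \<in> keys f \<and> (\<forall>b\<in>keys f. b \<noteq> u \<longrightarrow> W u < W b)"
    then show "\<not> (\<exists>a\<in>keys f. \<exists>b\<in>keys f. a \<noteq> b \<and> (\<forall>c\<in>keys f. W a \<le> W c \<and> W b \<le> W c))"
      by (metis leD)
  qed
qed

section \<open>Lattices and cones\<close>

lemma int_span_subset_span: "int_span B \<subseteq> span B"
  unfolding int_span_def by (auto intro!: span_sum span_scale intro: span_base)

lemma base_in_int_span:
  assumes "finite B" "b \<in> B" shows "b \<in> int_span B"
proof -
  have "(\<Sum>x\<in>B. of_int (if x = b then 1 else 0) *\<^sub>R x) = (\<Sum>x\<in>B. if x = b then x else 0)"
    by (intro sum.cong) auto
  then have "b = (\<Sum>x\<in>B. of_int (if x = b then 1 else 0) *\<^sub>R x)" using assms by simp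
  then show ?thesis unfolding int_span_def by (intro CollectI exI[of _ "\<lambda>x. if x = b then 1 else 0"]) simp
qed

text \<open>The adjoint turns a linear extension of \<open>p\<close> into a vector, and projecting
  that vector orthogonally to \<open>span B\<close> leaves its inner products with \<open>B\<close>
  unchanged.\<close>

lemma dual_basis_vector:
  fixes B :: "'a::euclidean_space set" and p :: "'a \<Rightarrow> real"
  assumes "independent B"
  shows "\<exists>u\<in>span B. \<forall>b\<in>B. u \<bullet> b = p b"
proof -
  obtain g where g: "linear g" "\<forall>x\<in>B. g x = p x" using real_vector.linear_independent_extend[OF assms]
    by (metis linear_def real_scaleR_def scaleR_conv_of_real linear_independent_extend assms)
  have "x \<bullet> adjoint g 1 = g x" for x using adjoint_works[OF g(1), of x 1] by simp
  moreover obtain y z where yz: "y \<in> span B" "\<And>w. w \<in> span B \<Longrightarrow> orthogonal z w" "adjoint g 1 = y + z"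
    using orthogonal_subspace_decomp_exists by metis
  ultimately have "y \<bullet> b = p b" if "b \<in> B" for b
    using that g(2) yz(2)[OF span_base[OF that]] by (metis add.right_neutral inner_add_left inner_commute orthogonal_def)
  then show ?thesis using yz(1) by blast
qed

lemma dual_lattice_int_spanI:
  assumes "finite B" "u \<in> span B" "\<And>b. b \<in> B \<Longrightarrow> u \<bullet> b \<in> \<int>"
  shows "u \<in> dual_lattice (int_span B)"
proof -
  have "span B \<subseteq> span (int_span B)" using base_in_int_span[OF assms(1)] by (intro span_mono) auto
  moreover have "u \<bullet> v \<in> \<int>" if "v \<in> int_span B" for v
    using that assms(3) by (auto simp: int_span_def inner_sum_right intro!: Ints_sum Ints_mult)
  ultimately show ?thesis using assms(2) by (auto simp: dual_lattice_def)
qed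

text \<open>
  Simultaneous Diophantine approximation replaces a real functional by an integral one: where the
  former vanishes, the latter is an integer of absolute value less than \<open>1\<close>.
\<close>

lemma dual_lattice_sign_vector:
  fixes N :: "'a::euclidean_space set"
  assumes N: "is_lattice N" and X: "finite X" "X \<subseteq> N"
  obtains u0 where "u0 \<in> dual_lattice N" "\<And>x. x \<in> X \<Longrightarrow> u \<bullet> x = 0 \<Longrightarrow> u0 \<bullet> x = 0"
    "\<And>x. x \<in> X \<Longrightarrow> 0 < u \<bullet> x \<Longrightarrow> 0 < u0 \<bullet> x"
proof -
  obtain B where B: "finite B" "independent B" "N = int_span B" using N unfolding is_lattice_def by blast
  obtain h where h: "bij_betw h {0..<card B} B" using ex_bij_betw_nat_finite[OF B(1)] by blast
  have "\<exists>c :: 'a \<Rightarrow> int. x = (\<Sum>b\<in>B. of_int (c b) *\<^sub>R b)" if "x \<in> X" for x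
    using that X(2) unfolding B(3) int_span_def by blast
  then obtain c :: "'a \<Rightarrow> 'a \<Rightarrow> int" where c: "\<And>x. x \<in> X \<Longrightarrow> x = (\<Sum>b\<in>B. of_int (c x b) *\<^sub>R b)" by metis
  \<comment> \<open>\<open>C\<close> strictly exceeds the sum of the absolute coordinates of each
    \<open>x\<close> in \<open>X\<close>, so an error of \<open>1 / K\<close> on the basis becomes
    one below \<open>C / K\<close> on \<open>X\<close>.\<close>
  define C where "C = 1 + (\<Sum>x\<in>X. \<Sum>b\<in>B. \<bar>real_of_int (c x b)\<bar>)"
  have C: "(\<Sum>b\<in>B. \<bar>real_of_int (c x b)\<bar>) < C" if "x \<in> X" for x
    using member_le_sum[of x X "\<lambda>x. \<Sum>b\<in>B. \<bar>real_of_int (c x b)\<bar>"] that X(1) unfolding C_def by (auto simp: sum_nonneg)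
  have C1: "C \<ge> 1" unfolding C_def by (auto intro!: sum_nonneg)
  \<comment> \<open>A lower bound for the positive values of \<open>u\<close> on \<open>X\<close>;
    the 1 covers the case that there are none.\<close>
  define \<delta> where "\<delta> = Min (insert 1 ({y\<in>(\<bullet>) u ` X. 0 < y}))"
  have fin: "finite (insert 1 ({y\<in>(\<bullet>) u ` X. 0 < y}))" using X by simp
  have \<delta>: "0 < \<delta>" using Min_in[OF fin] unfolding \<delta>_def by auto
  have \<delta>le: "\<delta> \<le> u \<bullet> x" if "x \<in> X" "0 < u \<bullet> x" for x unfolding \<delta>_def using that by (intro Min_le[OF fin]) auto
  \<comment> \<open>This makes \<open>C / K\<close> at most 1, which forces the zero values, and at
    most \<open>\<delta>\<close>, which preserves the positive ones since the multiplier
    \<open>q\<close> is at least 1.\<close>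
  obtain K :: nat where K: "C + C / \<delta> \<le> real K" using real_arch_simple by blast
  have "C > 0" "C / \<delta> > 0" using C1 \<delta> by auto
  then have K0: "0 < K" "C \<le> real K" "C / \<delta> \<le> real K" using K by (linarith | (rule gr0I; use K in simp))+
  have CK: "C / K \<le> 1" "C / K \<le> \<delta>" using K0 \<delta> by (simp_all add: field_simps)
  obtain q p where qp: "0 < q" "\<And>i. i < card B \<Longrightarrow> \<bar>of_int q * (u \<bullet> h i) - of_int (p i)\<bar> < 1 / K"
    using Dirichlet_approx_simult[OF K0(1), of "card B" "\<lambda>i. u \<bullet> h i"] by metis
  define P where "P b = real_of_int (p (the_inv_into {0..<card B} h b))" for b
  have P: "\<bar>of_int q * (u \<bullet> b) - P b\<bar> \<le> 1 / K" if b: "b \<in> B" for b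
  proof -
    have "b \<in> h ` {0..<card B}" using h b by (simp add: bij_betw_def)
    then obtain i where i: "i < card B" "b = h i" by auto
    then have "P b = of_int (p i)" using h by (simp add: P_def bij_betw_def the_inv_into_f_f)
    then show ?thesis using qp(2)[OF i(1)] i(2) by simp
  qed
  obtain u0 where u0: "u0 \<in> span B" "\<And>b. b \<in> B \<Longrightarrow> u0 \<bullet> b = P b" using dual_basis_vector[OF B(2)] by blast
  have dual: "u0 \<in> dual_lattice N" unfolding B(3) using u0 by (intro dual_lattice_int_spanI[OF B(1)]) (auto simp: P_def)
  have approx: "\<bar>of_int q * (u \<bullet> x) - u0 \<bullet> x\<bar> < C / K" if x: "x \<in> X" for x
  proof -
    have 1: "y \<bullet> x = (\<Sum>b\<in>B. real_of_int (c x b) * (y \<bullet> b))" for y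
      by (subst c[OF x]) (simp add: inner_sum_right)
    have "of_int q * (u \<bullet> x) - u0 \<bullet> x = (\<Sum>b\<in>B. real_of_int (c x b) * (of_int q * (u \<bullet> b) - P b))"
      unfolding 1 using u0(2) by (simp add: sum_distrib_left sum_subtractf[symmetric] algebra_simps)
    also have "\<bar>\<dots>\<bar> \<le> (\<Sum>b\<in>B. \<bar>real_of_int (c x b)\<bar> * (1 / K))"
      by (rule order_trans[OF sum_abs], intro sum_mono, unfold abs_mult) (intro mult_left_mono P abs_ge_zero)
    also have "\<dots> = (\<Sum>b\<in>B. \<bar>real_of_int (c x b)\<bar>) / K" by (simp add: sum_divide_distrib)
    also have "\<dots> < C / K" using C[OF x] K0(1) by (simp add: divide_strict_right_mono)
    finally show ?thesis .
  qed
  show ?thesis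
  proof (rule that[OF dual])
    fix x assume x: "x \<in> X" "u \<bullet> x = 0"
    have "u0 \<bullet> x \<in> \<int>" using dual x X(2) by (auto simp: dual_lattice_def)
    moreover have "\<bar>u0 \<bullet> x\<bar> < 1" using approx[OF x(1)] CK(1) x(2) by simp
    ultimately show "u0 \<bullet> x = 0" by (auto elim!: Ints_cases)
  next
    fix x assume x: "x \<in> X" "0 < u \<bullet> x"
    have "1 * (u \<bullet> x) \<le> of_int q * (u \<bullet> x)" using qp(1) x(2) by (intro mult_right_mono) auto
    then show "0 < u0 \<bullet> x" using approx[OF x(1)] CK(2) \<delta>le[OF x] by linarith
  qed
qed

lemma convex_cone_hull_finite_explicit:
  fixes G :: "'a::real_vector set"
  assumes "finite G"
  shows "convex_cone hull G = {\<Sum>g\<in>G. c g *\<^sub>R g | c. \<forall>g. 0 \<le> (c g :: real)}" (is "_ = ?R")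
proof
  have "convex_cone ?R"
    unfolding convex_cone_iff
  proof (intro conjI ballI allI impI)
    show "0 \<in> ?R" by (auto intro!: exI[of _ "\<lambda>_. 0"])
  next
    fix x y assume "x \<in> ?R" "y \<in> ?R"
    then obtain c d where "x = (\<Sum>g\<in>G. c g *\<^sub>R g)" "y = (\<Sum>g\<in>G. d g *\<^sub>R g)" "\<forall>g. 0 \<le> c g" "\<forall>g. 0 \<le> d g" by blast
    then show "x + y \<in> ?R"
      by (auto intro!: exI[of _ "\<lambda>g. c g + d g"] simp: scaleR_add_left sum.distrib)
  next
    fix x and r :: real assume "x \<in> ?R" "0 \<le> r"
    then obtain c where "x = (\<Sum>g\<in>G. c g *\<^sub>R g)" "\<forall>g. 0 \<le> c g" by blast
    then show "r *\<^sub>R x \<in> ?R" using \<open>0 \<le> r\<close>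
      by (auto intro!: exI[of _ "\<lambda>g. r * c g"] simp: scaleR_sum_right)
  qed
  moreover have "G \<subseteq> ?R"
  proof
    fix x assume "x \<in> G"
    then have "(\<Sum>g\<in>G. (if g = x then 1 else 0) *\<^sub>R g) = x"
      using assms by (simp add: if_distrib[of "\<lambda>z. z *\<^sub>R _"] cong: if_cong)
    then show "x \<in> ?R" by (auto intro!: exI[of _ "\<lambda>g. if g = x then 1 else 0"])
  qed
  ultimately show "convex_cone hull G \<subseteq> ?R" by (intro hull_minimal)
  have "(\<Sum>g\<in>A. c g *\<^sub>R g) \<in> convex_cone hull G" if "A \<subseteq> G" "\<forall>g. 0 \<le> c g" for A and c :: "'a \<Rightarrow> real"
    using finite_subset[OF that(1) assms] that
    by (induction A rule: finite_induct)
       (auto intro!: convex_cone_hull_add convex_cone_hull_mul intro: hull_inc simp: convex_cone_hull_contains_0)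
  then show "?R \<subseteq> convex_cone hull G" by blast
qed

text \<open>In an irredundant generating set of a pointed cone, every generator spans a face.\<close>

lemma pointed_cone_extreme_rays:
  fixes \<sigma> :: "'a::euclidean_space set"
  assumes G: "finite G" "\<sigma> = convex_cone hull G" and pointed: "\<sigma> \<inter> uminus ` \<sigma> = {0}"
  obtains G' where "G' \<subseteq> G" "0 \<notin> G'" "\<sigma> = convex_cone hull G'" "\<And>g. g \<in> G' \<Longrightarrow> convex_cone hull {g} face_of \<sigma>"
proof -
  define P where "P H \<longleftrightarrow> H \<subseteq> G \<and> convex_cone hull H = \<sigma>" for H
  have "P G" using G by (simp add: P_def)
  \<comment> \<open>Minimal cardinality yields irredundance; pointedness then excludes nontrivial
    nonnegative relations among the generators.\<close>
  then obtain H where H: "P H" and least: "\<And>H'. P H' \<Longrightarrow> card H \<le> card H'"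
    using ex_has_least_nat[of P G card] by blast
  have finH: "finite H" using H G(1) finite_subset by (auto simp: P_def)
  have \<sigma>: "\<sigma> = convex_cone hull H" using H by (simp add: P_def)
  have cc: "convex_cone \<sigma>" unfolding \<sigma> by (rule convex_cone_convex_cone_hull)
  have irredundant: "g \<notin> convex_cone hull (H - {g})" if g: "g \<in> H" for g
  proof
    assume "g \<in> convex_cone hull (H - {g})"
    then have "convex_cone hull (H - {g}) = convex_cone hull (insert g (H - {g}))"
      by (rule hull_redundant[symmetric])
    also have "\<dots> = \<sigma>" using g \<sigma> by (simp add: insert_absorb)
    finally have "P (H - {g})" using H by (auto simp: P_def)
    then show False using least[of "H - {g}"] g finH by (metis card_Diff1_less leD)
  qed
  have H0: "0 \<notin> H" using irredundant convex_cone_hull_contains_0 by blast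
  have zero: "c g = 0" if "(\<Sum>h\<in>H. c h *\<^sub>R h) = 0" "\<forall>h\<in>H. 0 \<le> c h" "g \<in> H" for c :: "'a \<Rightarrow> real" and g
  proof (rule ccontr)
    assume "c g \<noteq> 0"
    then have cg: "0 < c g" using that by force
    have in_cone: "(\<Sum>h\<in>A. c h *\<^sub>R h) \<in> \<sigma>" if "A \<subseteq> H" for A
      using finite_subset[OF that finH] that \<open>\<forall>h\<in>H. 0 \<le> c h\<close> unfolding \<sigma>
      by (induction A rule: finite_induct)
         (auto intro!: convex_cone_hull_add convex_cone_hull_mul intro: hull_inc simp: convex_cone_hull_contains_0)
    have "c g *\<^sub>R g + (\<Sum>h\<in>H - {g}. c h *\<^sub>R h) = 0" using that(1,3) finH by (simp add: sum.remove)
    then have "- (c g *\<^sub>R g) \<in> \<sigma>" using in_cone[of "H - {g}"] by (metis Diff_subset add_eq_0_iff)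
    moreover have "c g *\<^sub>R g \<in> \<sigma>" using in_cone[of "{g}"] that(3) by simp
    ultimately have "c g *\<^sub>R g \<in> \<sigma> \<inter> uminus ` \<sigma>" by (auto intro: image_eqI[of _ _ "- (c g *\<^sub>R g)"])
    then have "c g *\<^sub>R g = 0" using pointed by blast
    then show False using cg H0 that(3) by auto
  qed
  have "convex_cone hull {g} face_of \<sigma>" if g: "g \<in> H" for g
  proof -
    have ray: "convex_cone hull {g} = {c *\<^sub>R g | c. 0 \<le> c}"
      by (auto simp: convex_cone_hull_finite_explicit)
    have key: "a \<in> convex_cone hull {g} \<and> b \<in> convex_cone hull {g}"
      if ab: "a \<in> \<sigma>" "b \<in> \<sigma>" and x: "x \<in> convex_cone hull {g}" "x \<in> open_segment a b" for a b x
    proof -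
      obtain \<alpha> where \<alpha>: "a = (\<Sum>h\<in>H. \<alpha> h *\<^sub>R h)" "\<forall>h. 0 \<le> \<alpha> h"
        using ab(1) unfolding \<sigma> convex_cone_hull_finite_explicit[OF finH] by blast
      obtain \<beta> where \<beta>: "b = (\<Sum>h\<in>H. \<beta> h *\<^sub>R h)" "\<forall>h. 0 \<le> \<beta> h"
        using ab(2) unfolding \<sigma> convex_cone_hull_finite_explicit[OF finH] by blast
      obtain c where c: "x = c *\<^sub>R g" using x(1) ray by blast
      obtain t where t: "0 < t" "t < 1" "x = (1 - t) *\<^sub>R a + t *\<^sub>R b" using x(2) by (auto simp: in_segment)
      define \<gamma> where "\<gamma> h = (1 - t) * \<alpha> h + t * \<beta> h" for h
      have \<gamma>0: "0 \<le> \<gamma> h" for h using \<alpha>(2) \<beta>(2) t by (simp add: \<gamma>_def)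
      have "(\<Sum>h\<in>H. \<gamma> h *\<^sub>R h) = x"
        unfolding t(3) \<alpha>(1) \<beta>(1) by (simp add: \<gamma>_def scaleR_add_left sum.distrib scaleR_sum_right)
      then have sum: "(\<Sum>h\<in>H - {g}. \<gamma> h *\<^sub>R h) = (c - \<gamma> g) *\<^sub>R g"
        using g finH by (simp add: sum.remove c scaleR_diff_left) (metis add_diff_cancel_left')
      \<comment> \<open>Were the difference positive, \<open>sum\<close> would express
        \<open>g\<close> through the other generators.\<close>
      have "c - \<gamma> g \<le> 0"
      proof (rule ccontr)
        assume "\<not> c - \<gamma> g \<le> 0"
        then have pos: "0 < c - \<gamma> g" by simp
        have "(\<Sum>h\<in>H - {g}. \<gamma> h *\<^sub>R h) \<in> convex_cone hull (H - {g})"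
          unfolding convex_cone_hull_finite_explicit[OF finite_Diff[OF finH]] using \<gamma>0 by blast
        from convex_cone_hull_mul[OF this, of "1 / (c - \<gamma> g)"] have "g \<in> convex_cone hull (H - {g})"
          unfolding sum using pos by simp
        then show False using irredundant[OF g] by simp
      qed
      \<comment> \<open>Moving \<open>x\<close> to the other side gives a nonnegative relation,
        which must be trivial. So the other generators have coefficient zero in \<open>x\<close>,
        hence in \<open>a\<close> and in \<open>b\<close>.\<close>
      define \<gamma>' where "\<gamma>' h = (if h = g then \<gamma> g - c else \<gamma> h)" for h
      have "(\<Sum>h\<in>H. \<gamma>' h *\<^sub>R h) = (\<gamma> g - c) *\<^sub>R g + (\<Sum>h\<in>H - {g}. \<gamma>' h *\<^sub>R h)"
        using g finH by (simp add: sum.remove \<gamma>'_def)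
      also have "(\<Sum>h\<in>H - {g}. \<gamma>' h *\<^sub>R h) = (c - \<gamma> g) *\<^sub>R g"
        unfolding sum[symmetric] by (intro sum.cong) (auto simp: \<gamma>'_def)
      finally have "(\<Sum>h\<in>H. \<gamma>' h *\<^sub>R h) = 0" by (simp add: algebra_simps)
      then have "\<gamma>' h = 0" if "h \<in> H" for h
        using zero[of \<gamma>' h] that \<gamma>0 \<open>c - \<gamma> g \<le> 0\<close> by (auto simp: \<gamma>'_def)
      then have "\<gamma> h = 0" if "h \<in> H" "h \<noteq> g" for h using that by (metis \<gamma>'_def)
      then have \<alpha>\<beta>: "\<alpha> h = 0" "\<beta> h = 0" if "h \<in> H" "h \<noteq> g" for h
        using that \<alpha>(2) \<beta>(2) t by (auto simp: \<gamma>_def add_nonneg_eq_0_iff)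
      have "a = \<alpha> g *\<^sub>R g" "b = \<beta> g *\<^sub>R g"
        unfolding \<alpha>(1) \<beta>(1) using \<alpha>\<beta> g finH by (auto simp: sum.remove)
      then show ?thesis using ray \<alpha>(2) \<beta>(2) by auto
    qed
    show ?thesis unfolding face_of_def
    proof (intro conjI ballI impI)
      show "convex_cone hull {g} \<subseteq> \<sigma>" unfolding \<sigma> using g by (intro hull_mono) auto
      show "convex (convex_cone hull {g})" by (rule convex_convex_cone_hull)
    qed (use key in blast)+
  qed
  then show ?thesis using that[of H] H H0 \<sigma> by (auto simp: P_def)
qed

lemma convex_cone_hull_singleton: "convex_cone hull {g} = {c *\<^sub>R g | c. 0 \<le> (c::real)}"
  by (auto simp: convex_cone_hull_finite_explicit)

text \<open>An integral functional with value \<open>n > 0\<close> at \<open>g\<close> admits only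
  multiples of \<open>g\<close> by fractions with denominator \<open>n\<close> in the lattice; the
  least positive numerator gives the first lattice point.\<close>

lemma first_lattice_point_exists:
  fixes N :: "'a::euclidean_space set"
  assumes N: "is_lattice N" and g: "g \<in> N" "g \<noteq> 0"
  shows "\<exists>c>0. first_lattice_point N (convex_cone hull {g}) (c *\<^sub>R g)"
proof -
  obtain u where u: "u \<in> dual_lattice N" "0 < u \<bullet> g"
    using dual_lattice_sign_vector[OF N, of "{g}" g] g by auto
  then have "u \<bullet> g \<in> \<int>" using g by (auto simp: dual_lattice_def)
  then obtain n :: nat where n: "u \<bullet> g = real n" using u(2) by (metis Ints_cases of_int_of_nat_eq less_eq_real_def of_int_0_le_iff nonneg_int_cases)
  then have n0: "0 < n" using u(2) by simp
  define P where "P k \<longleftrightarrow> 0 < k \<and> (real k / real n) *\<^sub>R g \<in> N" for k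
  have "P n" using n0 g by (simp add: P_def)
  then obtain k where k: "P k" and least: "\<And>j. P j \<Longrightarrow> k \<le> j" using ex_has_least_nat[of P n "\<lambda>k. k"] by blast
  let ?c = "real k / real n"
  have c: "0 < ?c" using k n0 by (simp add: P_def)
  have "d *\<^sub>R (?c *\<^sub>R g) \<notin> N" if d: "0 < d" "d < 1" for d :: real
  proof
    assume dN: "d *\<^sub>R (?c *\<^sub>R g) \<in> N"
    then have "u \<bullet> (d *\<^sub>R (?c *\<^sub>R g)) \<in> \<int>" using u(1) by (auto simp: dual_lattice_def)
    then have "d * real k \<in> \<int>" using n n0 by simp
    moreover have dk: "0 < d * real k" "d * real k < real k" using d k by (auto simp: P_def)
    ultimately obtain j :: nat where j: "d * real k = real j"
      by (metis Ints_cases of_int_of_nat_eq less_eq_real_def of_int_0_le_iff nonneg_int_cases)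
    have "P j" using dN j dk by (simp add: P_def)
    then show False using least[of j] j dk by simp
  qed
  then have "first_lattice_point N (convex_cone hull {g}) (?c *\<^sub>R g)"
    using c k g n0 by (auto simp: first_lattice_point_def P_def convex_cone_hull_singleton)
  then show ?thesis using c by blast
qed

section \<open>The rays of a fan and the matrix \<open>Q\<close>\<close>

locale cox_fan =
  fixes N :: "'a::euclidean_space set" and \<Sigma> :: "'a set set" and s t :: nat and q :: "nat \<Rightarrow> 'a"
  assumes lattice: "is_lattice N" and fan: "is_fan N \<Sigma>" and cox: "cox_matrix N \<Sigma> s t q"
begin

lemma zero_in_N: "0 \<in> N"
proof -
  obtain B where "N = int_span B" using lattice unfolding is_lattice_def by blast
  then show ?thesis by (auto simp: int_span_def intro!: exI[of _ "\<lambda>_. 0"])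
qed

lemma q_ray: "q ` {1..s} = {v. \<exists>\<rho>\<in>rays \<Sigma>. first_lattice_point N \<rho> v}"
  using cox unfolding cox_matrix_def bij_betw_def by blast

lemma lattice_decomp:
  "N = {x + y | x y. x \<in> N \<inter> span (\<Union>(rays \<Sigma>)) \<and> y \<in> int_span (q ` {s+1..s+t})}"
  using cox unfolding cox_matrix_def Let_def by blast

lemma q_in_N: assumes "i \<in> {1..s+t}" shows "q i \<in> N"
proof (cases "i \<in> {1..s}")
  case True
  then have "q i \<in> q ` {1..s}" by blast
  then show ?thesis unfolding q_ray by (auto simp: first_lattice_point_def)
next
  case False
  then have "q i \<in> int_span (q ` {s+1..s+t})" using assms by (intro base_in_int_span) auto
  moreover have "0 \<in> N \<inter> span (\<Union>(rays \<Sigma>))" using zero_in_N span_zero by blast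
  ultimately show ?thesis by (subst lattice_decomp) (metis (mono_tags, lifting) CollectI add_0)
qed

lemma cone_rays_subset: "cone_rays s q \<sigma> \<subseteq> {1..s+t}"
  by (auto simp: cone_rays_def)

text \<open>A generator of an irredundant set spans a one-dimensional face, which belongs to the fan
  and is thus a ray; its first lattice point is some \<open>q i\<close>, a positive multiple of the
  generator.\<close>

lemma cone_eq_hull:
  assumes "\<sigma> \<in> \<Sigma>" shows "\<sigma> = convex_cone hull (q ` cone_rays s q \<sigma>)"
proof
  have "rational_cone N \<sigma>" using fan assms by (simp add: is_fan_def)
  then obtain G where G: "finite G" "G \<subseteq> N" "\<sigma> = convex_cone hull G" "\<sigma> \<inter> uminus ` \<sigma> = {0}"
    unfolding rational_cone_def by blast
  obtain G' where G': "G' \<subseteq> G" "0 \<notin> G'" "\<sigma> = convex_cone hull G'"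
    "\<And>g. g \<in> G' \<Longrightarrow> convex_cone hull {g} face_of \<sigma>"
    using pointed_cone_extreme_rays[OF G(1,3,4)] by metis
  have "g \<in> convex_cone hull (q ` cone_rays s q \<sigma>)" if g: "g \<in> G'" for g
  proof -
    have g0: "g \<in> N" "g \<noteq> 0" using g G' G by auto
    let ?\<rho> = "convex_cone hull {g}"
    have "\<forall>\<tau>. \<tau> face_of \<sigma> \<and> \<tau> \<noteq> {} \<longrightarrow> \<tau> \<in> \<Sigma>" using fan assms by (simp add: is_fan_def)
    then have "?\<rho> \<in> \<Sigma>" using G'(4)[OF g] convex_cone_hull_nonempty by blast
    moreover have "span ?\<rho> = span {g}"
    proof (rule span_eq[THEN iffD2], intro conjI)
      show "?\<rho> \<subseteq> span {g}" by (auto simp: convex_cone_hull_singleton span_base span_scale)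
      show "{g} \<subseteq> span ?\<rho>" by (simp add: hull_inc span_base)
    qed
    then have "dim ?\<rho> = 1" using g0(2) by (metis dim_singleton dim_span)
    ultimately have "?\<rho> \<in> rays \<Sigma>" by (simp add: rays_def)
    moreover obtain c where c: "0 < c" "first_lattice_point N ?\<rho> (c *\<^sub>R g)"
      using first_lattice_point_exists[OF lattice g0] by blast
    ultimately have "c *\<^sub>R g \<in> q ` {1..s}" unfolding q_ray by blast
    then obtain i where i: "i \<in> {1..s}" "c *\<^sub>R g = q i" by auto
    have "q i \<in> \<sigma>" using c(2) i(2) face_of_imp_subset[OF G'(4)[OF g]] by (auto simp: first_lattice_point_def)
    then have "q i \<in> convex_cone hull (q ` cone_rays s q \<sigma>)" using i(1) by (auto simp: cone_rays_def intro: hull_inc)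
    from convex_cone_hull_mul[OF this, of "1 / c"] show ?thesis unfolding i(2)[symmetric] using c(1) by simp
  qed
  then have "convex_cone hull G' \<subseteq> convex_cone hull (q ` cone_rays s q \<sigma>)"
    by (intro hull_minimal) (auto simp: convex_cone_convex_cone_hull)
  then show "\<sigma> \<subseteq> convex_cone hull (q ` cone_rays s q \<sigma>)" using G'(3) by simp
  have "convex_cone \<sigma>" using G(3) by (simp add: convex_cone_convex_cone_hull)
  then show "convex_cone hull (q ` cone_rays s q \<sigma>) \<subseteq> \<sigma>" by (intro hull_minimal) (auto simp: cone_rays_def)
qed

lemma dual_cone_iff:
  assumes "\<sigma> \<in> \<Sigma>"
  shows "(\<forall>x\<in>\<sigma>. 0 \<le> u \<bullet> x) \<longleftrightarrow> (\<forall>i\<in>cone_rays s q \<sigma>. 0 \<le> u \<bullet> q i)"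
proof
  assume *: "\<forall>i\<in>cone_rays s q \<sigma>. 0 \<le> u \<bullet> q i"
  have "convex_cone {x. 0 \<le> u \<bullet> x}" by (auto simp: convex_cone_iff inner_add_right)
  then have "convex_cone hull (q ` cone_rays s q \<sigma>) \<subseteq> {x. 0 \<le> u \<bullet> x}" using * by (intro hull_minimal) auto
  then show "\<forall>x\<in>\<sigma>. 0 \<le> u \<bullet> x" using cone_eq_hull[OF assms] by blast
qed (auto simp: cone_rays_def)

lemma orth_cone_iff:
  assumes "\<sigma> \<in> \<Sigma>"
  shows "(\<forall>x\<in>\<sigma>. u \<bullet> x = 0) \<longleftrightarrow> (\<forall>i\<in>cone_rays s q \<sigma>. u \<bullet> q i = 0)"
proof
  assume *: "\<forall>i\<in>cone_rays s q \<sigma>. u \<bullet> q i = 0"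
  have "\<forall>x\<in>\<sigma>. 0 \<le> u \<bullet> x" "\<forall>x\<in>\<sigma>. 0 \<le> (- u) \<bullet> x" unfolding dual_cone_iff[OF assms] using * by auto
  then show "\<forall>x\<in>\<sigma>. u \<bullet> x = 0" by (force intro: antisym)
qed (auto simp: cone_rays_def)

text \<open>The first lattice points generate the rays, and the last \<open>t\<close> rows supply
  the complementary summand of \<open>N\<close>.\<close>

lemma span_q: "span (q ` {1..s+t}) = span N"
proof (rule span_eq[THEN iffD2], intro conjI)
  show "q ` {1..s+t} \<subseteq> span N" using q_in_N by (auto intro: span_base)
  have "\<Union>(rays \<Sigma>) \<subseteq> span (q ` {1..s+t})"
  proof clarify
    fix x \<rho> assume x: "x \<in> \<rho>" and "\<rho> \<in> rays \<Sigma>"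
    then have "\<rho> = convex_cone hull (q ` cone_rays s q \<rho>)" using cone_eq_hull by (simp add: rays_def)
    also have "\<dots> \<subseteq> span (q ` {1..s+t})"
    proof (rule hull_minimal)
      show "q ` cone_rays s q \<rho> \<subseteq> span (q ` {1..s+t})" using cone_rays_subset by (auto intro: span_base)
      show "convex_cone (span (q ` {1..s+t}))" by (auto simp: convex_cone_iff span_zero span_add span_scale)
    qed
    finally show "x \<in> span (q ` {1..s+t})" using x by blast
  qed
  then have "span (\<Union>(rays \<Sigma>)) \<subseteq> span (q ` {1..s+t})" by (simp add: span_minimal subspace_span)
  moreover have "int_span (q ` {s+1..s+t}) \<subseteq> span (q ` {1..s+t})"
    using int_span_subset_span by (rule order_trans) (intro span_mono image_mono, auto)
  ultimately show "N \<subseteq> span (q ` {1..s+t})" by (subst lattice_decomp) (auto intro!: span_add)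
qed

lemma dual_lattice_add: "u \<in> dual_lattice N \<Longrightarrow> u' \<in> dual_lattice N \<Longrightarrow> u + u' \<in> dual_lattice N"
  by (auto simp: dual_lattice_def span_add inner_add_left)

lemma dual_lattice_diff: "u \<in> dual_lattice N \<Longrightarrow> u' \<in> dual_lattice N \<Longrightarrow> u - u' \<in> dual_lattice N"
  by (auto simp: dual_lattice_def span_diff inner_diff_left)

lemma zero_dual_lattice: "0 \<in> dual_lattice N"
  by (simp add: dual_lattice_def span_zero)

lemma dual_lattice_scale: "u \<in> dual_lattice N \<Longrightarrow> real k *\<^sub>R u \<in> dual_lattice N"
  by (auto simp: dual_lattice_def span_scale)

lemma dual_lattice_q_int: "u \<in> dual_lattice N \<Longrightarrow> i \<in> {1..s+t} \<Longrightarrow> q i \<bullet> u \<in> \<int>"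
  using q_in_N by (auto simp: dual_lattice_def inner_commute)

lemma lookup_Qvec:
  assumes "u \<in> dual_lattice N"
  shows "real_of_int (lookup (Qvec (s+t) q u) i) = (if i \<in> {1..s+t} then q i \<bullet> u else 0)"
proof -
  have "lookup (Qvec (s+t) q u) i = (\<Sum>j\<in>{1..s+t}. if j = i then \<lfloor>q j \<bullet> u\<rfloor> else 0)"
    unfolding Qvec_def lookup_sum by (intro sum.cong) (auto simp: lookup_single when_def)
  then show ?thesis using dual_lattice_q_int[OF assms, of i] by (auto elim!: Ints_cases)
qed

lemma Qvec_add:
  assumes "u \<in> dual_lattice N" "u' \<in> dual_lattice N"
  shows "Qvec (s+t) q (u + u') = Qvec (s+t) q u + Qvec (s+t) q u'"
proof (rule poly_mapping_eqI)
  fix i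
  have "real_of_int (lookup (Qvec (s+t) q (u + u')) i) = real_of_int (lookup (Qvec (s+t) q u + Qvec (s+t) q u') i)"
    by (simp add: lookup_add lookup_Qvec assms dual_lattice_add inner_add_right)
  then show "lookup (Qvec (s+t) q (u + u')) i = lookup (Qvec (s+t) q u + Qvec (s+t) q u') i" by (simp only: of_int_eq_iff)
qed

lemma Qvec_zero: "Qvec (s+t) q 0 = 0"
  by (simp add: Qvec_def)

text \<open>The rows of \<open>Q\<close> span the space containing the dual lattice, so a difference
  annihilated by all rows is orthogonal to itself.\<close>

lemma inj_on_Qvec: "inj_on (Qvec (s+t) q) (dual_lattice N)"
proof (rule inj_onI)
  fix u u' assume u: "u \<in> dual_lattice N" "u' \<in> dual_lattice N" "Qvec (s+t) q u = Qvec (s+t) q u'"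
  have "q i \<bullet> (u - u') = 0" if "i \<in> {1..s+t}" for i
    using lookup_Qvec[OF u(1), of i] lookup_Qvec[OF u(2), of i] u(3) that by (simp add: inner_diff_right)
  then have "orthogonal (u - u') y" if "y \<in> q ` {1..s+t}" for y using that by (auto simp: orthogonal_def inner_commute)
  then have "orthogonal (u - u') y" if "y \<in> span (q ` {1..s+t})" for y
    using orthogonal_to_span[OF that] by blast
  moreover have "u - u' \<in> span (q ` {1..s+t})"
    unfolding span_q using u(1,2) by (auto simp: dual_lattice_def intro: span_diff)
  ultimately show "u = u'" by (metis orthogonal_self right_minus_eq)
qed

lemma dual_monoid_iff:
  assumes "\<sigma> \<in> \<Sigma>"
  shows "u \<in> dual_monoid N \<sigma> \<longleftrightarrow> u \<in> dual_lattice N \<and> (\<forall>i\<in>cone_rays s q \<sigma>. 0 \<le> u \<bullet> q i)"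
  by (simp add: dual_monoid_def dual_cone_iff[OF assms])

lemma cone_rays_mono: "\<tau> \<subseteq> \<sigma> \<Longrightarrow> cone_rays s q \<tau> \<subseteq> cone_rays s q \<sigma>"
  by (auto simp: cone_rays_def)

text \<open>Faces of a polyhedral cone are exposed, the exposing hyperplane passes through the
  common point 0, and \<open>dual_lattice_sign_vector\<close> makes its normal integral. The vector
  serves to pass from the chart of \<open>\<sigma>\<close> to that of \<open>\<tau>\<close>.\<close>

lemma exposing_dual_vector:
  assumes \<sigma>: "\<sigma> \<in> \<Sigma>" and \<tau>: "\<tau> \<in> \<Sigma>" "\<tau> face_of \<sigma>"
  obtains u0 where "u0 \<in> dual_monoid N \<sigma>" "\<And>i. i \<in> cone_rays s q \<tau> \<Longrightarrow> u0 \<bullet> q i = 0"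
    "\<And>i. i \<in> cone_rays s q \<sigma> - cone_rays s q \<tau> \<Longrightarrow> 0 < u0 \<bullet> q i"
proof -
  have fin: "finite (q ` cone_rays s q \<sigma>)" by (simp add: cone_rays_def)
  have zero: "0 \<in> \<rho>" if "\<rho> \<in> \<Sigma>" for \<rho> using cone_eq_hull[OF that] convex_cone_hull_contains_0 by blast
  have "polyhedron \<sigma>" using polyhedron_convex_cone_hull[OF fin] cone_eq_hull[OF \<sigma>] by simp
  then have "\<tau> exposed_face_of \<sigma>" using \<tau>(2) exposed_face_of_polyhedron by blast
  then obtain a b where ab: "\<sigma> \<subseteq> {x. a \<bullet> x \<le> b}" "\<tau> = \<sigma> \<inter> {x. a \<bullet> x = b}" unfolding exposed_face_of_def by blast
  have "b = 0" using zero[OF \<tau>(1)] ab(2) by simp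
  then have a: "\<And>x. x \<in> \<sigma> \<Longrightarrow> 0 \<le> (- a) \<bullet> x" "\<And>x. x \<in> \<sigma> \<Longrightarrow> x \<in> \<tau> \<longleftrightarrow> (- a) \<bullet> x = 0" using ab by auto
  have XN: "q ` cone_rays s q \<sigma> \<subseteq> N" using cone_rays_subset q_in_N by blast
  obtain u0 where u0: "u0 \<in> dual_lattice N"
    "\<And>x. x \<in> q ` cone_rays s q \<sigma> \<Longrightarrow> (- a) \<bullet> x = 0 \<Longrightarrow> u0 \<bullet> x = 0"
    "\<And>x. x \<in> q ` cone_rays s q \<sigma> \<Longrightarrow> 0 < (- a) \<bullet> x \<Longrightarrow> 0 < u0 \<bullet> x"
    using dual_lattice_sign_vector[OF lattice fin XN] by metis
  have sub: "cone_rays s q \<tau> \<subseteq> cone_rays s q \<sigma>" using face_of_imp_subset[OF \<tau>(2)] by (rule cone_rays_mono)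
  have in\<tau>: "u0 \<bullet> q i = 0" if "i \<in> cone_rays s q \<tau>" for i
    using that sub a(2)[of "q i"] by (intro u0(2)) (auto simp: cone_rays_def)
  have out\<tau>: "0 < u0 \<bullet> q i" if "i \<in> cone_rays s q \<sigma> - cone_rays s q \<tau>" for i
    using that a(1)[of "q i"] a(2)[of "q i"] by (intro u0(3)) (force simp: cone_rays_def)+
  show ?thesis
  proof (rule that)
    show "u0 \<in> dual_monoid N \<sigma>" unfolding dual_monoid_iff[OF \<sigma>]
      using u0(1) in\<tau> out\<tau> by (metis DiffI less_eq_real_def)
  qed (use in\<tau> out\<tau> in auto)
qed

end

section \<open>Cox coordinates\<close>

lemma trop_prod_TReal: "(\<Prod>i\<in>A. TReal (x i)) = TReal (\<Sum>i\<in>A. x i)"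
  by (induction A rule: infinite_finite_induct) (auto simp: one_trop_def)

lemma trop_prod_eq_TInf_iff:
  assumes "finite A" shows "(\<Prod>i\<in>A. x i) = TInf \<longleftrightarrow> (\<exists>i\<in>A. x i = TInf)"
proof -
  have "y * z = TInf \<longleftrightarrow> y = TInf \<or> z = TInf" for y z :: trop by (cases y; cases z) auto
  with assms show ?thesis by (induction A rule: finite_induct) (auto simp: one_trop_def)
qed

text \<open>Because \<open>0 \<cdot> \<infinity> = 0\<close>, additivity fails at infinity for
  exponents of opposite sign such as 1 and -1.\<close>

lemma trop_scale_add:
  assumes "x \<noteq> TInf \<or> (0 \<le> c \<and> 0 \<le> d)"
  shows "trop_scale (c + d) x = trop_scale c x * trop_scale d x"
  using assms by (cases x) (auto simp: algebra_simps)

definition monomial_value :: "nat \<Rightarrow> (nat \<Rightarrow> trop) \<Rightarrow> (nat \<Rightarrow>\<^sub>0 int) \<Rightarrow> trop" where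
  "monomial_value m w a = (\<Prod>i\<in>{1..m}. trop_scale (of_int (lookup a i)) (w i))"

lemma monomial_value_add:
  assumes "\<And>i. i \<in> {1..m} \<Longrightarrow> w i \<noteq> TInf \<or> (0 \<le> lookup a i \<and> 0 \<le> lookup b i)"
  shows "monomial_value m w (a + b) = monomial_value m w a * monomial_value m w b"
  unfolding monomial_value_def prod.distrib[symmetric] lookup_add of_int_add
  using assms by (intro prod.cong trop_scale_add) auto

lemma monomial_value_finite:
  assumes "\<And>i. i \<in> {1..m} \<Longrightarrow> w i \<noteq> TInf \<or> lookup a i = 0"
  shows "monomial_value m w a \<noteq> TInf"
proof -
  have "trop_scale (of_int (lookup a i)) (w i) \<noteq> TInf" if "i \<in> {1..m}" for i
    using assms[OF that] by (cases "w i") auto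
  then show ?thesis unfolding monomial_value_def by (auto simp: trop_prod_eq_TInf_iff)
qed

definition xhat_exp :: "nat \<Rightarrow> nat set \<Rightarrow> nat \<Rightarrow> (nat \<Rightarrow>\<^sub>0 int)" where
  "xhat_exp m J k = (\<Sum>i\<in>{1..m} - J. Poly_Mapping.single i (int k))"

lemma lookup_xhat_exp: "lookup (xhat_exp m J k) i = (if i \<in> {1..m} - J then int k else 0)"
proof -
  have "lookup (xhat_exp m J k) i = (\<Sum>j\<in>{1..m} - J. if j = i then int k else 0)"
    unfolding xhat_exp_def lookup_sum by (intro sum.cong) (auto simp: lookup_single when_def)
  then show ?thesis by simp
qed

lemma xhat_power: "xhat m J ^ k = Poly_Mapping.single (xhat_exp m J k) 1"
proof -
  have "(\<Prod>i\<in>A. Poly_Mapping.single (Poly_Mapping.single i 1) 1) =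
      Poly_Mapping.single (\<Sum>i\<in>A. Poly_Mapping.single i (1::int)) (1::trop)" for A :: "nat set"
    by (induction A rule: infinite_finite_induct) (auto simp: mult_single)
  then have 1: "xhat m J = Poly_Mapping.single (xhat_exp m J 1) 1" by (simp add: xhat_def xhat_exp_def)
  have step: "xhat_exp m J (Suc k) = xhat_exp m J 1 + xhat_exp m J k" for k
    by (rule poly_mapping_eqI) (simp add: lookup_xhat_exp lookup_add)
  have 0: "xhat_exp m J 0 = 0" by (rule poly_mapping_eqI) (simp add: lookup_xhat_exp)
  show ?thesis
  proof (induction k)
    case (Suc k)
    show ?case unfolding power_Suc Suc step by (subst 1) (simp add: mult_single)
  qed (simp add: 0)
qed

lemma keys_xhat_exp: "keys (xhat_exp m J k) \<subseteq> {1..m}"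
  by (auto simp: in_keys_iff lookup_xhat_exp split: if_splits)

lemma single_in_cox_semiring:
  "keys a \<subseteq> {1..m} \<Longrightarrow> (\<And>i. 0 \<le> lookup a i) \<Longrightarrow> Poly_Mapping.single a c \<in> cox_semiring m"
  by (auto simp: cox_semiring_def polys_on_def)

lemma xhat_power_in_cox_semiring: "xhat m J ^ k \<in> cox_semiring m"
  unfolding xhat_power using keys_xhat_exp by (intro single_in_cox_semiring) (auto simp: lookup_xhat_exp)

lemma ideal_generated_mult: "r \<in> A \<Longrightarrow> f \<in> G \<Longrightarrow> r * f \<in> ideal_generated A G"
  unfolding ideal_generated_def semiring_ideal_def by blast

lemma ideal_generated_incl: "f \<in> G \<Longrightarrow> f \<in> ideal_generated A G"
  unfolding ideal_generated_def by blast

text \<open>The elements that a power of \<open>xhat\<close> carries into \<open>I\<close> form an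
  ideal of the localization containing \<open>I\<close>.\<close>

lemma ideal_generated_localization:
  assumes I: "semiring_ideal (cox_semiring m) I" and f: "f \<in> ideal_generated (cox_localization m J) I"
  shows "\<exists>k. xhat m J ^ k * f \<in> I"
proof -
  let ?x = "xhat m J"
  let ?K = "{f. \<exists>k. ?x ^ k * f \<in> I}"
  have IS: "I \<subseteq> cox_semiring m" "I \<noteq> {}" "\<And>f g. f \<in> I \<Longrightarrow> g \<in> I \<Longrightarrow> f + g \<in> I"
    "\<And>r f. r \<in> cox_semiring m \<Longrightarrow> f \<in> I \<Longrightarrow> r * f \<in> I"
    using I unfolding semiring_ideal_def by blast+
  have "I \<subseteq> ?K" by (auto intro!: exI[of _ 0])
  moreover have "semiring_ideal (cox_localization m J) ?K"
    unfolding semiring_ideal_def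
  proof (intro conjI ballI)
    show "?K \<subseteq> cox_localization m J" using IS(1) by (auto simp: cox_localization_def)
    show "?K \<noteq> {}" using IS(2) \<open>I \<subseteq> ?K\<close> by blast
  next
    fix f g assume "f \<in> ?K" "g \<in> ?K"
    then obtain k l where "?x ^ k * f \<in> I" "?x ^ l * g \<in> I" by blast
    then have "?x ^ l * (?x ^ k * f) + ?x ^ k * (?x ^ l * g) \<in> I"
      using IS(3,4) xhat_power_in_cox_semiring by metis
    then show "f + g \<in> ?K" by (auto intro!: exI[of _ "k + l"] simp: power_add algebra_simps)
  next
    fix r f assume "r \<in> cox_localization m J" "f \<in> ?K"
    then obtain k l where "?x ^ k * r \<in> cox_semiring m" "?x ^ l * f \<in> I" by (auto simp: cox_localization_def)
    then have "(?x ^ k * r) * (?x ^ l * f) \<in> I" by (rule IS(4))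
    then show "r * f \<in> ?K" by (auto intro!: exI[of _ "k + l"] simp: power_add algebra_simps)
  qed
  ultimately show ?thesis using f unfolding ideal_generated_def by blast
qed

lemma lookup_terms_in: "lookup (terms_in D f) u = (if u \<in> D then lookup f u else 0)"
proof -
  have "lookup (terms_in D f) u = (\<Sum>a\<in>keys f \<inter> D. if a = u then lookup f u else 0)"
    unfolding terms_in_def lookup_sum by (intro sum.cong) (auto simp: lookup_single when_def)
  then show ?thesis by (auto simp: in_keys_iff)
qed

lemma keys_terms_in: "keys (terms_in D f) = keys f \<inter> D"
  by (auto simp: in_keys_iff lookup_terms_in split: if_splits)

section \<open>The exponents \<open>Q u\<close> and the quotient map\<close>

context cox_fan
begin

lemma lookup_cox_embed:
  assumes "keys g \<subseteq> dual_lattice N" "u \<in> dual_lattice N"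
  shows "lookup (cox_embed (s+t) q g) (Qvec (s+t) q u) = lookup g u"
proof -
  have "lookup (cox_embed (s+t) q g) (Qvec (s+t) q u) = (\<Sum>a\<in>keys g. if a = u then lookup g u else 0)"
    unfolding cox_embed_def lookup_sum using assms inj_onD[OF inj_on_Qvec]
    by (intro sum.cong) (force simp: lookup_single when_def)+
  then show ?thesis by (auto simp: in_keys_iff)
qed

lemma keys_cox_embed:
  assumes "keys g \<subseteq> dual_lattice N"
  shows "keys (cox_embed (s+t) q g) = Qvec (s+t) q ` keys g"
proof
  show "keys (cox_embed (s+t) q g) \<subseteq> Qvec (s+t) q ` keys g"
  proof (rule subsetI, rule ccontr)
    fix x assume x: "x \<in> keys (cox_embed (s+t) q g)" "x \<notin> Qvec (s+t) q ` keys g"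
    have "lookup (cox_embed (s+t) q g) x = 0"
      unfolding cox_embed_def lookup_sum using x(2) by (intro sum.neutral) (auto simp: lookup_single when_def)
    then show False using x(1) by (simp add: in_keys_iff)
  qed
  show "Qvec (s+t) q ` keys g \<subseteq> keys (cox_embed (s+t) q g)"
    using lookup_cox_embed[OF assms] assms by (auto simp: in_keys_iff)
qed

text \<open>
  In Cox coordinates, \<open>w\<close> represents the class of \<open>v\<close> in the stratum of \<open>\<tau>\<close>.  If \<open>\<tau>\<close> is not
  simplicial, then \<open>w i\<close> may be finite for some \<open>i \<in> \<tau>\<close>.
\<close>

definition represents :: "(nat \<Rightarrow> trop) \<Rightarrow> 'a set \<Rightarrow> 'a \<Rightarrow> bool" where
  "represents w \<tau> v \<longleftrightarrow> w \<in> trop_space (s+t) \<and> \<tau> \<in> \<Sigma> \<and>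
     (\<forall>i\<in>{1..s+t} - cone_rays s q \<tau>. w i \<noteq> TInf) \<and>
     (\<forall>u\<in>dual_monoid N \<tau>. monomial_value (s+t) w (Qvec (s+t) q u) = point_hom \<tau> v u)"

text \<open>At \<open>w\<close> the monomial \<open>xhat\<close> of \<open>\<tau>\<close> is finite,
  and a single term never attains its minimum twice.\<close>

lemma represents_not_irrelevant:
  assumes "represents w \<tau> v" shows "w \<notin> irrelevant_locus \<Sigma> s t q"
proof
  assume "w \<in> irrelevant_locus \<Sigma> s t q"
  moreover have \<tau>: "\<tau> \<in> \<Sigma>" using assms by (simp add: represents_def)
  then have "xhat (s+t) (cone_rays s q \<tau>) \<in> irrelevant_ideal \<Sigma> s t q"
    unfolding irrelevant_ideal_def by (intro ideal_generated_incl) blast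
  ultimately have "w \<in> affine_variety (s+t) (xhat (s+t) (cone_rays s q \<tau>))" by (auto simp: irrelevant_locus_def)
  moreover have x: "xhat (s+t) (cone_rays s q \<tau>) = Poly_Mapping.single (xhat_exp (s+t) (cone_rays s q \<tau>) 1) 1"
    using xhat_power[of _ _ 1] by simp
  moreover have "monomial_value (s+t) w (xhat_exp (s+t) (cone_rays s q \<tau>) 1) \<noteq> TInf"
    using assms by (intro monomial_value_finite) (auto simp: represents_def lookup_xhat_exp)
  ultimately show False by (simp add: affine_variety_def trop_term_def monomial_value_def min_twice_def x)
qed

text \<open>The quotient map is tested on the chart of some \<open>\<sigma>\<close> having
  \<open>\<tau>\<close> as a face. The finite value at an exposing vector \<open>u0\<close> forces
  finite coordinates on the rays of \<open>\<sigma>\<close> outside \<open>\<tau>\<close>. A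
  multiple of \<open>u0\<close> moves any \<open>u\<close> in the dual monoid of
  \<open>\<tau>\<close> into that of \<open>\<sigma>\<close>, and its finite value cancels.\<close>

lemma quotient_map_represents:
  assumes "(w, (\<tau>, X)) \<in> quotient_map N \<Sigma> s t q"
  shows "\<exists>v\<in>span N. X = coset \<tau> v \<and> represents w \<tau> v"
proof -
  obtain v \<sigma> where w: "w \<in> trop_space (s+t)" "\<tau> \<in> \<Sigma>" "v \<in> span N" "X = coset \<tau> v"
    and \<sigma>: "\<sigma> \<in> \<Sigma>" "\<tau> face_of \<sigma>" "\<And>i. i \<in> {1..s+t} - cone_rays s q \<sigma> \<Longrightarrow> w i < TInf"
    and hom: "\<And>u. u \<in> dual_monoid N \<sigma> \<Longrightarrow> point_hom \<tau> v u = monomial_value (s+t) w (Qvec (s+t) q u)"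
    using assms unfolding quotient_map_def monomial_value_def by blast
  obtain u0 where u0: "u0 \<in> dual_monoid N \<sigma>" "\<And>i. i \<in> cone_rays s q \<tau> \<Longrightarrow> u0 \<bullet> q i = 0"
    "\<And>i. i \<in> cone_rays s q \<sigma> - cone_rays s q \<tau> \<Longrightarrow> 0 < u0 \<bullet> q i"
    using exposing_dual_vector[OF \<sigma>(1) w(2) \<sigma>(2)] by metis
  have u0d: "u0 \<in> dual_lattice N" using u0(1) by (simp add: dual_monoid_def)
  have u0\<tau>: "\<forall>x\<in>\<tau>. u0 \<bullet> x = 0" unfolding orth_cone_iff[OF w(2)] using u0(2) by blast
  have fin: "w i \<noteq> TInf" if i: "i \<in> {1..s+t} - cone_rays s q \<tau>" for i
  proof (cases "i \<in> cone_rays s q \<sigma>")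
    case True
    have "monomial_value (s+t) w (Qvec (s+t) q u0) \<noteq> TInf"
      using hom[OF u0(1)] u0\<tau> by (simp add: point_hom_def flip: hom[OF u0(1)])
    then have "trop_scale (of_int (lookup (Qvec (s+t) q u0) i)) (w i) \<noteq> TInf"
      using i unfolding monomial_value_def by (simp add: trop_prod_eq_TInf_iff)
    moreover have "real_of_int (lookup (Qvec (s+t) q u0) i) \<noteq> 0"
      using u0(3)[of i] True i by (simp add: lookup_Qvec[OF u0d] inner_commute)
    ultimately show ?thesis by auto
  next
    case False
    then show ?thesis using \<sigma>(3)[of i] i by (auto simp: less_trop_def)
  qed
  have "monomial_value (s+t) w (Qvec (s+t) q u) = point_hom \<tau> v u" if u: "u \<in> dual_monoid N \<tau>" for u
  proof -
    have ud: "u \<in> dual_lattice N" "\<And>i. i \<in> cone_rays s q \<tau> \<Longrightarrow> 0 \<le> u \<bullet> q i"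
      using u unfolding dual_monoid_iff[OF w(2)] by auto
    \<comment> \<open>The multiple of \<open>u0\<close> needed to make up for negative values of
      \<open>u\<close> on the rays outside \<open>\<tau>\<close>. On the rays of
      \<open>\<tau>\<close> the quotient has denominator zero and is 0 by convention.\<close>
    obtain K where K: "\<And>i. i \<in> cone_rays s q \<sigma> \<Longrightarrow> - (u \<bullet> q i) / (u0 \<bullet> q i) \<le> K"
      using bdd_above_finite[of "(\<lambda>i. - (u \<bullet> q i) / (u0 \<bullet> q i)) ` cone_rays s q \<sigma>"]
      by (auto simp: cone_rays_def bdd_above_def)
    obtain k :: nat where k: "K \<le> real k" using real_arch_simple by blast
    define u1 where "u1 = real k *\<^sub>R u0"
    have u1d: "u1 \<in> dual_lattice N" using u0d by (simp add: u1_def dual_lattice_scale)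
    have u1: "u1 \<in> dual_monoid N \<sigma>" using u0(1) u1d unfolding dual_monoid_iff[OF \<sigma>(1)] by (simp add: u1_def)
    have u1\<tau>: "\<forall>x\<in>\<tau>. u1 \<bullet> x = 0" using u0\<tau> by (simp add: u1_def)
    have uu1: "u + u1 \<in> dual_monoid N \<sigma>"
      unfolding dual_monoid_iff[OF \<sigma>(1)]
    proof (intro conjI ballI)
      fix i assume i: "i \<in> cone_rays s q \<sigma>"
      show "0 \<le> (u + u1) \<bullet> q i"
      proof (cases "i \<in> cone_rays s q \<tau>")
        case True
        then show ?thesis using ud(2) u0(2) by (simp add: u1_def inner_add_left)
      next
        case False
        then have "0 < u0 \<bullet> q i" using u0(3) i by simp
        moreover have "- (u \<bullet> q i) / (u0 \<bullet> q i) \<le> real k" using K[OF i] k by linarith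
        ultimately show ?thesis by (simp add: u1_def inner_add_left field_simps)
      qed
    qed (use ud u1d dual_lattice_add in auto)
    have "monomial_value (s+t) w (Qvec (s+t) q (u + u1)) =
        monomial_value (s+t) w (Qvec (s+t) q u) * monomial_value (s+t) w (Qvec (s+t) q u1)"
      unfolding Qvec_add[OF ud(1) u1d]
    proof (rule monomial_value_add)
      fix i assume i: "i \<in> {1..s+t}"
      show "w i \<noteq> TInf \<or> 0 \<le> lookup (Qvec (s+t) q u) i \<and> 0 \<le> lookup (Qvec (s+t) q u1) i"
      proof (cases "i \<in> cone_rays s q \<tau>")
        case True
        have "0 \<le> real_of_int (lookup (Qvec (s+t) q u) i)" "0 \<le> real_of_int (lookup (Qvec (s+t) q u1) i)"
          unfolding lookup_Qvec[OF ud(1)] lookup_Qvec[OF u1d] using i ud(2)[OF True] u0(2)[OF True]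
          by (simp_all add: inner_commute u1_def)
        then show ?thesis by simp
      qed (use fin i in auto)
    qed
    moreover have "monomial_value (s+t) w (Qvec (s+t) q u1) = TReal (u1 \<bullet> v)"
      using hom[OF u1] u1\<tau> by (simp add: point_hom_def)
    moreover have "monomial_value (s+t) w (Qvec (s+t) q (u + u1)) = point_hom \<tau> v u * TReal (u1 \<bullet> v)"
      by (subst hom[OF uu1, symmetric]) (use u1\<tau> in \<open>auto simp: point_hom_def inner_add_left\<close>)
    moreover have "x = y" if "x * TReal c = y * TReal c" for x y c using that by (cases x; cases y) auto
    ultimately show ?thesis by metis
  qed
  then have "represents w \<tau> v" using w fin by (auto simp: represents_def)
  then show ?thesis using w by blast
qed

text \<open>The finite coordinates expand \<open>v\<close> in the rows of \<open>Q\<close>. Among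
  all representatives this one is infinite on every ray of \<open>\<tau>\<close>, so that every
  monomial of a polynomial involving such a ray becomes infinite.\<close>

lemma quotient_map_surj:
  assumes \<tau>: "\<tau> \<in> \<Sigma>" and v: "v \<in> span N"
  shows "\<exists>w. (w, (\<tau>, coset \<tau> v)) \<in> quotient_map N \<Sigma> s t q \<and> represents w \<tau> v \<and>
    (\<forall>i\<in>cone_rays s q \<tau>. w i = TInf)"
proof -
  have "v \<in> {\<Sum>i\<in>{1..s+t}. c i *\<^sub>R q i | c. True}"
  proof -
    let ?S = "{\<Sum>i\<in>{1..s+t}. c i *\<^sub>R q i | c. True}"
    have "subspace ?S"
      unfolding subspace_def
    proof (intro conjI ballI allI)
      show "0 \<in> ?S" by (auto intro!: exI[of _ "\<lambda>_. 0"])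
    next
      fix x y assume "x \<in> ?S" "y \<in> ?S"
      then obtain c d where "x = (\<Sum>i\<in>{1..s+t}. c i *\<^sub>R q i)" "y = (\<Sum>i\<in>{1..s+t}. d i *\<^sub>R q i)" by blast
      then show "x + y \<in> ?S" by (auto intro!: exI[of _ "\<lambda>i. c i + d i"] simp: scaleR_add_left sum.distrib)
    next
      fix x and r :: real assume "x \<in> ?S"
      then obtain c where "x = (\<Sum>i\<in>{1..s+t}. c i *\<^sub>R q i)" by blast
      then show "r *\<^sub>R x \<in> ?S" by (auto intro!: exI[of _ "\<lambda>i. r * c i"] simp: scaleR_sum_right)
    qed
    moreover have "q j \<in> ?S" if j: "j \<in> {1..s+t}" for j
    proof -
      have "(\<Sum>i\<in>{1..s+t}. (if i = j then 1 else 0) *\<^sub>R q i) = (\<Sum>i\<in>{1..s+t}. if i = j then q i else 0)"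
        by (intro sum.cong) auto
      then have "q j = (\<Sum>i\<in>{1..s+t}. (if i = j then 1 else 0) *\<^sub>R q i)" using j by simp
      then show ?thesis by (intro CollectI exI[of _ "\<lambda>i. if i = j then 1 else 0"]) simp
    qed
    ultimately have "span (q ` {1..s+t}) \<subseteq> ?S" by (intro span_minimal) auto
    then show ?thesis using v span_q by auto
  qed
  then obtain c where c: "v = (\<Sum>i\<in>{1..s+t}. c i *\<^sub>R q i)" by blast
  define w where "w = restrict (\<lambda>i. if i \<in> cone_rays s q \<tau> then TInf else TReal (c i)) {1..s+t}"
  have wi: "w i = (if i \<in> cone_rays s q \<tau> then TInf else TReal (c i))" if "i \<in> {1..s+t}" for i
    using that by (simp add: w_def)
  have hom: "monomial_value (s+t) w (Qvec (s+t) q u) = point_hom \<tau> v u" if u: "u \<in> dual_monoid N \<tau>" for u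
  proof -
    have ud: "u \<in> dual_lattice N" using u by (simp add: dual_monoid_def)
    have mv: "monomial_value (s+t) w (Qvec (s+t) q u) = (\<Prod>i\<in>{1..s+t}. trop_scale (q i \<bullet> u) (w i))"
      unfolding monomial_value_def by (intro prod.cong) (auto simp: lookup_Qvec[OF ud])
    show ?thesis
    proof (cases "\<forall>x\<in>\<tau>. u \<bullet> x = 0")
      case True
      then have q0: "\<forall>i\<in>cone_rays s q \<tau>. u \<bullet> q i = 0" using orth_cone_iff[OF \<tau>] by blast
      have "(\<Prod>i\<in>{1..s+t}. trop_scale (q i \<bullet> u) (w i)) = (\<Prod>i\<in>{1..s+t}. TReal ((q i \<bullet> u) * c i))"
        using q0 by (intro prod.cong) (auto simp: wi inner_commute)
      also have "\<dots> = TReal (u \<bullet> v)"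
        unfolding trop_prod_TReal c inner_sum_right by (simp add: inner_commute mult.commute)
      finally show ?thesis using True by (simp add: mv point_hom_def)
    next
      case False
      then obtain i where i: "i \<in> cone_rays s q \<tau>" "u \<bullet> q i \<noteq> 0" using orth_cone_iff[OF \<tau>] by blast
      then have "i \<in> {1..s+t}" using cone_rays_subset by blast
      then have "(\<Prod>i\<in>{1..s+t}. trop_scale (q i \<bullet> u) (w i)) = TInf"
        using i wi[of i] by (subst trop_prod_eq_TInf_iff) (auto intro!: bexI[of _ i] simp: inner_commute)
      then show ?thesis using False by (simp add: mv point_hom_def)
    qed
  qed
  have wt: "w \<in> trop_space (s+t)" by (simp add: w_def trop_space_def)
  have fin': "\<forall>i\<in>{1..s+t} - cone_rays s q \<tau>. w i \<noteq> TInf" using wi by auto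
  then have fin: "\<forall>i\<in>{1..s+t} - cone_rays s q \<tau>. w i < TInf" by (simp add: order.not_eq_order_implies_strict)
  have "convex \<tau>" by (subst cone_eq_hull[OF \<tau>]) (rule convex_convex_cone_hull)
  then have face: "\<tau> face_of \<tau>" by (rule face_of_refl)
  have "(w, (\<tau>, coset \<tau> v)) \<in> quotient_map N \<Sigma> s t q"
    unfolding quotient_map_def using wt \<tau> v face fin hom unfolding monomial_value_def
    by (intro CollectI exI[of _ w] exI[of _ \<tau>] exI[of _ v] conjI refl bexI[of _ \<tau>]) auto
  moreover have "represents w \<tau> v" using wt \<tau> fin' hom unfolding represents_def by blast
  moreover have "\<forall>i\<in>cone_rays s q \<tau>. w i = TInf" using wi cone_rays_subset[of \<tau>] by (meson subsetD)
  ultimately show ?thesis by blast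
qed

end

section \<open>Strata\<close>

context cox_fan
begin

abbreviation boundary_free :: "'a set \<Rightarrow> 'a set" where
  "boundary_free \<tau> \<equiv> {u. \<not> (\<exists>i\<in>cone_rays s q \<tau>. 0 < lookup (Qvec (s+t) q u) i)}"

lemma boundary_free_iff:
  assumes "\<tau> \<in> \<Sigma>" "u \<in> dual_monoid N \<tau>"
  shows "u \<in> boundary_free \<tau> \<longleftrightarrow> (\<forall>x\<in>\<tau>. u \<bullet> x = 0)"
proof -
  have u: "u \<in> dual_lattice N" "\<And>i. i \<in> cone_rays s q \<tau> \<Longrightarrow> 0 \<le> u \<bullet> q i"
    using assms unfolding dual_monoid_iff[OF assms(1)] by auto
  have "0 < lookup (Qvec (s+t) q u) i \<longleftrightarrow> u \<bullet> q i \<noteq> 0" if "i \<in> cone_rays s q \<tau>" for i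
  proof -
    have "real_of_int (lookup (Qvec (s+t) q u) i) = u \<bullet> q i"
      using lookup_Qvec[OF u(1), of i] that cone_rays_subset[of \<tau>] by (auto simp: inner_commute)
    then show ?thesis using u(2)[OF that] by linarith
  qed
  then show ?thesis unfolding orth_cone_iff[OF assms(1)] by blast
qed

lemma coset_inner_eq:
  assumes "coset \<tau> v = coset \<tau> v'" "\<forall>x\<in>\<tau>. u \<bullet> x = 0"
  shows "u \<bullet> v = u \<bullet> v'"
proof -
  have "v \<in> coset \<tau> v" by (auto simp: coset_def intro!: exI[of _ 0] span_zero)
  then have "v \<in> coset \<tau> v'" using assms(1) by simp
  then obtain x where x: "v = v' + x" "x \<in> span \<tau>" by (auto simp: coset_def)
  have "orthogonal u x" using x(2) assms(2) by (intro orthogonal_to_span[of x \<tau>]) (auto simp: orthogonal_def)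
  then show ?thesis by (simp add: x(1) inner_add_right orthogonal_def)
qed

text \<open>At \<open>w\<close> the terms outside the orthogonal space of \<open>\<tau>\<close> are
  infinite, and the others are those of \<open>h\<close> at \<open>v\<close> shifted by the finite
  value of the monomial \<open>a0\<close>. The case \<open>h = 0\<close> is an infinite value of the
  polynomial.\<close>

lemma affine_variety_shift_iff:
  assumes rep: "represents w \<tau> v" and g: "keys g \<subseteq> dual_monoid N \<tau>"
    and a0: "\<And>i. i \<in> cone_rays s q \<tau> \<Longrightarrow> lookup a0 i = 0"
  defines "h \<equiv> terms_in (boundary_free \<tau>) g"
  shows "w \<in> affine_variety (s+t) (Poly_Mapping.single a0 1 * cox_embed (s+t) q g) \<longleftrightarrow>
    h = 0 \<or> min_twice (keys h) (\<lambda>u. lookup h u * TReal (u \<bullet> v))"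
proof -
  have \<tau>: "\<tau> \<in> \<Sigma>" and wsp: "w \<in> trop_space (s+t)"
    and fin: "\<And>i. i \<in> {1..s+t} - cone_rays s q \<tau> \<Longrightarrow> w i \<noteq> TInf"
    and hom: "\<And>u. u \<in> dual_monoid N \<tau> \<Longrightarrow> monomial_value (s+t) w (Qvec (s+t) q u) = point_hom \<tau> v u"
    using rep unfolding represents_def by blast+
  define f where "f = Poly_Mapping.single a0 1 * cox_embed (s+t) q g"
  define A where "A u = a0 + Qvec (s+t) q u" for u
  have gd: "keys g \<subseteq> dual_lattice N" using g by (auto simp: dual_monoid_def)
  have inj: "inj_on A (keys g)" using inj_on_subset[OF inj_on_Qvec gd] by (auto simp: A_def inj_on_def)
  have keys_f: "keys f = A ` keys g"
    unfolding f_def A_def using keys_single_mult[of "1::trop" a0 "cox_embed (s+t) q g"] keys_cox_embed[OF gd] by (simp add: image_image)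
  have lookup_f: "lookup f (A u) = lookup g u" if "u \<in> keys g" for u
    using that gd by (simp add: f_def A_def lookup_single_mult lookup_cox_embed subset_iff)
  have "monomial_value (s+t) w a0 \<noteq> TInf" using fin a0 by (intro monomial_value_finite) blast
  then obtain c0 where c0: "monomial_value (s+t) w a0 = TReal c0" by (cases "monomial_value (s+t) w a0") auto
  define T where "T u = trop_term (s+t) f w (A u)" for u
  have T: "T u = lookup g u * (TReal c0 * point_hom \<tau> v u)" if u: "u \<in> keys g" for u
  proof -
    have um: "u \<in> dual_monoid N \<tau>" "u \<in> dual_lattice N" using u g gd by auto
    have "monomial_value (s+t) w (A u) = monomial_value (s+t) w a0 * monomial_value (s+t) w (Qvec (s+t) q u)"
      unfolding A_def
    proof (rule monomial_value_add)
      fix i assume i: "i \<in> {1..s+t}"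
      show "w i \<noteq> TInf \<or> 0 \<le> lookup a0 i \<and> 0 \<le> lookup (Qvec (s+t) q u) i"
      proof (cases "i \<in> cone_rays s q \<tau>")
        case True
        have "0 \<le> u \<bullet> q i" using um(1) True unfolding dual_monoid_iff[OF \<tau>] by blast
        then have "0 \<le> real_of_int (lookup (Qvec (s+t) q u) i)"
          unfolding lookup_Qvec[OF um(2)] using i by (simp add: inner_commute)
        then show ?thesis using a0[OF True] by simp
      qed (use fin i in auto)
    qed
    then show ?thesis unfolding T_def trop_term_def monomial_value_def[symmetric]
      using lookup_f[OF u] hom[OF um(1)] c0 by simp
  qed
  have keys_h: "keys h = {u\<in>keys g. \<forall>x\<in>\<tau>. u \<bullet> x = 0}"
    unfolding h_def keys_terms_in using g boundary_free_iff[OF \<tau>] by auto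
  have lookup_h: "lookup h u = lookup g u" if "u \<in> keys h" for u
    using that unfolding h_def keys_terms_in by (simp add: lookup_terms_in)
  define W where "W u = lookup h u * TReal (u \<bullet> v)" for u
  have T_out: "T u = TInf" if "u \<in> keys g" "u \<notin> keys h" for u
  proof -
    have "point_hom \<tau> v u = TInf" using that keys_h by (auto simp: point_hom_def)
    moreover have "x * TInf = TInf" for x by (cases x) auto
    ultimately show ?thesis using T[OF that(1)] by simp
  qed
  have T_in: "T u = TReal c0 * W u \<and> T u \<noteq> TInf" if "u \<in> keys h" for u
  proof -
    have "u \<in> keys g" "point_hom \<tau> v u = TReal (u \<bullet> v)" using that keys_h by (auto simp: point_hom_def)
    then show ?thesis using T[of u] lookup_h[OF that] unfolding W_def
      by (cases "lookup g u") (auto simp: in_keys_iff zero_trop_def)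
  qed
  have le: "TReal c0 * x \<le> TReal c0 * y \<longleftrightarrow> x \<le> y" for x y by (cases x; cases y) auto
  have aff: "w \<in> affine_variety (s+t) f \<longleftrightarrow> (\<forall>u\<in>keys g. T u = TInf) \<or>
     (\<exists>a\<in>keys g. \<exists>b\<in>keys g. a \<noteq> b \<and> (\<forall>c\<in>keys g. T a \<le> T c \<and> T b \<le> T c))"
  proof -
    have "(\<exists>a\<in>keys f. \<exists>b\<in>keys f. a \<noteq> b \<and> (\<forall>c\<in>keys f. trop_term (s+t) f w a \<le> trop_term (s+t) f w c \<and>
        trop_term (s+t) f w b \<le> trop_term (s+t) f w c)) \<longleftrightarrow>
      (\<exists>a\<in>keys g. \<exists>b\<in>keys g. a \<noteq> b \<and> (\<forall>c\<in>keys g. T a \<le> T c \<and> T b \<le> T c))"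
      unfolding keys_f T_def bex_simps ball_simps using inj_on_eq_iff[OF inj] by metis
    then show ?thesis unfolding affine_variety_def
      using wsp by (simp add: trop_sum_eq_TInf_iff min_twice_iff) (simp add: keys_f T_def)
  qed
  have mt: "min_twice (keys h) W \<longleftrightarrow> (\<exists>a\<in>keys h. \<exists>b\<in>keys h. a \<noteq> b \<and> (\<forall>c\<in>keys h. T a \<le> T c \<and> T b \<le> T c))"
    unfolding min_twice_iff[OF finite_keys] using T_in le by (metis (no_types, lifting))
  have sub: "keys h \<subseteq> keys g" using keys_h by blast
  have "w \<in> affine_variety (s+t) f \<longleftrightarrow> h = 0 \<or> min_twice (keys h) W"
  proof (cases "h = 0")
    case True
    then show ?thesis using aff T_out by simp
  next
    case False
    then obtain u where u: "u \<in> keys h" by fastforce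
    have not_inf: "\<not> (\<forall>u\<in>keys g. T u = TInf)" using u sub T_in by blast
    \<comment> \<open>A finite term exists in \<open>h\<close>, so an infinite term cannot be
      minimal.\<close>
    have in_h: "a \<in> keys h" if "a \<in> keys g" "\<forall>c\<in>keys g. T a \<le> T c" for a
    proof (rule ccontr)
      assume "a \<notin> keys h"
      then have "T a = TInf" using T_out that(1) by blast
      moreover have "T a \<le> T u" using that(2) u sub by blast
      moreover have "T u \<noteq> TInf" using T_in[OF u] by blast
      ultimately show False by (cases "T u") auto
    qed
    have ext: "T a \<le> T c" if "\<forall>c\<in>keys h. T a \<le> T c" "c \<in> keys g" for a c
      using that T_out[of c] by (cases "c \<in> keys h") auto
    have "a \<in> keys g \<and> (\<forall>c\<in>keys g. T a \<le> T c) \<longleftrightarrow> a \<in> keys h \<and> (\<forall>c\<in>keys h. T a \<le> T c)" for a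
      using in_h ext sub by blast
    then show ?thesis unfolding aff mt ball_conj_distrib using not_inf False by blast
  qed
  then show ?thesis unfolding f_def W_def .
qed

section \<open>Ideals of strata and homogenization\<close>

definition orth_lattice :: "'a set \<Rightarrow> 'a set" where
  "orth_lattice \<tau> = {u\<in>dual_lattice N. \<forall>x\<in>\<tau>. u \<bullet> x = 0}"

lemma orth_lattice_subset: "orth_lattice \<tau> \<subseteq> dual_monoid N \<tau>"
  by (auto simp: orth_lattice_def dual_monoid_def)

lemma local_ideal_keys: "g \<in> local_ideal N s t q I \<tau> \<Longrightarrow> keys g \<subseteq> dual_monoid N \<tau>"
  by (simp add: local_ideal_def polys_on_def)

text \<open>Elimination is carried out before deleting terms, since deletion only discards
  coefficients outside a fixed set of exponents. Monomials orthogonal to \<open>\<tau>\<close>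
  preserve this set, and a finite generating set of \<open>N\<close> supplies the separating
  functionals.\<close>

lemma stratum_laurent_tropical_ideal:
  assumes \<tau>: "\<tau> \<in> \<Sigma>" and I: "locally_tropical N \<Sigma> s t q I"
  shows "\<exists>B. laurent_tropical_ideal (orth_lattice \<tau>) B (stratum_ideal N s t q I \<tau>)"
proof -
  obtain B where B: "finite B" "N = int_span B" using lattice unfolding is_lattice_def by blast
  have BN: "B \<subseteq> N" using B base_in_int_span by blast
  let ?J = "local_ideal N s t q I \<tau>" and ?D = "boundary_free \<tau>"
  have trop: "tropical_ideal (dual_monoid N \<tau>) ?J" using I \<tau> by (simp add: locally_tropical_def)
  have "laurent_tropical_ideal (orth_lattice \<tau>) B (terms_in ?D ` ?J)"
  proof
    show "0 \<in> orth_lattice \<tau>" by (simp add: orth_lattice_def zero_dual_lattice)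
    show "a + b \<in> orth_lattice \<tau>" "a - b \<in> orth_lattice \<tau>" if "a \<in> orth_lattice \<tau>" "b \<in> orth_lattice \<tau>" for a b
      using that by (auto simp: orth_lattice_def dual_lattice_add dual_lattice_diff inner_add_left inner_diff_left)
    show "finite B" by fact
    show "a \<bullet> b \<in> \<int>" if "a \<in> orth_lattice \<tau>" "b \<in> B" for a b
      using that BN by (auto simp: orth_lattice_def dual_lattice_def)
    show "a = 0" if a: "a \<in> orth_lattice \<tau>" "\<And>b. b \<in> B \<Longrightarrow> a \<bullet> b = 0" for a
    proof -
      have "a \<in> span N" using a(1) by (simp add: orth_lattice_def dual_lattice_def)
      moreover have "span N \<subseteq> span B" unfolding B(2) using int_span_subset_span by (intro span_minimal) auto
      ultimately have "orthogonal a a" using a(2) by (intro orthogonal_to_span[of a B]) (auto simp: orthogonal_def)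
      then show ?thesis by (simp add: orthogonal_self)
    qed
    show "keys f \<subseteq> orth_lattice \<tau>" if f: "f \<in> terms_in ?D ` ?J" for f
    proof -
      obtain g where "f = terms_in ?D g" "g \<in> ?J" using f by blast
      then have "u \<in> dual_monoid N \<tau> \<and> u \<in> ?D" if "u \<in> keys f" for u
        using local_ideal_keys[of g] that by (auto simp only: keys_terms_in)
      then have "u \<in> dual_lattice N \<and> (\<forall>x\<in>\<tau>. u \<bullet> x = 0)" if "u \<in> keys f" for u
        using boundary_free_iff[OF \<tau>, of u] that by (simp add: dual_monoid_def)
      then show ?thesis by (auto simp: orth_lattice_def)
    qed
  next
    fix f a c assume f: "f \<in> terms_in ?D ` ?J" and a: "a \<in> orth_lattice \<tau>"
    then obtain g where g: "f = terms_in ?D g" "g \<in> ?J" by blast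
    have "Poly_Mapping.single a (TReal c) \<in> polys_on (dual_monoid N \<tau>)"
      using a orth_lattice_subset by (auto simp: polys_on_def)
    then have mem: "Poly_Mapping.single a (TReal c) * g \<in> ?J"
      using trop g(2) unfolding tropical_ideal_def semiring_ideal_def by blast
    have "Poly_Mapping.single a (TReal c) * f = terms_in ?D (Poly_Mapping.single a (TReal c) * g)"
    proof (rule poly_mapping_eqI)
      fix x
      show "lookup (Poly_Mapping.single a (TReal c) * f) x = lookup (terms_in ?D (Poly_Mapping.single a (TReal c) * g)) x"
      proof (cases "x - a \<in> keys g")
        case True
        then have xa: "x - a \<in> dual_monoid N \<tau>" using local_ideal_keys[OF g(2)] by blast
        then have "x \<in> dual_lattice N"
          using a dual_lattice_add[of "x - a" a] by (simp add: dual_monoid_def orth_lattice_def)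
        then have x: "x \<in> dual_monoid N \<tau>" using xa a by (simp add: dual_monoid_def orth_lattice_def inner_diff_left)
        have "x - a \<in> ?D \<longleftrightarrow> x \<in> ?D"
          unfolding boundary_free_iff[OF \<tau> xa] boundary_free_iff[OF \<tau> x]
          using a by (simp add: orth_lattice_def inner_diff_left)
        then show ?thesis by (simp only: g(1) lookup_single_mult lookup_terms_in) simp
      next
        case False
        then show ?thesis by (simp add: g(1) lookup_single_mult lookup_terms_in in_keys_iff)
      qed
    qed
    then show "Poly_Mapping.single a (TReal c) * f \<in> terms_in ?D ` ?J" using mem by blast
  next
    fix f g e assume f: "f \<in> terms_in ?D ` ?J" and g: "g \<in> terms_in ?D ` ?J"
      and e: "e \<in> keys f" "lookup f e = lookup g e"
    obtain F G where F: "f = terms_in ?D F" "F \<in> ?J" and G: "g = terms_in ?D G" "G \<in> ?J" using f g by blast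
    \<comment> \<open>The supports of the chosen lifts form the finite set required by the
      definition; outside it all three polynomials have coefficient infinity.\<close>
    define E where "E = keys F \<union> keys G"
    have E: "finite E" "E \<subseteq> dual_monoid N \<tau>" unfolding E_def using F G local_ideal_keys by auto
    have FE: "F \<in> ?J \<inter> polys_on E" "G \<in> ?J \<inter> polys_on E" using F G by (auto simp: polys_on_def E_def)
    have eD: "e \<in> ?D" "e \<in> keys F" using e(1) by (auto simp only: F(1) keys_terms_in)
    have eE: "e \<in> E" using eD(2) by (simp add: E_def)
    have eq: "lookup F e = lookup G e \<and> lookup F e \<noteq> TInf"
      using e(2) eD by (auto simp only: F(1) G(1) lookup_terms_in in_keys_iff zero_trop_def if_True)
    from trop have "\<forall>f \<in> ?J \<inter> polys_on E. \<forall>g \<in> ?J \<inter> polys_on E. \<forall>e\<in>E.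
           lookup f e = lookup g e \<and> lookup f e \<noteq> TInf \<longrightarrow>
           (\<exists>h \<in> ?J \<inter> polys_on E. lookup h e = TInf \<and>
              (\<forall>e'\<in>E. min (lookup f e') (lookup g e') \<le> lookup h e' \<and>
                 (lookup f e' \<noteq> lookup g e' \<longrightarrow>
                    lookup h e' = min (lookup f e') (lookup g e'))))"
      using E unfolding tropical_ideal_def by blast
    from this[rule_format, OF FE eE] eq obtain H where H: "H \<in> ?J \<inter> polys_on E" "lookup H e = TInf"
      "\<And>x. x \<in> E \<Longrightarrow> min (lookup F x) (lookup G x) \<le> lookup H x \<and>
        (lookup F x \<noteq> lookup G x \<longrightarrow> lookup H x = min (lookup F x) (lookup G x))" by blast
    have all: "min (lookup F x) (lookup G x) \<le> lookup H x \<and>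
        (lookup F x \<noteq> lookup G x \<longrightarrow> lookup H x = min (lookup F x) (lookup G x))" for x
    proof (cases "x \<in> E")
      case False
      then have "lookup F x = TInf" "lookup G x = TInf" "lookup H x = TInf"
        using H(1) by (auto simp: E_def polys_on_def in_keys_iff zero_trop_def)
      then show ?thesis by simp
    qed (use H in blast)
    show "\<exists>h\<in>terms_in ?D ` ?J. lookup h e = TInf \<and> (\<forall>x. min (lookup f x) (lookup g x) \<le> lookup h x \<and>
        (lookup f x \<noteq> lookup g x \<longrightarrow> lookup h x = min (lookup f x) (lookup g x)))"
    proof (intro bexI[of _ "terms_in ?D H"] conjI allI)
      show "lookup (terms_in ?D H) e = TInf" using H(2) by (simp add: lookup_terms_in zero_trop_def)
      show "terms_in ?D H \<in> terms_in ?D ` ?J" using H(1) by blast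
    next
      fix x
      define P where "P \<longleftrightarrow> x \<in> ?D"
      show "min (lookup f x) (lookup g x) \<le> lookup (terms_in ?D H) x"
        using all[of x] unfolding F(1) G(1) lookup_terms_in P_def[symmetric]
        by (cases P) (simp_all add: zero_trop_def)
      show "lookup f x \<noteq> lookup g x \<longrightarrow> lookup (terms_in ?D H) x = min (lookup f x) (lookup g x)"
        using all[of x] unfolding F(1) G(1) lookup_terms_in P_def[symmetric]
        by (cases P) (simp_all add: zero_trop_def)
    qed
  qed
  then show ?thesis unfolding stratum_ideal_def by blast
qed

text \<open>By homogeneity the exponents of \<open>f\<close> differ from \<open>a0\<close> by
  vectors \<open>Q u\<close>. As \<open>a0\<close> involves no ray of \<open>\<tau>\<close>, its
  monomial is invertible in the localization, and dividing by it keeps exponents nonnegative on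
  these rays.\<close>

lemma homogeneous_dehomogenize:
  assumes \<tau>: "\<tau> \<in> \<Sigma>" and I: "semiring_ideal (cox_semiring (s+t)) I"
    and f: "f \<in> I" "homogeneous N (s+t) q f"
    and a0: "a0 \<in> keys f" "\<And>i. i \<in> cone_rays s q \<tau> \<Longrightarrow> lookup a0 i = 0"
  obtains g where "g \<in> local_ideal N s t q I \<tau>" "f = Poly_Mapping.single a0 1 * cox_embed (s+t) q g"
proof -
  let ?Q = "Qvec (s+t) q"
  have "f \<in> cox_semiring (s+t)" using I f(1) unfolding semiring_ideal_def by blast
  then have "keys f \<subseteq> {a. keys a \<subseteq> {1..s+t} \<and> (\<forall>i. 0 \<le> lookup a i)}"
    by (simp only: cox_semiring_def polys_on_def mem_Collect_eq)
  then have fS: "keys a \<subseteq> {1..s+t}" "0 \<le> lookup a i" if "a \<in> keys f" for a i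
    using that by blast+
  have fin: "finite {u \<in> dual_lattice N. a0 + ?Q u \<in> keys f}"
  proof (rule finite_imageD)
    show "finite ((\<lambda>u. a0 + ?Q u) ` {u \<in> dual_lattice N. a0 + ?Q u \<in> keys f})"
      by (rule finite_subset[OF _ finite_keys[of f]]) auto
    show "inj_on (\<lambda>u. a0 + ?Q u) {u \<in> dual_lattice N. a0 + ?Q u \<in> keys f}"
      using inj_on_Qvec by (auto simp: inj_on_def)
  qed
  define c where "c u = (if u \<in> dual_lattice N then lookup f (a0 + ?Q u) else 0)" for u
  define g where "g = Abs_poly_mapping c"
  have "{u. c u \<noteq> 0} = {u \<in> dual_lattice N. a0 + ?Q u \<in> keys f}" by (auto simp: c_def in_keys_iff)
  then have "finite {u. c u \<noteq> 0}" using fin by simp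
  then have lg: "lookup g u = (if u \<in> dual_lattice N then lookup f (a0 + ?Q u) else 0)" for u
    by (simp add: g_def c_def)
  have kg: "keys g = {u \<in> dual_lattice N. a0 + ?Q u \<in> keys f}" by (auto simp: in_keys_iff lg split: if_splits)
  then have gd: "keys g \<subseteq> dual_lattice N" by blast
  have gP: "keys g \<subseteq> dual_monoid N \<tau>"
  proof
    fix u assume u: "u \<in> keys g"
    have "0 \<le> u \<bullet> q i" if i: "i \<in> cone_rays s q \<tau>" for i
    proof -
      have "0 \<le> lookup (a0 + ?Q u) i" using u kg fS(2) by blast
      then have "0 \<le> real_of_int (lookup (?Q u) i)" using a0(2)[OF i] by (simp add: lookup_add)
      then show ?thesis using u gd i cone_rays_subset[of \<tau>] by (subst (asm) lookup_Qvec) (auto simp: inner_commute)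
    qed
    then show "u \<in> dual_monoid N \<tau>" unfolding dual_monoid_iff[OF \<tau>] using u gd by blast
  qed
  have shift: "\<exists>u\<in>dual_lattice N. x = a0 + ?Q u" if x: "x \<in> keys f" for x
  proof -
    have "cox_degree N (s+t) q x = cox_degree N (s+t) q a0" using f(2) x a0(1) by (auto simp: homogeneous_def)
    moreover have "x \<in> cox_degree N (s+t) q x"
      using zero_dual_lattice Qvec_zero by (auto simp: cox_degree_def intro!: exI[of _ 0])
    ultimately show ?thesis by (auto simp: cox_degree_def)
  qed
  have eq: "f = Poly_Mapping.single a0 1 * cox_embed (s+t) q g"
  proof (rule poly_mapping_eqI)
    fix x
    show "lookup f x = lookup (Poly_Mapping.single a0 1 * cox_embed (s+t) q g) x"
    proof (cases "x \<in> keys f")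
      case True
      then obtain u where "u \<in> dual_lattice N" "x = a0 + ?Q u" using shift by blast
      then show ?thesis by (simp add: lookup_single_mult lookup_cox_embed[OF gd] lg)
    next
      case False
      have "x - a0 \<notin> ?Q ` keys g"
      proof
        assume "x - a0 \<in> ?Q ` keys g"
        then obtain u where u: "u \<in> keys g" "x - a0 = ?Q u" by blast
        then have "x = a0 + ?Q u" by (metis add.commute diff_add_cancel)
        then show False using False u(1) kg by blast
      qed
      then have "lookup (cox_embed (s+t) q g) (x - a0) = 0" using keys_cox_embed[OF gd] by (metis in_keys_iff)
      then show ?thesis using False by (simp add: lookup_single_mult in_keys_iff)
    qed
  qed
  let ?m = "Poly_Mapping.single (- a0) (1::trop)"
  have "cox_embed (s+t) q g = ?m * f"
    by (subst eq) (simp add: mult.assoc[symmetric] mult_single single_one)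
  moreover have "?m \<in> cox_localization (s+t) (cone_rays s q \<tau>)"
  proof -
    \<comment> \<open>With a bound \<open>K\<close> on the entries of \<open>a0\<close>, the power
      \<open>nat K\<close> of \<open>xhat\<close> clears the inverse monomial.\<close>
    have "bdd_above ((\<lambda>i. lookup a0 i) ` {1..s+t})" by (intro bdd_above_finite) auto
    then obtain K where K: "\<And>i. i \<in> {1..s+t} \<Longrightarrow> lookup a0 i \<le> K" unfolding bdd_above_def by blast
    let ?e = "xhat_exp (s+t) (cone_rays s q \<tau>) (nat K)"
    have "0 \<le> lookup (?e - a0) i" for i
    proof (cases "i \<in> {1..s+t}")
      case True
      then show ?thesis using K[OF True] a0(2)[of i] by (auto simp: lookup_minus lookup_xhat_exp)
    next
      case False
      then have "lookup a0 i = 0" using fS(1)[OF a0(1)] by (auto simp: in_keys_iff)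
      then show ?thesis using False by (simp add: lookup_minus lookup_xhat_exp)
    qed
    moreover have "keys (?e - a0) \<subseteq> {1..s+t}"
      using keys_xhat_exp fS(1)[OF a0(1)] keys_diff[of ?e a0] by blast
    ultimately have "Poly_Mapping.single (?e - a0) 1 \<in> cox_semiring (s+t)" by (intro single_in_cox_semiring)
    then show ?thesis unfolding cox_localization_def
      by (intro CollectI exI[of _ "nat K"]) (simp add: xhat_power mult_single)
  qed
  ultimately have "g \<in> local_ideal N s t q I \<tau>"
    using gP f(1) ideal_generated_mult by (auto simp: local_ideal_def polys_on_def)
  then show ?thesis using eq that by blast
qed

text \<open>A power of \<open>xhat\<close> clears denominators without involving the rays of
  \<open>\<tau>\<close>, and all exponents then lie in one coset of the image of
  \<open>Q\<close>.\<close>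

lemma local_ideal_homogenize:
  assumes \<tau>: "\<tau> \<in> \<Sigma>" and I: "semiring_ideal (cox_semiring (s+t)) I" and g: "g \<in> local_ideal N s t q I \<tau>"
  obtains a0 where "\<forall>i\<in>cone_rays s q \<tau>. lookup a0 i = 0"
    "Poly_Mapping.single a0 1 * cox_embed (s+t) q g \<in> I"
    "homogeneous N (s+t) q (Poly_Mapping.single a0 1 * cox_embed (s+t) q g)"
proof -
  have "cox_embed (s+t) q g \<in> ideal_generated (cox_localization (s+t) (cone_rays s q \<tau>)) I"
    using g by (simp add: local_ideal_def)
  then obtain k where k: "xhat (s+t) (cone_rays s q \<tau>) ^ k * cox_embed (s+t) q g \<in> I"
    using ideal_generated_localization[OF I] by blast
  define a0 where "a0 = xhat_exp (s+t) (cone_rays s q \<tau>) k"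
  have gd: "keys g \<subseteq> dual_lattice N" using local_ideal_keys[OF g] by (auto simp: dual_monoid_def)
  have "cox_degree N (s+t) q x = cox_degree N (s+t) q a0"
    if x: "x \<in> keys (Poly_Mapping.single a0 1 * cox_embed (s+t) q g)" for x
  proof -
    have "keys (Poly_Mapping.single a0 1 * cox_embed (s+t) q g) = (+) a0 ` Qvec (s+t) q ` keys g"
      using keys_cox_embed[OF gd] by (simp add: keys_single_mult)
    then obtain u where u: "u \<in> dual_lattice N" "x = a0 + Qvec (s+t) q u" using x gd by auto
    show ?thesis unfolding cox_degree_def
    proof (intro set_eqI iffI; clarify)
      fix u' assume "u' \<in> dual_lattice N"
      then show "\<exists>u''. x + Qvec (s+t) q u' = a0 + Qvec (s+t) q u'' \<and> u'' \<in> dual_lattice N"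
        using u by (intro exI[of _ "u + u'"]) (simp add: Qvec_add dual_lattice_add add.assoc)
    next
      fix u' assume u': "u' \<in> dual_lattice N"
      have "Qvec (s+t) q u' = Qvec (s+t) q u + Qvec (s+t) q (u' - u)"
        using Qvec_add[of u "u' - u"] u u' dual_lattice_diff by simp
      then show "\<exists>u''. a0 + Qvec (s+t) q u' = x + Qvec (s+t) q u'' \<and> u'' \<in> dual_lattice N"
        using u u' by (intro exI[of _ "u' - u"]) (simp add: dual_lattice_diff add.assoc)
    qed
  qed
  then have "homogeneous N (s+t) q (Poly_Mapping.single a0 1 * cox_embed (s+t) q g)" by (auto simp: homogeneous_def)
  moreover have "Poly_Mapping.single a0 1 * cox_embed (s+t) q g \<in> I" using k by (simp add: a0_def xhat_power)
  moreover have "\<forall>i\<in>cone_rays s q \<tau>. lookup a0 i = 0" by (simp add: a0_def lookup_xhat_exp)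
  ultimately show ?thesis using that by blast
qed

text \<open>If some term of \<open>f\<close> involves no ray of \<open>\<tau>\<close>, dividing by
  its monomial leads into the stratum ideal. Otherwise every term is infinite at the representative
  that is infinite on all rays of \<open>\<tau>\<close>.\<close>

lemma variety_ideal_subset_variety_poly:
  assumes I: "semiring_ideal (cox_semiring (s+t)) I" and f: "f \<in> I" "homogeneous N (s+t) q f"
  shows "variety_ideal N \<Sigma> s t q I \<subseteq> variety_poly N \<Sigma> s t q f"
proof clarify
  fix \<tau> X assume "(\<tau>, X) \<in> variety_ideal N \<Sigma> s t q I"
  then obtain v where \<tau>: "\<tau> \<in> \<Sigma>" and v: "v \<in> span N" "X = coset \<tau> v"
    and V: "\<And>h. h \<in> stratum_ideal N s t q I \<tau> \<Longrightarrow> h \<noteq> 0 \<Longrightarrow> min_twice (keys h) (\<lambda>u. lookup h u * TReal (u \<bullet> v))"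
    unfolding variety_ideal_def by blast
  obtain w where w: "(w, (\<tau>, X)) \<in> quotient_map N \<Sigma> s t q" "represents w \<tau> v"
    "\<And>i. i \<in> cone_rays s q \<tau> \<Longrightarrow> w i = TInf"
    using quotient_map_surj[OF \<tau> v(1)] v(2) by blast
  have "w \<in> affine_variety (s+t) f"
  proof (cases "\<exists>a0\<in>keys f. \<forall>i\<in>cone_rays s q \<tau>. lookup a0 i = 0")
    case True
    then obtain a0 where a0: "a0 \<in> keys f" "\<And>i. i \<in> cone_rays s q \<tau> \<Longrightarrow> lookup a0 i = 0" by blast
    obtain g where g: "g \<in> local_ideal N s t q I \<tau>" "f = Poly_Mapping.single a0 1 * cox_embed (s+t) q g"
      using homogeneous_dehomogenize[OF \<tau> I f a0] by blast
    have "terms_in (boundary_free \<tau>) g \<in> stratum_ideal N s t q I \<tau>" using g(1) unfolding stratum_ideal_def by blast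
    from V[OF this] show ?thesis
      using affine_variety_shift_iff[OF w(2) local_ideal_keys[OF g(1)] a0(2)] unfolding g(2) by metis
  next
    case False
    have "trop_term (s+t) f w a = TInf" if a: "a \<in> keys f" for a
    proof -
      obtain i where i: "i \<in> cone_rays s q \<tau>" "lookup a i \<noteq> 0" using False a by blast
      then have "(\<Prod>i\<in>{1..s+t}. trop_scale (of_int (lookup a i)) (w i)) = TInf"
        using w(3)[OF i(1)] cone_rays_subset[of \<tau>] by (subst trop_prod_eq_TInf_iff) (auto intro!: bexI[of _ i])
      moreover have "x * TInf = TInf" for x by (cases x) auto
      ultimately show ?thesis by (simp add: trop_term_def)
    qed
    then show ?thesis using w(2) by (simp add: affine_variety_def represents_def trop_sum_eq_TInf_iff)
  qed
  then show "(\<tau>, X) \<in> variety_poly N \<Sigma> s t q f"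
    unfolding variety_poly_def using w(1) represents_not_irrelevant[OF w(2)] by blast
qed

lemma finite_tropical_basis_exists:
  assumes lt: "locally_tropical N \<Sigma> s t q I"
  shows "\<exists>F. finite F \<and> F \<noteq> {} \<and> F \<subseteq> I \<and> (\<forall>f\<in>F. homogeneous N (s+t) q f) \<and>
    variety_ideal N \<Sigma> s t q I = (\<Inter>f\<in>F. variety_poly N \<Sigma> s t q f)"
proof -
  have I: "semiring_ideal (cox_semiring (s+t)) I" using lt by (simp add: locally_tropical_def homogeneous_ideal_def)
  let ?init = "\<lambda>v f. \<exists>u. initial_at (\<lambda>c a. 0 < c + a \<bullet> (v::'a)) f u"
  have "\<exists>H\<subseteq>stratum_ideal N s t q I \<tau>. finite H \<and>
     (\<forall>v. (\<exists>f\<in>stratum_ideal N s t q I \<tau>. ?init v f) \<longrightarrow> (\<exists>f\<in>H. ?init v f))" if "\<tau> \<in> \<Sigma>" for \<tau>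
    using stratum_laurent_tropical_ideal[OF that lt] laurent_tropical_ideal.finite_tropical_basis by blast
  then obtain H where H: "\<And>\<tau>. \<tau> \<in> \<Sigma> \<Longrightarrow> H \<tau> \<subseteq> stratum_ideal N s t q I \<tau>" "\<And>\<tau>. \<tau> \<in> \<Sigma> \<Longrightarrow> finite (H \<tau>)"
    "\<And>\<tau> v f. \<tau> \<in> \<Sigma> \<Longrightarrow> f \<in> stratum_ideal N s t q I \<tau> \<Longrightarrow> ?init v f \<Longrightarrow> \<exists>f\<in>H \<tau>. ?init v f"
    by metis
  \<comment> \<open>A lift restricts to \<open>h\<close> on the stratum of \<open>\<tau>\<close> up
    to a monomial that is finite there.\<close>
  define lifts where "lifts \<tau> h f \<longleftrightarrow> f \<in> I \<and> homogeneous N (s+t) q f \<and>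
     (\<exists>a0 g. (\<forall>i\<in>cone_rays s q \<tau>. lookup a0 i = 0) \<and> g \<in> local_ideal N s t q I \<tau> \<and>
       h = terms_in (boundary_free \<tau>) g \<and> f = Poly_Mapping.single a0 1 * cox_embed (s+t) q g)" for \<tau> h f
  have "\<exists>f. lifts \<tau> h f" if \<tau>h: "\<tau> \<in> \<Sigma>" "h \<in> stratum_ideal N s t q I \<tau>" for \<tau> h
  proof -
    obtain g where g: "g \<in> local_ideal N s t q I \<tau>" "h = terms_in (boundary_free \<tau>) g"
      using \<tau>h(2) unfolding stratum_ideal_def by blast
    obtain a0 where "\<forall>i\<in>cone_rays s q \<tau>. lookup a0 i = 0"
      "Poly_Mapping.single a0 1 * cox_embed (s+t) q g \<in> I"
      "homogeneous N (s+t) q (Poly_Mapping.single a0 1 * cox_embed (s+t) q g)"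
      by (rule local_ideal_homogenize[OF \<tau>h(1) I g(1)])
    then have "lifts \<tau> h (Poly_Mapping.single a0 1 * cox_embed (s+t) q g)"
      unfolding lifts_def using g by blast
    then show ?thesis ..
  qed
  then obtain l where l: "\<And>\<tau> h. \<tau> \<in> \<Sigma> \<Longrightarrow> h \<in> stratum_ideal N s t q I \<tau> \<Longrightarrow> lifts \<tau> h (l \<tau> h)" by metis
  \<comment> \<open>The zero polynomial vanishes everywhere. It keeps \<open>F\<close> nonempty and,
    in the reverse inclusion, provides \<open>\<tau> \<in> \<Sigma>\<close> and a representative
    \<open>v\<close> even if every \<open>H \<tau>\<close> is empty.\<close>
  define F where "F = insert 0 (\<Union>\<tau>\<in>\<Sigma>. l \<tau> ` H \<tau>)"
  have "finite \<Sigma>" using fan by (simp add: is_fan_def)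
  then have finF: "finite F" using H(2) by (auto simp: F_def)
  obtain f0 where "f0 \<in> I" using I by (auto simp: semiring_ideal_def)
  moreover have "0 \<in> cox_semiring (s+t)" by (simp add: cox_semiring_def polys_on_def)
  ultimately have "0 * f0 \<in> I" using I unfolding semiring_ideal_def by blast
  then have zero: "0 \<in> I \<and> homogeneous N (s+t) q 0" by (simp add: homogeneous_def)
  have "l \<tau> h \<in> I \<and> homogeneous N (s+t) q (l \<tau> h)" if "\<tau> \<in> \<Sigma>" "h \<in> H \<tau>" for \<tau> h
    using l[of \<tau> h] H(1)[of \<tau>] that unfolding lifts_def by blast
  then have FI: "f \<in> I \<and> homogeneous N (s+t) q f" if "f \<in> F" for f
    using that zero unfolding F_def by blast
  have "(\<tau>, X) \<in> variety_ideal N \<Sigma> s t q I" if mem: "\<And>f. f \<in> F \<Longrightarrow> (\<tau>, X) \<in> variety_poly N \<Sigma> s t q f" for \<tau> X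
  proof -
    have pt: "\<exists>w\<in>affine_variety (s+t) f. \<exists>v\<in>span N. X = coset \<tau> v \<and> represents w \<tau> v" if "f \<in> F" for f
      using mem[OF that] quotient_map_represents unfolding variety_poly_def by blast
    obtain v where v: "v \<in> span N" "X = coset \<tau> v" and \<tau>: "\<tau> \<in> \<Sigma>"
      using pt[of 0] by (auto simp: F_def represents_def)
    have "min_twice (keys h) (\<lambda>u. lookup h u * TReal (u \<bullet> v))"
      if h: "h \<in> stratum_ideal N s t q I \<tau>" "h \<noteq> 0" for h
    proof (rule ccontr)
      assume "\<not> ?thesis"
      then have "?init v h" using not_min_twice_iff[OF h(2)] by blast
      then obtain h' where h': "h' \<in> H \<tau>" "?init v h'" using H(3)[OF \<tau> h(1)] by blast
      have h'0: "h' \<noteq> 0" using h'(2) by (auto simp: initial_at_def)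
      have h'J: "h' \<in> stratum_ideal N s t q I \<tau>" using H(1)[OF \<tau>] h'(1) by blast
      obtain a0 g where g: "\<forall>i\<in>cone_rays s q \<tau>. lookup a0 i = 0" "g \<in> local_ideal N s t q I \<tau>"
        "h' = terms_in (boundary_free \<tau>) g" "l \<tau> h' = Poly_Mapping.single a0 1 * cox_embed (s+t) q g"
        using l[OF \<tau> h'J] unfolding lifts_def by blast
      have "l \<tau> h' \<in> F" using \<tau> h'(1) by (auto simp: F_def)
      then obtain w v' where w: "w \<in> affine_variety (s+t) (l \<tau> h')" "X = coset \<tau> v'" "represents w \<tau> v'"
        using pt by blast
      have "min_twice (keys h') (\<lambda>u. lookup h' u * TReal (u \<bullet> v'))"
        using w(1) h'0 affine_variety_shift_iff[OF w(3) local_ideal_keys[OF g(2)] bspec[OF g(1)]]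
        unfolding g(3)[symmetric] g(4) by blast
      \<comment> \<open>The point lying on the variety of the lift yields its own representative
        \<open>v'\<close> of the coset; exponents orthogonal to \<open>\<tau>\<close> do not see the
        difference from \<open>v\<close>.\<close>
      moreover have "u \<bullet> v' = u \<bullet> v" if "u \<in> keys h'" for u
      proof (rule coset_inner_eq)
        show "coset \<tau> v' = coset \<tau> v" using w(2) v(2) by simp
        have "u \<in> dual_monoid N \<tau>" "u \<in> boundary_free \<tau>"
          using that local_ideal_keys[OF g(2)] unfolding g(3) keys_terms_in by blast+
        then show "\<forall>x\<in>\<tau>. u \<bullet> x = 0" using boundary_free_iff[OF \<tau>] by blast
      qed
      ultimately have "min_twice (keys h') (\<lambda>u. lookup h' u * TReal (u \<bullet> v))"
        unfolding min_twice_iff[OF finite_keys] by (metis (no_types, lifting))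
      then show False using h'(2) not_min_twice_iff[OF h'0] by blast
    qed
    then show ?thesis unfolding variety_ideal_def using \<tau> v by blast
  qed
  then have "(\<Inter>f\<in>F. variety_poly N \<Sigma> s t q f) \<subseteq> variety_ideal N \<Sigma> s t q I" by auto
  moreover have "variety_ideal N \<Sigma> s t q I \<subseteq> (\<Inter>f\<in>F. variety_poly N \<Sigma> s t q f)"
    using variety_ideal_subset_variety_poly[OF I] FI by blast
  moreover have "F \<noteq> {}" by (simp add: F_def)
  ultimately show ?thesis using finF FI by blast
qed

end

theorem theorem5p9:
  fixes N :: "'a::euclidean_space set" and \<Sigma> :: "'a set set"
    and s t :: nat and q :: "nat \<Rightarrow> 'a"
    and I :: "((nat \<Rightarrow>\<^sub>0 int) \<Rightarrow>\<^sub>0 trop) set"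
  assumes "is_lattice N" and "is_fan N \<Sigma>" and "cox_matrix N \<Sigma> s t q"
    and "locally_tropical N \<Sigma> s t q I"
  shows "\<exists>F. finite F \<and> F \<noteq> {} \<and> F \<subseteq> I \<and> (\<forall>f\<in>F. homogeneous N (s+t) q f) \<and>
    variety_ideal N \<Sigma> s t q I = (\<Inter>f\<in>F. variety_poly N \<Sigma> s t q f)"
proof -
  interpret cox_fan N \<Sigma> s t q using assms(1-3) by unfold_locales
  show ?thesis using assms(4) by (rule finite_tropical_basis_exists)
qed

end
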